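(* For all $m,n\in\mathbb N$ with $m\ge2$, $$L_m\le C_{2,m,n}\le D_m.$$ Moreover, $$L_m=\sqrt2\left(1-\frac{\log2}{4m}+o(m^{-1})\right)\qquad (m\to\infty),$$ and $$\lim_{m\to\infty}\ \sup_{n\in\mathbb N}\,|C_{2,m,n}-\sqrt2|=0.$$
   Context: $\mathbb U$ is the open unit disc in $\mathbb C$, $\mathbb T$ the unit circle, $\mathbb U^n$ the unit polydisc, and $dm_n$ is normalized Haar measure on $\mathbb T^n$. A complex-valued $f\in C^2(\mathbb U^n)$ is pluriharmonic if $\partial^2 f/\partial z_j\partial\overline z_k=0$ for all $1\le j,k\le n$. For $0<p<\infty$, $h^p(\mathbb U^n)$ is the set of complex-valued pluriharmonic $f$ on $\mathbb U^n$ with $$\|f\|_{h^p(\mathbb U^n)}=\sup_{0<r<1}\Big(\int_{\mathbb T^n}|f(r\omega)|^p\,dm_n(\omega)\Big)^{1/p}<\infty.$$ For an integer $m\ge2$, $$d\mu_{\mathbf{m-2}}(z)=\frac{(m-1)^n}{\pi^n}\prod_{k=1}^n(1-|z_k|^2)^{m-2}\,dx_k\,dy_k,\qquad z_k=x_k+iy_k,$$ and for $0<q<\infty$, $\|f\|_{b^q_{\mathbf{m-2}}(\mathbb U^n)}=\big(\int_{\mathbb U^n}|f|^q\,d\mu_{\mathbf{m-2}}\big)^{1/q}$. For $1<p<\infty$, $C_{p,m,n}$ denotes the best (smallest) constant $C$ such that $\|f\|_{b^{mp}_{\mathbf{m-2}}(\mathbb U^n)}\le C\|f\|_{h^p(\mathbb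 U^n)}$ for all $f\in h^p(\mathbb U^n)$; here $p=2$. Further, $$D_m=\sqrt2\cos\left(\frac{\pi}{4m}\right),\qquad L_m=\left[\frac{(4m-2)!\,((m-1)!)^2}{2^m\,((2m-1)!)^2\,(2m-2)!}\right]^{1/(2m)}.$$ *)

theory Defs
  imports "HOL-Analysis.Analysis" "HOL-Library.Landau_Symbols"
begin

text \<open>
  The dimension \<open>n\<close> is quantified inside the theorem, so \<open>\<complex>\<^sup>n\<close> is represented by the
  functions \<open>nat \<Rightarrow> complex\<close> that are \<open>undefined\<close> outside \<open>{..<n}\<close>; on these the
  product topology of \<open>nat \<Rightarrow> complex\<close> is the usual one of \<open>\<complex>\<^sup>n\<close>.
\<close>

definition polydisc :: "nat \<Rightarrow> (nat \<Rightarrow> complex) set" where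
  "polydisc n = (\<Pi>\<^sub>E k\<in>{..<n}. ball 0 1)"

definition circle_measure :: "complex measure" where
  "circle_measure =
     distr (uniform_measure lborel {0..<2*pi}) (restrict_space borel (sphere 0 1)) cis"

definition torus_measure :: "nat \<Rightarrow> (nat \<Rightarrow> complex) measure" where
  "torus_measure n = (\<Pi>\<^sub>M k\<in>{..<n}. circle_measure)"

text \<open>
  Real partial derivative in the \<open>k\<close>-th complex variable: \<open>v = 1\<close> gives
  \<open>\<partial>/\<partial>x\<^sub>k\<close> and \<open>v = \<i>\<close> gives \<open>\<partial>/\<partial>y\<^sub>k\<close>.
\<close>

definition partial_deriv ::
    "nat \<Rightarrow> complex \<Rightarrow> ((nat \<Rightarrow> complex) \<Rightarrow> complex) \<Rightarrow> (nat \<Rightarrow> complex) \<Rightarrow> complex" where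
  "partial_deriv k v f z = vector_derivative (\<lambda>t::real. f (z(k := z k + t *\<^sub>R v))) (at 0)"

definition C1_on_polydisc :: "nat \<Rightarrow> ((nat \<Rightarrow> complex) \<Rightarrow> complex) \<Rightarrow> bool" where
  "C1_on_polydisc n f \<longleftrightarrow>
     continuous_on (polydisc n) f \<and>
     (\<forall>k<n. \<forall>v\<in>{1, \<i>}.
        (\<forall>z\<in>polydisc n. (\<lambda>t::real. f (z(k := z k + t *\<^sub>R v))) differentiable (at 0)) \<and>
        continuous_on (polydisc n) (partial_deriv k v f))"

definition C2_on_polydisc :: "nat \<Rightarrow> ((nat \<Rightarrow> complex) \<Rightarrow> complex) \<Rightarrow> bool" where
  "C2_on_polydisc n f \<longleftrightarrow>
     C1_on_polydisc n f \<and> (\<forall>k<n. \<forall>v\<in>{1, \<i>}. C1_on_polydisc n (partial_deriv k v f))"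

definition wirtinger ::
    "nat \<Rightarrow> ((nat \<Rightarrow> complex) \<Rightarrow> complex) \<Rightarrow> (nat \<Rightarrow> complex) \<Rightarrow> complex" where
  "wirtinger j f z = (partial_deriv j 1 f z - \<i> * partial_deriv j \<i> f z) / 2"

definition wirtinger_bar ::
    "nat \<Rightarrow> ((nat \<Rightarrow> complex) \<Rightarrow> complex) \<Rightarrow> (nat \<Rightarrow> complex) \<Rightarrow> complex" where
  "wirtinger_bar k f z = (partial_deriv k 1 f z + \<i> * partial_deriv k \<i> f z) / 2"

definition pluriharmonic :: "nat \<Rightarrow> ((nat \<Rightarrow> complex) \<Rightarrow> complex) \<Rightarrow> bool" where
  "pluriharmonic n f \<longleftrightarrow>
     C2_on_polydisc n f \<and>
     (\<forall>j<n. \<forall>k<n. \<forall>z\<in>polydisc n. wirtinger j (wirtinger_bar k f) z = 0)"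

text \<open>\<open>(\<integral>|f|\<^sup>p dM)\<^bsup>1/p\<^esup>\<close>, with value \<open>\<infinity>\<close> when the integral diverges.\<close>

definition Lp_norm :: "'a measure \<Rightarrow> real \<Rightarrow> ('a \<Rightarrow> complex) \<Rightarrow> ennreal" where
  "Lp_norm M p f =
     (let I = (\<integral>\<^sup>+ x. ennreal (cmod (f x) powr p) \<partial>M)
      in if I = \<infinity> then \<infinity> else ennreal (enn2real I powr (1 / p)))"

definition hardy_norm :: "nat \<Rightarrow> real \<Rightarrow> ((nat \<Rightarrow> complex) \<Rightarrow> complex) \<Rightarrow> ennreal" where
  "hardy_norm n p f =
     (SUP r\<in>{0<..<1::real}. Lp_norm (torus_measure n) p (\<lambda>\<omega>. f (\<lambda>k\<in>{..<n}. r *\<^sub>R \<omega> k)))"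

definition hardy_space :: "nat \<Rightarrow> real \<Rightarrow> ((nat \<Rightarrow> complex) \<Rightarrow> complex) set" where
  "hardy_space n p = {f. pluriharmonic n f \<and> hardy_norm n p f < \<infinity>}"

text \<open>The measure \<open>\<mu>\<^bsub>m-2\<^esub>\<close> on the polydisc, for \<open>m \<ge> 2\<close>.\<close>

definition bergman_measure :: "nat \<Rightarrow> nat \<Rightarrow> (nat \<Rightarrow> complex) measure" where
  "bergman_measure n m =
     density (restrict_space (\<Pi>\<^sub>M k\<in>{..<n}. lborel) (polydisc n))
       (\<lambda>z. ennreal ((real m - 1) ^ n / pi ^ n * (\<Prod>k<n. (1 - (cmod (z k))\<^sup>2) ^ (m - 2))))"

definition bergman_norm :: "nat \<Rightarrow> nat \<Rightarrow> real \<Rightarrow> ((nat \<Rightarrow> complex) \<Rightarrow> complex) \<Rightarrow> ennreal" where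
  "bergman_norm n m q f = Lp_norm (bergman_measure n m) q f"

text \<open>
  The constant \<open>C\<^bsub>p,m,n\<^esub>\<close>, as an extended real: it is \<open>\<infinity>\<close> if no real constant works.
\<close>

definition best_const :: "real \<Rightarrow> nat \<Rightarrow> nat \<Rightarrow> ereal" where
  "best_const p m n =
     Inf (ereal ` {C. 0 \<le> C \<and>
       (\<forall>f\<in>hardy_space n p. bergman_norm n m (real m * p) f \<le> ennreal C * hardy_norm n p f)})"

definition D_const :: "nat \<Rightarrow> real" where
  "D_const m = sqrt 2 * cos (pi / (4 * real m))"

definition L_const :: "nat \<Rightarrow> real" where
  "L_const m =
     (fact (4 * m - 2) * (fact (m - 1))\<^sup>2 /
       (2 ^ m * (fact (2 * m - 1))\<^sup>2 * fact (2 * m - 2))) powr (1 / (2 * real m))"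

end

theory Submission
  imports Defs "HOL-Complex_Analysis.Complex_Analysis" "HOL-Real_Asymp.Real_Asymp"
begin

text \<open>
  Split a pluriharmonic function as \<open>f = g + cnj h\<close> with \<open>g\<close>, \<open>h\<close> holomorphic and \<open>h(0) = 0\<close>.
  The pointwise Hollenbeck-Verbitsky type inequality
  \<open>|z + cnj w|^{2m} \<le> D_m^{2m} (|z|^2 + |w|^2)^m + b Re (2zw)^m\<close> integrates to an estimate without
  the last term, because \<open>(2gh)^m\<close> is holomorphic and vanishes at the origin; Minkowski's inequality
  and the contractivity of the inclusion of the Hardy space \<open>H^2\<close> into the weighted Bergman space
  then give the upper bound.  For the lower bound take \<open>f = 2 Re (1 / (1 - r z_1))\<close>
  with \<open>r \<rightarrow> 1\<close>: after expanding \<open>(g + cnj g)^{2m}\<close> every term is a power series in \<open>r^2\<close> that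
  is bounded below, by log-convexity of the factorial, by a multiple of \<open>(1 - r^2)^{-m}\<close>, and the
  multiples add up by Vandermonde's identity.
\<close>

section \<open>A pointwise inequality\<close>

text \<open>The splitting \<open>f = g + cnj h\<close> is never carried out for \<open>f\<close>
  itself, which would call for power series in several variables. On each smaller closed polydisc
  \<open>f\<close> is uniformly close to a pair of polynomials; the estimate is proved for such
  pairs, carried over to the dilations of \<open>f\<close>, and Fatou's lemma lets the dilation
  factor tend to 1. The constant \<open>D_m\<close> comes from the circle: for
  \<open>\<zeta> = cis (2 u)\<close> one has to bound
  \<open>2^m (cos u ^ (2 m) - K cos (2 m u))\<close>. The number \<open>K\<close> is the one that
  makes the first zero \<open>u0 = pi / (4 m)\<close> of the second term a critical point, and the
  value there is \<open>D_m ^ (2 m)\<close>. The kernels \<open>1 / (1 - r z_1)\<close> are extremal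
  for the contraction used in the upper bound, hence the natural test functions. They involve one
  coordinate only, so both bounds are free of \<open>n\<close>, which is the source of the
  uniformity in the last claim. In the asymptotics \<open>L_m\<close> is governed by a quotient of
  two central binomial ratios, so that the Wallis constant cancels and only its existence and
  positivity matter.\<close>

lemma power_above_tangent:
  fixes x y :: real
  assumes "0 \<le> x" "0 \<le> y"
  shows "x ^ Suc m + real (Suc m) * x ^ m * (y - x) \<le> y ^ Suc m"
proof (induction m)
  case (Suc m)
  have "x ^ Suc (Suc m) + real (Suc (Suc m)) * x ^ Suc m * (y - x)
      = y * (x ^ Suc m + real (Suc m) * x ^ m * (y - x)) - real (Suc m) * x ^ m * (y - x)\<^sup>2"
    by (simp add: algebra_simps power2_eq_square)
  also have "\<dots> \<le> y * (x ^ Suc m + real (Suc m) * x ^ m * (y - x))"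
    using assms by simp
  also have "\<dots> \<le> y * y ^ Suc m"
    using assms by (intro mult_left_mono Suc.IH)
  finally show ?case by simp
qed auto

text \<open>A form of \<open>tan (M u) >= M tan u\<close> free of division, since
  \<open>cos (M u)\<close> changes sign on the range. The difference of the two sides vanishes at 0
  and its derivative collapses to \<open>(M^2 - 1) sin u sin (M u)\<close>.\<close>

lemma sin_multiple_ge:
  fixes u :: real
  assumes "1 \<le> M" "0 \<le> u" "real M * u \<le> pi"
  shows "real M * sin u * cos (real M * u) \<le> sin (real M * u) * cos u"
proof -
  define k where "k = (\<lambda>u. sin (real M * u) * cos u - real M * sin u * cos (real M * u))"
  have "k 0 \<le> k u"
  proof (rule DERIV_nonneg_imp_nondecreasing[OF assms(2)])
    fix x assume x: "0 \<le> x" "x \<le> u"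
    have Mx: "real M * x \<le> pi" using x assms(3) by (meson mult_left_mono of_nat_0_le_iff order_trans)
    have xpi: "x \<le> pi"
      using x assms mult_right_mono[of 1 "real M" x] Mx by simp
    have "(k has_real_derivative ((real M)\<^sup>2 - 1) * (sin x * sin (real M * x))) (at x)"
      unfolding k_def
      by (auto intro!: derivative_eq_intros simp: algebra_simps power2_eq_square)
    moreover have "0 \<le> ((real M)\<^sup>2 - 1) * (sin x * sin (real M * x))"
      using assms(1) x Mx xpi
      by (intro mult_nonneg_nonneg sin_ge_zero) auto
    ultimately show "\<exists>y. (k has_real_derivative y) (at x) \<and> 0 \<le> y" by blast
  qed
  then show ?thesis by (simp add: k_def)
qed

text \<open>Where \<open>sin (N u) > 0\<close>, the derivative of
  \<open>cos u ^ N - K cos (N u)\<close> has the sign of \<open>K\<close> minus this quotient, so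
  monotonicity leaves a single sign change. By the addition theorem and
  \<open>cos^2 + sin^2 = 1\<close> the derivative of the quotient reduces to
  \<open>sin_multiple_ge\<close>.\<close>

lemma cos_power_sin_quotient_mono:
  fixes u v :: real
  assumes "1 \<le> M" "0 < u" "u \<le> v" "real (Suc M) * v < pi"
  shows "cos u ^ M * sin u / sin (real (Suc M) * u) \<le> cos v ^ M * sin v / sin (real (Suc M) * v)"
proof (rule DERIV_nonneg_imp_nondecreasing[OF assms(3), where f = "\<lambda>u. cos u ^ M * sin u / sin (real (Suc M) * u)"])
  fix x assume x: "u \<le> x" "x \<le> v"
  let ?N = "real (Suc M)"
  have Nx: "?N * x < pi" using x assms(4) by (meson mult_left_mono of_nat_0_le_iff order_le_less_trans)
  have x0: "0 < x" using x assms by simp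
  have s: "0 < sin (?N * x)" using Nx x0 by (intro sin_gt_zero) auto
  have Mx: "real M * x \<le> pi" using Nx x0 by (simp add: algebra_simps)
  have "2 * x \<le> ?N * x" using assms(1) x0 by (intro mult_right_mono) auto
  then have "x < pi / 2" using Nx by simp
  then have c: "0 < cos x" using x0 by (intro cos_gt_zero_pi) auto
  obtain K where K: "M = Suc K" using assms(1) by (cases M) auto
  define S where "S = sin (?N * x)"
  define C where "C = cos (?N * x)"
  have key: "((cos x)\<^sup>2 - real M * (sin x)\<^sup>2) * S - ?N * (cos x * sin x * C) \<ge> 0"
  proof -
    have A: "sin (?N * x) = sin (real M * x) * cos x + cos (real M * x) * sin x"
      "cos (?N * x) = cos (real M * x) * cos x - sin (real M * x) * sin x"
      by (simp_all add: algebra_simps sin_add cos_add)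
    have "((cos x)\<^sup>2 - real M * (sin x)\<^sup>2) * S - ?N * (cos x * sin x * C)
        = ((cos x)\<^sup>2 + (sin x)\<^sup>2) * (sin (real M * x) * cos x - real M * sin x * cos (real M * x))"
      unfolding S_def C_def A unfolding of_nat_Suc by algebra
    then show ?thesis using sin_multiple_ge[OF assms(1) less_imp_le[OF x0] Mx] by simp
  qed
  have "((\<lambda>u. cos u ^ M * sin u / sin (?N * u)) has_real_derivative
      (cos x ^ K * (((cos x)\<^sup>2 - real M * (sin x)\<^sup>2) * S - ?N * (cos x * sin x * C))) / S\<^sup>2) (at x)"
  proof -
    have "0 < K \<Longrightarrow> cos x ^ K = cos x * cos x ^ (K - Suc 0)" by (cases K) auto
    then show ?thesis
      using s unfolding K S_def C_def
      by (auto intro!: derivative_eq_intros simp: field_simps power2_eq_square)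
  qed
  moreover have "0 \<le> (cos x ^ K * (((cos x)\<^sup>2 - real M * (sin x)\<^sup>2) * S - ?N * (cos x * sin x * C))) / S\<^sup>2"
    using key c by (intro divide_nonneg_nonneg mult_nonneg_nonneg) auto
  ultimately show "\<exists>y. ((\<lambda>u. cos u ^ M * sin u / sin (?N * u)) has_real_derivative y) (at x) \<and> 0 \<le> y"
    by blast
qed

text \<open>\<open>u0\<close> is the first zero of \<open>cos (N u)\<close>, and the coefficient
  \<open>K\<close> makes it a critical point of \<open>f u = cos u ^ N - K cos (N u)\<close>. This
  \<open>f\<close> rises up to \<open>u0\<close> and falls from there to \<open>pi / N\<close>, so
  the claim is \<open>f u <= f u0\<close>.\<close>

lemma cos_power_le:
  fixes u :: real and M :: nat
  defines "N \<equiv> Suc M"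
  defines "u0 \<equiv> pi / (2 * real N)"
  assumes M: "1 \<le> M" and u: "0 \<le> u" "u \<le> pi / 2"
  shows "cos u ^ N \<le> cos u0 ^ N + cos u0 ^ M * sin u0 * cos (real N * u)"
proof -
  define K where "K = cos u0 ^ M * sin u0"
  define f where "f = (\<lambda>u. cos u ^ N - K * cos (real N * u))"
  have N2: "2 \<le> real N" using M by (simp add: N_def)
  have u0: "0 < u0" "u0 < pi / real N" "real N * u0 = pi / 2" "u0 \<le> pi / 4"
    using N2 by (auto simp: u0_def field_simps)
  have piN: "pi / real N \<le> pi / 2" using N2 by (intro divide_left_mono) auto
  have K0: "0 \<le> K"
    unfolding K_def using u0 by (intro mult_nonneg_nonneg zero_le_power cos_ge_zero sin_ge_zero) auto
  have quot0: "cos u0 ^ M * sin u0 / sin (real N * u0) = K"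
    unfolding u0(3) K_def by simp
  have df: "(f has_real_derivative real N * (K * sin (real N * x) - cos x ^ M * sin x)) (at x)" for x
  proof -
    have "cos x ^ M = cos x * cos x ^ (M - 1)" using M by (cases M) auto
    then show ?thesis
      unfolding f_def N_def by (auto intro!: derivative_eq_intros simp: algebra_simps)
  qed
  have fu0: "f u0 = cos u0 ^ N" unfolding f_def u0(3) by simp
  have left: "f v \<le> f u0" if v: "0 \<le> v" "v \<le> u0" for v
  proof (rule DERIV_nonneg_imp_nondecreasing[OF v(2)])
    fix x assume x: "v \<le> x" "x \<le> u0"
    have "cos x ^ M * sin x \<le> K * sin (real N * x)"
    proof (cases "x = 0")
      case False
      then have x0: "0 < x" using x v by simp
      have Nx: "real N * x < pi" "real N * u0 < pi"
        using x u0 N2 mult_left_mono[of x u0 "real N"] pi_gt_zero by linarith+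
      have "cos x ^ M * sin x / sin (real N * x) \<le> K"
        using cos_power_sin_quotient_mono[OF M x0 x(2)] Nx quot0 unfolding N_def by simp
      moreover have "0 < sin (real N * x)" using Nx x0 N2 by (intro sin_gt_zero) auto
      ultimately show ?thesis by (simp add: field_simps)
    qed auto
    then show "\<exists>y. (f has_real_derivative y) (at x) \<and> 0 \<le> y"
      using df[of x] by (intro exI[of _ "real N * (K * sin (real N * x) - cos x ^ M * sin x)"] conjI) auto
  qed
  have right: "f v \<le> f u0" if v: "u0 \<le> v" "v \<le> pi / real N" for v
  proof (rule DERIV_nonpos_imp_nonincreasing[OF v(1)])
    fix x assume x: "u0 \<le> x" "x \<le> v"
    have xpos: "0 < x" using x u0 by simp
    have "cos x ^ M * sin x \<ge> K * sin (real N * x)"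
    \<comment> \<open>At this endpoint \<open>sin (N x) = 0\<close>, so the quotient says nothing
      and the sign is checked directly.\<close>
    proof (cases "x = pi / real N")
      case True
      then have "real N * x = pi" using N2 by simp
      moreover have "0 \<le> cos x ^ M * sin x"
      proof -
        have "x \<le> pi / 2" using True piN by simp
        then show ?thesis
          using xpos pi_gt_zero
          by (intro mult_nonneg_nonneg zero_le_power cos_ge_zero sin_ge_zero) linarith+
      qed
      ultimately show ?thesis by simp
    next
      case False
      then have "x < pi / real N" using x v by simp
      then have Nx: "real N * x < pi" using N2 by (simp add: field_simps)
      have "K \<le> cos x ^ M * sin x / sin (real N * x)"
        using cos_power_sin_quotient_mono[OF M u0(1) x(1)] Nx quot0 unfolding N_def by simp
      moreover have "0 < sin (real N * x)" using Nx xpos N2 by (intro sin_gt_zero) auto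
      ultimately show ?thesis by (simp add: field_simps)
    qed
    then show "\<exists>y. (f has_real_derivative y) (at x) \<and> y \<le> 0"
      using df[of x] by (intro exI[of _ "real N * (K * sin (real N * x) - cos x ^ M * sin x)"] conjI) (auto intro!: mult_nonneg_nonpos)
  qed
  have "f u \<le> f u0"
  proof (cases "u \<le> pi / real N")
    case True
    then show ?thesis using left[of u] right[of u] u by linarith
  next
    case False
    \<comment> \<open>Past \<open>pi / N\<close> a crude comparison suffices: \<open>cos u\<close>
      has dropped below \<open>cos (pi / N)\<close>, and \<open>- K cos (N u)\<close> never exceeds
      \<open>K\<close>, its value at \<open>pi / N\<close>.\<close>
    have "cos u ^ N \<le> cos (pi / real N) ^ N"
      using False u piN by (intro power_mono cos_monotone_0_pi_le cos_ge_zero) auto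
    moreover have "- K * cos (real N * u) \<le> K"
      using mult_left_mono[OF cos_ge_minus_one K0, of "real N * u"] by simp
    moreover have "real N * (pi / real N) = pi" using N2 by simp
    ultimately have "f u \<le> f (pi / real N)" unfolding f_def by simp
    also have "\<dots> \<le> f u0" using right[of "pi / real N"] u0 by simp
    finally show ?thesis .
  qed
  then show ?thesis unfolding fu0 by (simp add: f_def K_def)
qed

text \<open>\<open>2 ^ m\<close> times the coefficient of \<open>cos_power_le\<close> for
  \<open>N = 2 * m\<close>, where \<open>u0 = pi / (4 * m)\<close>. The power of 2 comes from
  \<open>1 + Re \<zeta> = 2 (cos u)^2\<close>.\<close>

definition hv_coeff :: "nat \<Rightarrow> real" where
  "hv_coeff m = 2 ^ m * cos (pi / (4 * real m)) ^ (2 * m - 1) * sin (pi / (4 * real m))"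

lemma D_const_power: "D_const m ^ (2 * m) = 2 ^ m * cos (pi / (4 * real m)) ^ (2 * m)"
  by (simp add: D_const_def power_mult_distrib power_mult)

text \<open>Half-angle substitution: with \<open>\<zeta> = cis t\<close> and
  \<open>u = |t| / 2\<close> this is \<open>cos_power_le\<close> for \<open>N = 2 * m\<close>. Since
  the cosine is even, the absolute value costs nothing and brings \<open>u\<close> into
  \<open>[0, pi / 2]\<close>.\<close>

lemma hv_circle:
  assumes m: "1 \<le> m" and z: "cmod \<zeta> = 1"
  shows "(1 + Re \<zeta>) ^ m - hv_coeff m * Re (\<zeta> ^ m) \<le> D_const m ^ (2 * m)"
proof -
  define t where "t = Arg \<zeta>"
  have \<zeta>: "\<zeta> = cis t"
    using z Arg_eq[of \<zeta>] by (cases "\<zeta> = 0") (simp_all add: t_def cis_conv_exp)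
  have t: "\<bar>t\<bar> \<le> pi" using Arg_bounded[of \<zeta>] by (auto simp: t_def)
  define u where "u = \<bar>t\<bar> / 2"
  have u: "0 \<le> u" "u \<le> pi / 2" using t by (auto simp: u_def)
  have "Re \<zeta> = cos (2 * u)" by (simp add: \<zeta> u_def)
  then have A: "1 + Re \<zeta> = 2 * (cos u)\<^sup>2" by (simp add: cos_double_cos)
  have "Re (\<zeta> ^ m) = cos (real m * \<bar>t\<bar>)" by (simp add: \<zeta> Complex.DeMoivre abs_if)
  then have B: "Re (\<zeta> ^ m) = cos (real (2 * m) * u)" by (simp add: u_def)
  have S: "Suc (2 * m - 1) = 2 * m" using m by simp
  have eq: "pi / (2 * real (2 * m)) = pi / (4 * real m)" by simp
  have "1 \<le> 2 * m - 1" using m by simp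
  from cos_power_le[OF this u, unfolded S eq]
  have "2 ^ m * cos u ^ (2 * m) \<le> 2 ^ m * (cos (pi / (4 * real m)) ^ (2 * m) +
      cos (pi / (4 * real m)) ^ (2 * m - 1) * sin (pi / (4 * real m)) * cos (real (2 * m) * u))"
    by (intro mult_left_mono) auto
  then show ?thesis unfolding A B D_const_power hv_coeff_def
    by (simp add: power_mult_distrib algebra_simps flip: power_mult)
qed

text \<open>
  Replacing the convex function \<open>(1 + x)^m\<close> by its tangent at \<open>Re \<zeta>\<close> leaves a harmonic
  function, so the estimate on the circle propagates inside by the maximum principle.
\<close>

lemma hv_disc:
  assumes m: "1 \<le> m" and z: "cmod \<zeta> \<le> 1"
  shows "(1 + Re \<zeta>) ^ m - hv_coeff m * Re (\<zeta> ^ m) \<le> D_const m ^ (2 * m)"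
proof -
  obtain k where k: "m = Suc k" using m by (cases m) auto
  define x where "x = 1 + Re \<zeta>"
  have x: "0 \<le> x" using z abs_Re_le_cmod[of \<zeta>] by (simp add: x_def)
  define H :: "complex \<Rightarrow> complex" where "H = (\<lambda>w. of_real (x ^ m) + of_real (real m * x ^ k) * (1 + w - of_real x)
      - of_real (hv_coeff m) * w ^ m)"
  have ReH: "Re (H w) = x ^ m + real m * x ^ k * (1 + Re w - x) - hv_coeff m * Re (w ^ m)" for w
    by (simp add: H_def)
  have "Re (H \<zeta>) \<le> D_const m ^ (2 * m)"
  proof (rule maximum_real_frontier[where S = "cball 0 1" and f = H])
    show "H holomorphic_on interior (cball 0 1)" "continuous_on (closure (cball 0 1)) H"
      unfolding H_def by (intro holomorphic_intros continuous_intros)+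
    show "bounded (cball (0::complex) 1)" "\<zeta> \<in> cball 0 1" using z by auto
    fix w assume "w \<in> frontier (cball (0::complex) 1)"
    then have w: "cmod w = 1" by simp
    then have "0 \<le> 1 + Re w" using abs_Re_le_cmod[of w] by simp
    from power_above_tangent[OF x this, of k]
    have "Re (H w) \<le> (1 + Re w) ^ m - hv_coeff m * Re (w ^ m)"
      unfolding ReH k by simp
    also note hv_circle[OF m w]
    finally show "Re (H w) \<le> D_const m ^ (2 * m)" .
  qed
  then show ?thesis unfolding ReH by (simp add: x_def)
qed

text \<open>Both sides are homogeneous of degree \<open>2 * m\<close>. With
  \<open>Q = |z|^2 + |w|^2\<close> the left side is \<open>(Q + Re (2 z w)) ^ m\<close>, so division
  by \<open>Q ^ m\<close> leaves \<open>hv_disc\<close> at the point \<open>2 z w / Q\<close>, which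
  lies in the closed unit disc because \<open>2 |z| |w| <= Q\<close>.\<close>

lemma hollenbeck_verbitsky:
  assumes m: "1 \<le> m"
  shows "cmod (z + cnj w) ^ (2 * m)
    \<le> D_const m ^ (2 * m) * ((cmod z)\<^sup>2 + (cmod w)\<^sup>2) ^ m + hv_coeff m * Re ((2 * z * w) ^ m)"
proof (cases "(cmod z)\<^sup>2 + (cmod w)\<^sup>2 = 0")
  case True
  then have "cmod z = 0" "cmod w = 0" by (auto simp: add_nonneg_eq_0_iff)
  then show ?thesis using m by (simp add: power_0_left)
next
  case False
  define Q where "Q = (cmod z)\<^sup>2 + (cmod w)\<^sup>2"
  have Q: "0 < Q" using False by (simp add: Q_def add_nonneg_eq_0_iff less_le)
  define \<zeta> where "\<zeta> = 2 * z * w / of_real Q"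
  have zw: "2 * z * w = of_real Q * \<zeta>" using Q by (simp add: \<zeta>_def)
  have "2 * (cmod z * cmod w) \<le> Q"
    using sum_squares_bound[of "cmod z" "cmod w"] by (simp add: Q_def)
  then have "cmod \<zeta> \<le> 1" using Q by (simp add: \<zeta>_def norm_mult norm_divide)
  note hv_disc[OF m this]
  then have "Q ^ m * ((1 + Re \<zeta>) ^ m - hv_coeff m * Re (\<zeta> ^ m)) \<le> Q ^ m * D_const m ^ (2 * m)"
    using Q by (intro mult_left_mono) auto
  moreover have "cmod (z + cnj w) ^ (2 * m) = (Q * (1 + Re \<zeta>)) ^ m"
  proof -
    have "(cmod (z + cnj w))\<^sup>2 = Q + Re (2 * z * w)"
      unfolding Q_def by (simp add: cmod_power2) (simp add: power2_eq_square algebra_simps)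
    also have "\<dots> = Q * (1 + Re \<zeta>)" unfolding zw by (simp add: algebra_simps)
    finally show ?thesis by (simp add: power_mult)
  qed
  moreover have "Re ((2 * z * w) ^ m) = Q ^ m * Re (\<zeta> ^ m)"
    unfolding zw by (simp add: power_mult_distrib flip: of_real_power)
  ultimately show ?thesis
    unfolding Q_def[symmetric] by (simp add: power_mult_distrib right_diff_distrib mult.commute mult.left_commute)
qed

section \<open>Moments of the Bergman and torus measures\<close>

lemma borel_ball [measurable]: "ball (c::'a::metric_space) r \<in> sets borel"
  by simp

lemma indicator_ball_measurable [measurable, simp]:
  "(indicator (ball (c::'a::metric_space) r) :: 'a \<Rightarrow> ennreal) \<in> borel_measurable borel"
  by (rule borel_measurable_indicator) simp

text \<open>Both orders of integration are recorded because the two kinds of shear translate along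
  different axes.\<close>

lemma nn_integral_lborel_complex:
  fixes f :: "complex \<Rightarrow> ennreal"
  assumes [measurable]: "f \<in> borel_measurable borel"
  shows "(\<integral>\<^sup>+ x. \<integral>\<^sup>+ y. f (Complex x y) \<partial>lborel \<partial>lborel) = integral\<^sup>N lborel f"
    and "(\<integral>\<^sup>+ y. \<integral>\<^sup>+ x. f (Complex x y) \<partial>lborel \<partial>lborel) = integral\<^sup>N lborel f"
proof -
  define T :: "real \<times> real \<Rightarrow> complex" where "T = (\<lambda>p. Complex (fst p) (snd p))"
  have "continuous_on UNIV T"
    unfolding T_def Complex_eq by (intro continuous_intros)
  then have T[measurable]: "T \<in> borel_measurable (lborel \<Otimes>\<^sub>M lborel)"
    unfolding lborel_prod using borel_measurable_continuous_onI by auto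
  have *: "lborel = distr (lborel \<Otimes>\<^sub>M lborel) borel T"
  proof (rule lborel_eqI)
    fix l u :: complex
    assume lu: "\<And>b. b \<in> Basis \<Longrightarrow> l \<bullet> b \<le> u \<bullet> b"
    have "T -` box l u = {Re l<..<Re u} \<times> {Im l<..<Im u}"
      by (auto simp: T_def in_box_complex_iff)
    moreover have "Re l \<le> Re u" "Im l \<le> Im u"
      using lu[of 1] lu[of \<i>] by (auto simp: Basis_complex_def)
    ultimately show "emeasure (distr (lborel \<Otimes>\<^sub>M lborel) borel T) (box l u) = (\<Prod>b\<in>Basis. (u - l) \<bullet> b)"
      by (simp add: emeasure_distr space_pair_measure lborel.emeasure_pair_measure_Times
          Basis_complex_def ennreal_mult)
  qed simp
  have fT: "(\<lambda>p. f (T p)) \<in> borel_measurable (lborel \<Otimes>\<^sub>M lborel)" by measurable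
  have "integral\<^sup>N lborel f = (\<integral>\<^sup>+ p. f (T p) \<partial>(lborel \<Otimes>\<^sub>M lborel))"
    by (subst *) (simp add: nn_integral_distr)
  moreover have "(\<integral>\<^sup>+ p. f (T p) \<partial>(lborel \<Otimes>\<^sub>M lborel)) = (\<integral>\<^sup>+ x. \<integral>\<^sup>+ y. f (Complex x y) \<partial>lborel \<partial>lborel)"
    using lborel.nn_integral_fst[OF fT] by (simp add: T_def)
  moreover have "(\<integral>\<^sup>+ p. f (T p) \<partial>(lborel \<Otimes>\<^sub>M lborel)) = (\<integral>\<^sup>+ y. \<integral>\<^sup>+ x. f (Complex x y) \<partial>lborel \<partial>lborel)"
    using lborel_pair.nn_integral_snd[OF fT] by (simp add: T_def)
  ultimately show "(\<integral>\<^sup>+ x. \<integral>\<^sup>+ y. f (Complex x y) \<partial>lborel \<partial>lborel) = integral\<^sup>N lborel f"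
    "(\<integral>\<^sup>+ y. \<integral>\<^sup>+ x. f (Complex x y) \<partial>lborel \<partial>lborel) = integral\<^sup>N lborel f"
    by simp_all
qed

lemma continuous_on_Complex [continuous_intros]:
  "continuous_on A f \<Longrightarrow> continuous_on A g \<Longrightarrow> continuous_on A (\<lambda>x. Complex (f x) (g x))"
  unfolding Complex_eq by (intro continuous_intros)

text \<open>With the other coordinate fixed, a shear is a translation of a line, so it disappears in
  the inner integral.\<close>

lemma nn_integral_shear:
  fixes f :: "complex \<Rightarrow> ennreal"
  assumes f[measurable]: "f \<in> borel_measurable borel"
  shows "(\<integral>\<^sup>+ z. f (Complex (Re z + p * Im z) (Im z)) \<partial>lborel) = integral\<^sup>N lborel f"
    and "(\<integral>\<^sup>+ z. f (Complex (Re z) (Im z + p * Re z)) \<partial>lborel) = integral\<^sup>N lborel f"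
proof -
  have "(\<lambda>z. Complex (Re z + p * Im z) (Im z)) \<in> borel_measurable borel"
    by (intro borel_measurable_continuous_onI continuous_intros)
  then have m1: "(\<lambda>z. f (Complex (Re z + p * Im z) (Im z))) \<in> borel_measurable borel"
    by (rule measurable_compose) fact
  have "(\<lambda>z. Complex (Re z) (Im z + p * Re z)) \<in> borel_measurable borel"
    by (intro borel_measurable_continuous_onI continuous_intros)
  then have m2: "(\<lambda>z. f (Complex (Re z) (Im z + p * Re z))) \<in> borel_measurable borel"
    by (rule measurable_compose) fact
  have c: "(\<lambda>x. f (Complex x y)) \<in> borel_measurable borel"
    "(\<lambda>x. f (Complex y x)) \<in> borel_measurable borel" for y
    by (rule measurable_compose[OF _ f], intro borel_measurable_continuous_onI continuous_intros)+
  show "(\<integral>\<^sup>+ z. f (Complex (Re z + p * Im z) (Im z)) \<partial>lborel) = integral\<^sup>N lborel f"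
    unfolding nn_integral_lborel_complex(2)[OF m1, symmetric] nn_integral_lborel_complex(2)[OF f, symmetric]
    using nn_integral_real_affine[OF c(1), of 1 _ "p * _"] by (simp add: add.commute)
  show "(\<integral>\<^sup>+ z. f (Complex (Re z) (Im z + p * Re z)) \<partial>lborel) = integral\<^sup>N lborel f"
    unfolding nn_integral_lborel_complex(1)[OF m2, symmetric] nn_integral_lborel_complex(1)[OF f, symmetric]
    using nn_integral_real_affine[OF c(2), of 1 _ "p * _"] by (simp add: add.commute)
qed

text \<open>A rotation is the composition of three shears.\<close>

lemma distr_lborel_rotation:
  assumes t: "\<bar>t\<bar> < pi"
  shows "distr lborel borel (\<lambda>z. cis t * z) = lborel"
proof (rule measure_eqI)
  fix A assume "A \<in> sets (distr lborel borel (\<lambda>z. cis t * z))"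
  then have A[measurable]: "A \<in> sets borel" by simp
  \<comment> \<open>Multiplying out the three shear matrices and comparing with the rotation matrix
    forces these values; the bound on \<open>t\<close> makes \<open>cos (t / 2)\<close>
    nonzero.\<close>
  define p where "p = - tan (t / 2)"
  define q where "q = sin t"
  define X where "X z = Complex (Re z + p * Im z) (Im z)" for z
  define Y where "Y z = Complex (Re z) (Im z + q * Re z)" for z
  have XY[measurable]: "X \<in> borel_measurable borel" "Y \<in> borel_measurable borel"
    unfolding X_def[abs_def] Y_def[abs_def] by (intro borel_measurable_continuous_onI continuous_intros)+
  have "cos (t / 2) \<noteq> 0" using t by (intro less_imp_neq[symmetric] cos_gt_zero_pi) auto
  moreover have t2: "sin t = 2 * sin (t / 2) * cos (t / 2)" "cos t = 1 - 2 * (sin (t / 2))\<^sup>2"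
    using sin_double[of "t / 2"] cos_double_sin[of "t / 2"] by simp_all
  ultimately have pq: "1 + p * q = cos t"
    by (simp add: p_def q_def tan_def power2_eq_square)
  moreover have "p * (1 + cos t) = - sin t"
  proof -
    have "1 + cos t = 2 * (cos (t / 2))\<^sup>2" using cos_double_cos[of "t / 2"] by simp
    then show ?thesis using \<open>cos (t / 2) \<noteq> 0\<close>
      by (simp add: p_def tan_def t2(1) power2_eq_square)
  qed
  moreover have "2 + p * q = 1 + cos t" using pq by simp
  ultimately have p2: "p * (2 + p * q) = - sin t" by (simp only:)
  have eq: "cis t * z = X (Y (X z))" for z
  proof (rule complex_eqI)
    have "Re (X (Y (X z))) = (1 + p * q) * Re z + (p * (2 + p * q)) * Im z"
      by (simp add: X_def Y_def algebra_simps)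
    then show "Re (cis t * z) = Re (X (Y (X z)))" unfolding pq p2 by simp
    have "Im (X (Y (X z))) = (1 + p * q) * Im z + q * Re z"
      by (simp add: X_def Y_def algebra_simps)
    then show "Im (cis t * z) = Im (X (Y (X z)))" unfolding pq by (simp add: q_def)
  qed
  have "emeasure (distr lborel borel (\<lambda>z. cis t * z)) A
      = integral\<^sup>N (distr lborel borel (\<lambda>z. cis t * z)) (indicator A)"
    by (simp add: nn_integral_indicator)
  also have "\<dots> = (\<integral>\<^sup>+ z. indicator A (X (Y (X z))) \<partial>lborel)"
    by (subst nn_integral_distr) (simp_all add: eq)
  also have "\<dots> = (\<integral>\<^sup>+ z. indicator A (X (Y z)) \<partial>lborel)"
    using nn_integral_shear(1)[of "\<lambda>z. indicator A (X (Y z))" p] unfolding X_def[symmetric] by simp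
  also have "\<dots> = (\<integral>\<^sup>+ z. indicator A (X z) \<partial>lborel)"
    using nn_integral_shear(2)[of "\<lambda>z. indicator A (X z)" q] unfolding Y_def[symmetric] by simp
  also have "\<dots> = (\<integral>\<^sup>+ z. indicator A z \<partial>lborel)"
    using nn_integral_shear(1)[of "\<lambda>z. indicator A z" p] unfolding X_def[symmetric] by simp
  finally show "emeasure (distr lborel borel (\<lambda>z. cis t * z)) A = emeasure lborel A" by simp
qed simp

text \<open>Takes the place of polar coordinates: the annulus \<open>x < |z|^2 < 1\<close> has area
  \<open>pi (1 - x)\<close>, so the squared modulus of a point of the disc is uniformly distributed.
  Agreement on half-lines identifies the two measures.\<close>

lemma distr_cmod_square_disc:
  "distr (density lborel (indicator (ball 0 1))) borel (\<lambda>z::complex. (cmod z)\<^sup>2)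
    = density lborel (\<lambda>x::real. ennreal pi * indicator {0..1} x)" (is "?M = ?N")
proof (rule measure_eqI_lessThan)
  have M: "emeasure ?M {x<..} = emeasure lborel ({z\<in>ball 0 1. x < (cmod z)\<^sup>2} :: complex set)" for x
  proof -
    have "emeasure ?M {x<..} = emeasure (density lborel (indicator (ball 0 1))) {z::complex. x < (cmod z)\<^sup>2}"
      by (subst emeasure_distr) (auto intro!: arg_cong2[where f = emeasure])
    also have "\<dots> = emeasure lborel ({z\<in>ball 0 1. x < (cmod z)\<^sup>2} :: complex set)"
      by (subst emeasure_density)
        (auto simp flip: nn_integral_indicator intro!: nn_integral_cong split: split_indicator)
    finally show ?thesis .
  qed
  have N: "emeasure ?N {x<..} = ennreal pi * emeasure lborel ({0..1} \<inter> {x<..})" for x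
    by (subst emeasure_density)
      (auto simp: mult.assoc nn_integral_cmult simp flip: indicator_inter_arith)
  show "sets ?M = sets borel" "sets ?N = sets borel" by auto
  have ball: "emeasure lborel (ball (0::complex) 1) = ennreal pi"
    using emeasure_ball[of 1 "0::complex"] by (simp add: unit_ball_vol_2)
  show "emeasure ?M {x<..} < \<infinity>" for x
    unfolding M by (rule le_less_trans[OF emeasure_mono[of _ "ball 0 1"]]) (auto simp: ball)
  show "emeasure ?M {x<..} = emeasure ?N {x<..}" for x
  proof -
    have lt: "x < (cmod z)\<^sup>2 \<longleftrightarrow> sqrt x < cmod z" for z
      by (metis real_sqrt_less_iff real_sqrt_abs abs_norm_cancel)
    consider "x < 0" | "0 \<le> x" "x < 1" | "1 \<le> x" by linarith
    then show ?thesis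
    proof cases
      case 1
      then have "{z\<in>ball 0 1. x < (cmod z)\<^sup>2} = ball 0 1" "{0..1} \<inter> {x<..} = {0..1}"
        by (auto intro: less_le_trans)
      then show ?thesis unfolding M N by (simp add: ball)
    next
      case 2
      have "{z\<in>ball 0 1. x < (cmod z)\<^sup>2} = ball 0 1 - cball (0::complex) (sqrt x)"
        unfolding lt by auto
      moreover have "emeasure lborel (ball 0 1 - cball (0::complex) (sqrt x)) = ennreal pi - ennreal (pi * x)"
      proof -
        have sx: "sqrt x < 1" using 2 by simp
        show ?thesis
          using 2 by (subst emeasure_Diff)
            (auto simp: ball emeasure_cball unit_ball_vol_2 dest: le_less_trans[OF _ sx])
      qed
      moreover have "{0..1} \<inter> {x<..} = {x<..1}" using 2 by auto
      ultimately show ?thesis unfolding M N using 2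
        by (simp add: ennreal_minus algebra_simps flip: ennreal_mult)
    next
      case 3
      have "\<not> sqrt x < cmod z" if "cmod z < 1" for z
        using that 3 real_sqrt_ge_one[of x] by linarith
      then have "{z\<in>ball 0 1. x < (cmod z)\<^sup>2} = ({} :: complex set)" unfolding lt by auto
      moreover have "{0..1} \<inter> {x<..} = {}" using 3 by auto
      ultimately show ?thesis unfolding M N by (simp only: emeasure_empty) simp
    qed
  qed
qed

lemma Beta_nat:
  "((\<lambda>t::real. t ^ k * (1 - t) ^ l) has_integral fact k * fact l / fact (k + l + 1)) {0..1}"
proof -
  have "((\<lambda>t::real. t powr (real (k + 1) - 1) * (1 - t) powr (real (l + 1) - 1)) has_integral
      Beta (real (k + 1)) (real (l + 1))) {0<..<1}"
    using has_integral_Beta_real[of "real (k + 1)" "real (l + 1)"] by (simp add: has_integral_Icc_iff_Ioo)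
  moreover have "Beta (real (k + 1)) (real (l + 1)) = fact k * fact l / fact (k + l + 1)"
  proof -
    have "real (k + 1) + real (l + 1) = real (Suc (k + l + 1))" by simp
    then show ?thesis unfolding Beta_def using Gamma_fact[of k, where ?'a = real] Gamma_fact[of l, where ?'a = real]
      Gamma_fact[of "k + l + 1", where ?'a = real]  by (simp add: add_ac)
  qed
  ultimately have "((\<lambda>t::real. t ^ k * (1 - t) ^ l) has_integral fact k * fact l / fact (k + l + 1)) {0<..<1}"
    by (subst has_integral_cong[where g = "\<lambda>t::real. t powr (real (k + 1) - 1) * (1 - t) powr (real (l + 1) - 1)"])
      (auto simp: powr_realpow)
  then show ?thesis by (simp add: has_integral_Icc_iff_Ioo)
qed

definition disc_weight :: "nat \<Rightarrow> complex \<Rightarrow> real" where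
  "disc_weight m z = (real m - 1) / pi * (1 - (cmod z)\<^sup>2) ^ (m - 2)"

text \<open>The \<open>j\<close>-th moment of the squared modulus under
  \<open>disc_weight m\<close>. Its reciprocal is the coefficient of \<open>x ^ j\<close> in
  \<open>(1 - x) ^ (-m)\<close>, which ties the Bergman measure to \<open>m\<close>-th powers of
  geometric series.\<close>

definition moment_weight :: "nat \<Rightarrow> nat \<Rightarrow> real" where
  "moment_weight m j = 1 / real ((j + m - 1) choose j)"

text \<open>In the variable \<open>x = |z|^2\<close> this is a Beta integral, and the factor
  \<open>pi\<close> of the area cancels the one in the weight.\<close>

lemma nn_integral_disc_moment:
  assumes m: "2 \<le> m"
  shows "(\<integral>\<^sup>+ z. ennreal (((cmod z)\<^sup>2) ^ k * disc_weight m z) * indicator (ball 0 1) z \<partial>lborel)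
    = ennreal (moment_weight m k)"
proof -
  define F where "F = (\<lambda>x::real. ennreal (x ^ k * ((real m - 1) / pi * (1 - x) ^ (m - 2))))"
  have [measurable]: "F \<in> borel_measurable borel" unfolding F_def by measurable
  have "(\<integral>\<^sup>+ z. ennreal (((cmod z)\<^sup>2) ^ k * disc_weight m z) * indicator (ball 0 1) z \<partial>lborel)
      = (\<integral>\<^sup>+ z. F ((cmod z)\<^sup>2) \<partial>density lborel (indicator (ball 0 1)))"
    by (subst nn_integral_density) (auto simp: F_def disc_weight_def mult.commute)
  also have "\<dots> = integral\<^sup>N (distr (density lborel (indicator (ball 0 1))) borel (\<lambda>z::complex. (cmod z)\<^sup>2)) F"
    by (subst nn_integral_distr) auto
  also have "\<dots> = (\<integral>\<^sup>+ x. (ennreal pi * indicator {0..1} x) * F x \<partial>lborel)"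
    unfolding distr_cmod_square_disc by (subst nn_integral_density) auto
  also have "\<dots> = (\<integral>\<^sup>+ x. ennreal ((real m - 1) * (x ^ k * (1 - x) ^ (m - 2))) * indicator {0..1} x \<partial>lborel)"
    using m by (intro nn_integral_cong) (auto simp: F_def indicator_def simp flip: ennreal_mult)
  also have "\<dots> = ennreal ((real m - 1) * (fact k * fact (m - 2) / fact (k + (m - 2) + 1)))"
    using m by (intro nn_integral_has_integral_lebesgue' has_integral_mult_right Beta_nat) auto
  also have "(real m - 1) * (fact k * fact (m - 2) / fact (k + (m - 2) + 1)) = moment_weight m k"
  proof -
    obtain l where l: "m = Suc (Suc l)" using m by (metis Suc_le_D numeral_2_eq_2 Suc_le_mono)
    have "real ((k + Suc l) choose k) = fact (k + Suc l) / (fact k * fact (Suc l))"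
      using binomial_fact[of k "k + Suc l", where ?'a = real] by simp
    then show ?thesis by (simp add: moment_weight_def l field_simps)
  qed
  finally show ?thesis .
qed

lemma integrable_disc_moment:
  "integrable lborel (\<lambda>z. indicator (ball 0 1) z *\<^sub>R (disc_weight m z *\<^sub>R (z ^ a * cnj z ^ b)))"
proof (rule Bochner_Integration.integrable_bound
    [where f = "\<lambda>z. (\<bar>real m - 1\<bar> / pi) *\<^sub>R (indicator (ball 0 1) z :: real)"])
  show "integrable lborel (\<lambda>z::complex. (\<bar>real m - 1\<bar> / pi) *\<^sub>R (indicator (ball 0 1) z :: real))"
    by (intro integrable_scaleR_right integrable_real_indicator) (auto simp: emeasure_lborel_ball_finite[simplified])
  show "(\<lambda>z. indicator (ball 0 1) z *\<^sub>R (disc_weight m z *\<^sub>R (z ^ a * cnj z ^ b))) \<in> borel_measurable lborel"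
  proof -
    have [measurable]: "(\<lambda>z. disc_weight m z *\<^sub>R (z ^ a * cnj z ^ b)) \<in> borel_measurable borel"
      unfolding disc_weight_def by (intro borel_measurable_continuous_onI continuous_intros)
    show ?thesis by measurable
  qed
  have "norm (disc_weight m z *\<^sub>R (z ^ a * cnj z ^ b)) \<le> \<bar>real m - 1\<bar> / pi" if "cmod z < 1" for z
  proof -
    have "\<bar>disc_weight m z\<bar> \<le> \<bar>real m - 1\<bar> / pi * 1"
      unfolding disc_weight_def abs_mult abs_divide power_abs using that
      by (intro mult_mono power_le_one) (auto simp: abs_square_le_1)
    moreover have "cmod (z ^ a * cnj z ^ b) \<le> 1 * 1"
      unfolding norm_mult norm_power using that by (intro mult_mono power_le_one) auto
    ultimately have "\<bar>disc_weight m z\<bar> * cmod (z ^ a * cnj z ^ b) \<le> \<bar>real m - 1\<bar> / pi * 1"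
      by (intro mult_mono) auto
    then show ?thesis by simp
  qed
  then show "AE z in lborel. norm (indicator (ball 0 1) z *\<^sub>R (disc_weight m z *\<^sub>R (z ^ a * cnj z ^ b)))
      \<le> norm ((\<bar>real m - 1\<bar> / pi) *\<^sub>R (indicator (ball 0 1) z :: real))"
    by (intro AE_I2) (auto split: split_indicator)
qed

lemma integral_disc_moment:
  assumes m: "2 \<le> m"
  shows "(\<integral>z. indicator (ball 0 1) z *\<^sub>R (disc_weight m z *\<^sub>R (z ^ a * cnj z ^ b)) \<partial>lborel)
    = (if a = b then of_real (moment_weight m a) else 0)"
proof (cases "a = b")
  case True
  have "(\<integral>z. indicator (ball 0 1) z *\<^sub>R (disc_weight m z *\<^sub>R (z ^ a * cnj z ^ b)) \<partial>lborel)
     = (\<integral>z. complex_of_real (((cmod z)\<^sup>2) ^ a * disc_weight m z * indicator (ball 0 1) z) \<partial>lborel)"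
  proof (intro Bochner_Integration.integral_cong refl)
    fix z :: complex
    have "z ^ a * cnj z ^ a = of_real (((cmod z)\<^sup>2) ^ a)"
      unfolding power_mult_distrib[symmetric] complex_norm_square[symmetric] of_real_power[symmetric] ..
    then show "indicator (ball 0 1) z *\<^sub>R (disc_weight m z *\<^sub>R (z ^ a * cnj z ^ b))
        = complex_of_real (((cmod z)\<^sup>2) ^ a * disc_weight m z * indicator (ball 0 1) z)"
      using True by (simp add: scaleR_conv_of_real split: split_indicator)
  qed
  also have "\<dots> = of_real (\<integral>z. ((cmod z)\<^sup>2) ^ a * disc_weight m z * indicator (ball 0 1) z \<partial>lborel)"
    by (rule integral_complex_of_real)
  also have "(\<integral>z. ((cmod z)\<^sup>2) ^ a * disc_weight m z * indicator (ball 0 1) z \<partial>lborel) = moment_weight m a"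
  proof (subst integral_eq_nn_integral)
    show "(\<lambda>z. ((cmod z)\<^sup>2) ^ a * disc_weight m z * indicator (ball 0 1) z) \<in> borel_measurable lborel"
      unfolding disc_weight_def by measurable
    show "AE z in lborel. 0 \<le> ((cmod z)\<^sup>2) ^ a * disc_weight m z * indicator (ball 0 1) z"
      using m by (intro AE_I2) (auto simp: disc_weight_def abs_square_le_1 indicator_def intro!: mult_nonneg_nonneg zero_le_power)
    have "(\<integral>\<^sup>+ z. ennreal (((cmod z)\<^sup>2) ^ a * disc_weight m z * indicator (ball 0 1) z) \<partial>lborel)
      = (\<integral>\<^sup>+ z. ennreal (((cmod z)\<^sup>2) ^ a * disc_weight m z) * indicator (ball 0 1) z \<partial>lborel)"
      by (intro nn_integral_cong) (auto split: split_indicator)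
    then show "enn2real (\<integral>\<^sup>+ z. ennreal (((cmod z)\<^sup>2) ^ a * disc_weight m z * indicator (ball 0 1) z) \<partial>lborel)
      = moment_weight m a"
      unfolding nn_integral_disc_moment[OF m] by (simp add: moment_weight_def)
  qed
  finally show ?thesis using True by simp
next
  case False
  define d where "d = \<bar>real a - real b\<bar>"
  have d: "1 \<le> d" using False by (auto simp: d_def)
  \<comment> \<open>The angle makes \<open>t * (a - b)\<close> equal to \<open>pi / 2\<close> up to
    sign. The rotation then multiplies the integrand by \<open>c = \<i>\<close> or
    \<open>c = - \<i>\<close>, and invariance forces the integral to vanish. As \<open>d\<close> is
    at least 1, \<open>t\<close> stays below \<open>pi\<close>.\<close>
  define t where "t = pi / (2 * d)"
  have t: "\<bar>t\<bar> < pi" using d by (simp add: t_def field_simps)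
  define F where "F = (\<lambda>z. indicator (ball 0 1) z *\<^sub>R (disc_weight m z *\<^sub>R (z ^ a * cnj z ^ b)))"
  have [measurable]: "F \<in> borel_measurable borel"
    using integrable_disc_moment[of m a b] by (simp add: F_def integrable_iff_bounded)
  define c where "c = cis (t * (real a - real b))"
  have Fc: "F (cis t * z) = c * F z" for z
  proof -
    have "cis t ^ a * cnj (cis t) ^ b = c"
      by (simp add: c_def Complex.DeMoivre cis_mult right_diff_distrib mult.commute cis_cnj)
    then show ?thesis
      by (simp add: F_def disc_weight_def norm_mult power_mult_distrib mult_ac indicator_def scaleR_conv_of_real)
  qed
  have "integral\<^sup>L lborel F = (\<integral>z. F (cis t * z) \<partial>lborel)"
    by (subst distr_lborel_rotation[OF t, symmetric], subst integral_distr) auto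
  also have "\<dots> = c * integral\<^sup>L lborel F" unfolding Fc by simp
  finally have "(c - 1) * integral\<^sup>L lborel F = 0" by (simp add: algebra_simps)
  moreover have "c \<noteq> 1"
  proof -
    have "t * (real a - real b) = pi / 2 \<or> t * (real a - real b) = - (pi / 2)"
      using d by (auto simp: t_def d_def abs_if field_simps split: if_splits)
    then show ?thesis by (elim disjE; simp only: c_def; simp add: complex_eq_iff)
  qed
  ultimately show ?thesis using False by (simp add: F_def)
qed

section \<open>Monomial moments of the torus and Bergman measures\<close>

definition monomial :: "nat \<Rightarrow> (nat \<Rightarrow> nat) \<Rightarrow> (nat \<Rightarrow> complex) \<Rightarrow> complex" where
  "monomial n \<alpha> z = (\<Prod>k<n. z k ^ \<alpha> k)"

text \<open>
  Both measures of the theorem have this form: the weights are \<open>w = 1\<close> for the torus, and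
  for the Bergman measure the reciprocals of the numbers of weak compositions into \<open>m\<close> parts.
\<close>

locale moment_measure = finite_measure M for M :: "(nat \<Rightarrow> complex) measure" +
  fixes n :: nat and w :: "nat \<Rightarrow> real"
  assumes total: "emeasure M (space M) = 1"
    and coordinate [measurable]: "k < n \<Longrightarrow> (\<lambda>z. z k) \<in> borel_measurable M"
    and coordinate_le: "z \<in> space M \<Longrightarrow> k < n \<Longrightarrow> cmod (z k) \<le> 1"
    and moments: "integral\<^sup>L M (\<lambda>z. monomial n \<alpha> z * cnj (monomial n \<beta> z))
      = (if \<forall>k<n. \<alpha> k = \<beta> k then of_real (\<Prod>k<n. w (\<alpha> k)) else 0)"

lemma monomial_mult_cnj:
  "monomial n \<alpha> z * cnj (monomial n \<beta> z) = (\<Prod>k<n. z k ^ \<alpha> k * cnj (z k) ^ \<beta> k)"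
  by (simp add: monomial_def prod.distrib)

lemma prod_delta_all:
  fixes \<alpha> \<beta> :: "nat \<Rightarrow> nat" and w :: "nat \<Rightarrow> real"
  shows "(\<Prod>k<n. if \<alpha> k = \<beta> k then complex_of_real (w k) else 0)
    = (if \<forall>k<n. \<alpha> k = \<beta> k then of_real (\<Prod>k<n. w k) else 0)"
proof (cases "\<forall>k<n. \<alpha> k = \<beta> k")
  case False
  then obtain k where "k < n" "\<alpha> k \<noteq> \<beta> k" by blast
  then have "(\<Prod>k<n. if \<alpha> k = \<beta> k then complex_of_real (w k) else 0) = 0"
    by (intro prod_zero bexI[of _ k]) simp_all
  then show ?thesis using False by simp
qed (simp add: of_real_prod)

lemma borel_measurable_cnj [measurable (raw)]:
  "f \<in> borel_measurable M \<Longrightarrow> (\<lambda>x. cnj (f x)) \<in> borel_measurable M"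
  by (rule measurable_compose[OF _ borel_measurable_continuous_onI]) (auto intro: continuous_intros)

lemma cis_measurable_circle:
  "cis \<in> measurable (uniform_measure lborel {0..<2*pi}) (restrict_space borel (sphere 0 1))"
proof (rule measurable_restrict_space2)
  have "cis \<in> borel_measurable borel"
    by (intro borel_measurable_continuous_onI continuous_on_cis continuous_on_id)
  then show "cis \<in> borel_measurable (uniform_measure lborel {0..<2*pi})" by simp
qed auto

lemma circle_total: "emeasure circle_measure (space circle_measure) = 1"
proof -
  have "emeasure circle_measure (space circle_measure)
      = emeasure (uniform_measure lborel {0..<2*pi}) (cis -` sphere 0 1 \<inter> UNIV)"
    unfolding circle_measure_def space_distr
    by (subst emeasure_distr[OF cis_measurable_circle sets.top]) (simp add: space_restrict_space)
  also have "cis -` sphere 0 1 \<inter> UNIV = UNIV" by auto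
  also have "emeasure (uniform_measure lborel {0..<2*pi}) UNIV = 1"
    by (subst emeasure_uniform_measure) (auto simp: divide_ennreal)
  finally show ?thesis .
qed

lemma finite_measure_circle: "finite_measure circle_measure"
  by (rule finite_measureI) (simp add: circle_total)

lemma sets_circle: "sets circle_measure = sets (restrict_space borel (sphere 0 1))"
  and space_circle: "space circle_measure = sphere 0 1"
  by (simp_all add: circle_measure_def space_restrict_space)

lemma borel_measurable_circle:
  "f \<in> borel_measurable borel \<Longrightarrow> f \<in> borel_measurable circle_measure"
  unfolding measurable_cong_sets[OF sets_circle refl] by (rule measurable_restrict_space1)

lemma circle_moment:
  "(\<integral>z. z ^ a * cnj z ^ b \<partial>circle_measure) = (if a = b then 1 else 0)"
proof -
  define d where "d = real a - real b"
  have m[measurable]: "(\<lambda>z::complex. z ^ a * cnj z ^ b) \<in> borel_measurable borel"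
    by (intro borel_measurable_continuous_onI continuous_intros)
  have cis_d: "cis x ^ a * cnj (cis x) ^ b = cis (d * x)" for x
    by (simp add: d_def Complex.DeMoivre cis_mult algebra_simps cis_cnj)
  have [measurable]: "(\<lambda>x. cis (d * x)) \<in> borel_measurable borel"
    by (intro borel_measurable_continuous_onI continuous_intros continuous_on_cis)
  \<comment> \<open>The half-open interval is replaced by the closed one, to which the fundamental
    theorem of calculus applies; they differ by a null set.\<close>
  have dens: "uniform_measure lborel {0..<2*pi}
      = density lborel (\<lambda>x. ennreal (indicator {0..2*pi} x / (2 * pi)))"
    unfolding uniform_measure_def
  proof (rule density_cong)
    have "AE x in lborel. x \<noteq> 2 * pi" by (rule AE_lborel_singleton)
    then show "AE x in lborel. indicator {0..<2*pi} x / emeasure lborel {0..<2*pi}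
        = ennreal (indicator {0..2*pi} x / (2 * pi))"
      by eventually_elim (auto simp: indicator_def divide_ennreal simp flip: ennreal_1)
  qed auto
  have "(\<integral>z. z ^ a * cnj z ^ b \<partial>circle_measure) = (\<integral>x. cis (d * x) \<partial>uniform_measure lborel {0..<2*pi})"
    unfolding circle_measure_def
    by (subst integral_distr[OF cis_measurable_circle])
      (auto simp: cis_d intro!: measurable_restrict_space1)
  also have "\<dots> = (\<integral>x. (indicator {0..2*pi} x / (2 * pi)) *\<^sub>R cis (d * x) \<partial>lborel)"
    unfolding dens by (subst integral_density) auto
  also have "\<dots> = (\<integral>x. indicator {0..2*pi} x *\<^sub>R (cis (d * x) /\<^sub>R (2 * pi)) \<partial>lborel)"
    by (intro Bochner_Integration.integral_cong) (simp_all add: indicator_def inverse_eq_divide)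
  also have "\<dots> = (if a = b then 1 else 0)"
  proof (cases "a = b")
    case True
    have "(\<integral>x. indicator {0..2*pi} x *\<^sub>R (cis (d * x) /\<^sub>R (2 * pi)) \<partial>lborel)
        = of_real (2 * pi) /\<^sub>R (2 * pi) - of_real 0 /\<^sub>R (2 * pi)"
      using True
      by (intro integral_FTC_Icc) (auto simp: d_def intro!: derivative_eq_intros continuous_intros)
    then show ?thesis using True by (simp add: scaleR_conv_of_real)
  next
    case False
    then have d: "d \<noteq> 0" by (simp add: d_def)
    define F where "F = (\<lambda>x. cis (d * x) / (\<i> * of_real d) / of_real (2 * pi))"
    have "(\<integral>x. indicator {0..2*pi} x *\<^sub>R (cis (d * x) /\<^sub>R (2 * pi)) \<partial>lborel) = F (2 * pi) - F 0"
    proof (rule integral_FTC_Icc)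
      fix x :: real
      have "((\<lambda>x. cis (d * x)) has_vector_derivative d *\<^sub>R (\<i> * cis (d * x))) (at x within {0..2*pi})"
        by (auto intro!: derivative_eq_intros simp: has_vector_derivative_def)
      from has_vector_derivative_divide[OF has_vector_derivative_divide[OF this]]
      show "(F has_vector_derivative cis (d * x) /\<^sub>R (2 * pi)) (at x within {0..2*pi})"
        unfolding F_def by (rule has_vector_derivative_eq_rhs)
          (use d in \<open>simp add: scaleR_conv_of_real field_simps\<close>)
    qed (auto intro!: continuous_intros continuous_on_cis)
    \<comment> \<open>Here \<open>d\<close> is a real number; its integrality enters through
      \<open>cis_d\<close>, which expresses the value by natural powers of
      \<open>cis (2 * pi)\<close>.\<close>
    also have "cis (d * (2 * pi)) = 1"
    proof -
      have "cis (2 * pi) ^ a * cnj (cis (2 * pi)) ^ b = 1" by simp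
      then show ?thesis unfolding cis_d .
    qed
    then have "F (2 * pi) - F 0 = 0" by (simp add: F_def)
    finally show ?thesis using False by simp
  qed
  finally show ?thesis .
qed

lemma integrable_circle_moment: "integrable circle_measure (\<lambda>z. z ^ a * cnj z ^ b)"
proof -
  interpret finite_measure circle_measure by (rule finite_measure_circle)
  show ?thesis
  proof (rule integrable_const_bound[where B = 1])
    show "(\<lambda>z. z ^ a * cnj z ^ b) \<in> borel_measurable circle_measure"
      by (intro borel_measurable_circle borel_measurable_continuous_onI continuous_intros)
    show "AE z in circle_measure. norm (z ^ a * cnj z ^ b) \<le> 1"
      by (intro AE_I2) (simp add: space_circle norm_mult norm_power)
  qed
qed

lemma moment_measure_torus: "moment_measure (torus_measure n) n (\<lambda>_. 1)"
proof -
  interpret C: finite_measure circle_measure by (rule finite_measure_circle)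
  interpret P: product_sigma_finite "\<lambda>_::nat. circle_measure" ..
  have total: "emeasure (torus_measure n) (space (torus_measure n)) = 1"
    using P.product_nn_integral_prod[of "{..<n}" "\<lambda>_ _. 1"]
    by (simp add: torus_measure_def circle_total)
  show ?thesis
  proof (intro moment_measure.intro moment_measure_axioms.intro finite_measureI)
    show "emeasure (torus_measure n) (space (torus_measure n)) \<noteq> \<infinity>"
      "emeasure (torus_measure n) (space (torus_measure n)) = 1" by (simp_all add: total)
    show "(\<lambda>z. z k) \<in> borel_measurable (torus_measure n)" if "k < n" for k
      unfolding torus_measure_def
      by (rule measurable_compose[OF measurable_component_singleton[of k]])
        (use that in \<open>auto intro: borel_measurable_circle\<close>)
    show "cmod (z k) \<le> 1" if "z \<in> space (torus_measure n)" "k < n" for z k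
      using that by (auto simp: torus_measure_def space_PiM space_circle PiE_iff)
    show "(\<integral>z. monomial n \<alpha> z * cnj (monomial n \<beta> z) \<partial>torus_measure n)
        = (if \<forall>k<n. \<alpha> k = \<beta> k then of_real (\<Prod>k<n. 1) else 0)" for \<alpha> \<beta>
    proof -
      have "(\<integral>z. monomial n \<alpha> z * cnj (monomial n \<beta> z) \<partial>torus_measure n)
          = (\<Prod>k<n. \<integral>z. z ^ \<alpha> k * cnj z ^ \<beta> k \<partial>circle_measure)"
        unfolding monomial_mult_cnj torus_measure_def
        by (rule P.product_integral_prod) (auto intro: integrable_circle_moment)
      also have "\<dots> = (if \<forall>k<n. \<alpha> k = \<beta> k then of_real (\<Prod>k<n. 1) else 0)"
        unfolding circle_moment using prod_delta_all[of \<alpha> \<beta> "\<lambda>_. 1" n] unfolding of_real_1 .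
      finally show ?thesis .
    qed
  qed
qed

lemma polydisc_sets: "polydisc n \<in> sets (\<Pi>\<^sub>M k\<in>{..<n}. lborel)"
  unfolding polydisc_def by (intro sets_PiM_I_finite) auto

lemma polydisc_subset_space: "polydisc n \<subseteq> space (\<Pi>\<^sub>M k\<in>{..<n}. lborel)"
  by (auto simp: polydisc_def space_PiM)

lemma space_bergman: "space (bergman_measure n m) = polydisc n"
  using polydisc_subset_space[of n] by (auto simp: bergman_measure_def space_restrict_space)

lemma bergman_density:
  "(real m - 1) ^ n / pi ^ n * (\<Prod>k<n. (1 - (cmod (z k))\<^sup>2) ^ (m - 2)) = (\<Prod>k<n. disc_weight m (z k))"
  by (simp add: disc_weight_def prod.distrib power_divide prod_dividef)

text \<open>The value type is kept general: the total mass is computed with extended nonnegative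
  reals, the moments with real indicators.\<close>

lemma indicator_polydisc:
  assumes "z \<in> space (\<Pi>\<^sub>M k\<in>{..<n}. lborel)"
  shows "indicator (polydisc n) z = (\<Prod>k<n. indicator (ball 0 1) (z k) :: 'a::{comm_semiring_1,semiring_1_no_zero_divisors})"
proof (cases "z \<in> polydisc n")
  case True
  then show ?thesis by (auto simp: polydisc_def PiE_iff intro!: prod.neutral[symmetric])
next
  case False
  then obtain k where "k < n" "z k \<notin> ball 0 1"
    using assms by (auto simp: polydisc_def space_PiM PiE_iff)
  then have "(\<Prod>k<n. indicator (ball 0 1) (z k) :: 'a) = 0"
    by (intro prod_zero bexI[of _ k]) auto
  then show ?thesis using False by simp
qed

lemma disc_weight_nonneg: "2 \<le> m \<Longrightarrow> cmod z \<le> 1 \<Longrightarrow> 0 \<le> disc_weight m z"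
  by (auto simp: disc_weight_def abs_square_le_1 intro!: mult_nonneg_nonneg zero_le_power)

lemma disc_weight_measurable [measurable]: "disc_weight m \<in> borel_measurable borel"
  unfolding disc_weight_def[abs_def] by measurable

lemma moment_measure_bergman:
  assumes m: "2 \<le> m"
  shows "moment_measure (bergman_measure n m) n (moment_weight m)"
proof -
  let ?L = "\<Pi>\<^sub>M k\<in>{..<n}. (lborel :: complex measure)"
  interpret P: product_sigma_finite "\<lambda>_::nat. lborel :: complex measure" ..
  have [measurable]: "(\<lambda>z. z k) \<in> borel_measurable ?L" if "k < n" for k
    using measurable_component_singleton[of k "{..<n}" "\<lambda>_. lborel"] that by simp
  have dens[measurable]: "(\<lambda>z. \<Prod>k<n. disc_weight m (z k)) \<in> borel_measurable ?L"
    by (intro borel_measurable_prod measurable_compose[OF _ disc_weight_measurable]) auto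
  have dens_nonneg: "0 \<le> (\<Prod>k<n. disc_weight m (z k))" if "z \<in> polydisc n" for z
    using that m by (intro prod_nonneg disc_weight_nonneg) (auto simp: polydisc_def PiE_iff less_imp_le)
  have meas: "bergman_measure n m
      = density (restrict_space ?L (polydisc n)) (\<lambda>z. ennreal (\<Prod>k<n. disc_weight m (z k)))"
    unfolding bergman_measure_def bergman_density ..
  have coord: "(\<lambda>z. z k) \<in> borel_measurable (bergman_measure n m)" if "k < n" for k
    unfolding meas using that by (simp add: measurable_restrict_space1)
  have "emeasure (bergman_measure n m) (space (bergman_measure n m))
      = (\<integral>\<^sup>+ z. ennreal (\<Prod>k<n. disc_weight m (z k)) \<partial>restrict_space ?L (polydisc n))"
    unfolding meas by (subst emeasure_density)
      (auto intro!: measurable_restrict_space1 nn_integral_cong)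
  also have "\<dots> = (\<integral>\<^sup>+ z. ennreal (\<Prod>k<n. disc_weight m (z k)) * indicator (polydisc n) z \<partial>?L)"
    using polydisc_sets[of n] by (intro nn_integral_restrict_space) auto
  \<comment> \<open>The trivial power with exponent 0 turns every factor into the zeroth moment of
    \<open>nn_integral_disc_moment\<close>.\<close>
  also have "\<dots> = (\<integral>\<^sup>+ z. (\<Prod>k<n. ennreal (((cmod (z k))\<^sup>2) ^ 0 * disc_weight m (z k)) * indicator (ball 0 1) (z k)) \<partial>?L)"
  proof (intro nn_integral_cong)
    fix z :: "nat \<Rightarrow> complex" assume z: "z \<in> space ?L"
    show "ennreal (\<Prod>k<n. disc_weight m (z k)) * indicator (polydisc n) z
      = (\<Prod>k<n. ennreal (((cmod (z k))\<^sup>2) ^ 0 * disc_weight m (z k)) * indicator (ball 0 1) (z k))"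
    proof (cases "z \<in> polydisc n")
      case True
      then have "(\<Prod>k<n. ennreal (disc_weight m (z k)) * indicator (ball 0 1) (z k)) = (\<Prod>k<n. ennreal (disc_weight m (z k)))"
        by (intro prod.cong) (auto simp: polydisc_def PiE_iff)
      moreover have "(\<Prod>k<n. ennreal (disc_weight m (z k))) = ennreal (\<Prod>k<n. disc_weight m (z k))"
        using True m by (intro prod_ennreal disc_weight_nonneg) (auto simp: polydisc_def PiE_iff less_imp_le)
      ultimately show ?thesis using True by simp
    next
      case False
      then show ?thesis using indicator_polydisc[OF z, where ?'a = ennreal]
        by (simp add: prod.distrib)
    qed
  qed
  also have "\<dots> = (\<Prod>k<n. ennreal (moment_weight m 0))"
    unfolding nn_integral_disc_moment[OF m, symmetric]
    by (rule P.product_nn_integral_prod) auto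
  also have "\<dots> = 1" by (simp add: moment_weight_def)
  finally have total: "emeasure (bergman_measure n m) (space (bergman_measure n m)) = 1" .
  show ?thesis
  proof (intro moment_measure.intro moment_measure_axioms.intro finite_measureI)
    show "emeasure (bergman_measure n m) (space (bergman_measure n m)) \<noteq> \<infinity>"
      "emeasure (bergman_measure n m) (space (bergman_measure n m)) = 1" by (simp_all add: total)
    show "(\<lambda>z. z k) \<in> borel_measurable (bergman_measure n m)" if "k < n" for k
      using coord[OF that] .
    show "cmod (z k) \<le> 1" if "z \<in> space (bergman_measure n m)" "k < n" for z k
      using that by (auto simp: space_bergman polydisc_def PiE_iff less_imp_le)
    fix \<alpha> \<beta>
    have G: "(\<lambda>z. monomial n \<alpha> z * cnj (monomial n \<beta> z)) \<in> borel_measurable ?L"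
      unfolding monomial_mult_cnj by (intro borel_measurable_prod) measurable
    have "(\<integral>z. monomial n \<alpha> z * cnj (monomial n \<beta> z) \<partial>bergman_measure n m)
        = (\<integral>z. (\<Prod>k<n. disc_weight m (z k)) *\<^sub>R (monomial n \<alpha> z * cnj (monomial n \<beta> z)) \<partial>restrict_space ?L (polydisc n))"
      unfolding meas
      by (rule integral_density)
        (auto intro!: measurable_restrict_space1 dens_nonneg G simp: space_restrict_space)
    also have "\<dots> = (\<integral>z. indicator (polydisc n) z *\<^sub>R
        ((\<Prod>k<n. disc_weight m (z k)) *\<^sub>R (monomial n \<alpha> z * cnj (monomial n \<beta> z))) \<partial>?L)"
      using polydisc_sets[of n] by (intro integral_restrict_space) auto
    also have "\<dots> = (\<integral>z. (\<Prod>k<n. indicator (ball 0 1) (z k) *\<^sub>R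
        (disc_weight m (z k) *\<^sub>R (z k ^ \<alpha> k * cnj (z k) ^ \<beta> k))) \<partial>?L)"
      by (intro Bochner_Integration.integral_cong)
        (simp_all add: indicator_polydisc monomial_mult_cnj scaleR_conv_of_real prod.distrib of_real_prod)
    also have "\<dots> = (\<Prod>k<n. if \<alpha> k = \<beta> k then complex_of_real (moment_weight m (\<alpha> k)) else 0)"
      unfolding integral_disc_moment[OF m, symmetric]
      by (rule P.product_integral_prod) (simp, rule integrable_disc_moment)
    also have "\<dots> = (if \<forall>k<n. \<alpha> k = \<beta> k then of_real (\<Prod>k<n. moment_weight m (\<alpha> k)) else 0)"
      using prod_delta_all[of \<alpha> \<beta> "\<lambda>k. moment_weight m (\<alpha> k)" n] by simp
    finally show "(\<integral>z. monomial n \<alpha> z * cnj (monomial n \<beta> z) \<partial>bergman_measure n m)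
        = (if \<forall>k<n. \<alpha> k = \<beta> k then of_real (\<Prod>k<n. moment_weight m (\<alpha> k)) else 0)" .
  qed
qed

section \<open>Holomorphic polynomials and contractivity\<close>

text \<open>Polynomials as a class of functions closed under sums and products, so that powers,
  substitutions and dilations are immediate. Coefficients are recovered by
  \<open>hpoly_expand\<close> only where orthogonality is used.\<close>

inductive hpoly :: "nat \<Rightarrow> ((nat \<Rightarrow> complex) \<Rightarrow> complex) \<Rightarrow> bool" for n where
  hpoly_const: "hpoly n (\<lambda>z. c)"
| hpoly_coordinate: "k < n \<Longrightarrow> hpoly n (\<lambda>z. z k)"
| hpoly_add: "hpoly n f \<Longrightarrow> hpoly n g \<Longrightarrow> hpoly n (\<lambda>z. f z + g z)"
| hpoly_mult: "hpoly n f \<Longrightarrow> hpoly n g \<Longrightarrow> hpoly n (\<lambda>z. f z * g z)"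

lemma hpoly_power: "hpoly n f \<Longrightarrow> hpoly n (\<lambda>z. f z ^ m)"
  by (induction m) (auto intro: hpoly.intros)

lemma hpoly_sum: "(\<And>i. i \<in> I \<Longrightarrow> hpoly n (f i)) \<Longrightarrow> hpoly n (\<lambda>z. \<Sum>i\<in>I. f i z)"
  by (induction I rule: infinite_finite_induct) (auto intro: hpoly.intros)

lemma hpoly_diff: "hpoly n f \<Longrightarrow> hpoly n g \<Longrightarrow> hpoly n (\<lambda>z. f z - g z)"
  using hpoly_add[OF _ hpoly_mult[OF hpoly_const[of n "-1"]], of f g] by simp

lemma hpoly_bounded:
  assumes "hpoly n f"
  obtains B where "\<And>z. (\<And>k. k < n \<Longrightarrow> cmod (z k) \<le> 1) \<Longrightarrow> cmod (f z) \<le> B"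
proof -
  have "\<exists>B. \<forall>z. (\<forall>k<n. cmod (z k) \<le> 1) \<longrightarrow> cmod (f z) \<le> B"
    using assms
  proof induction
    case (hpoly_add f g)
    then obtain A B where "\<forall>z. (\<forall>k<n. cmod (z k) \<le> 1) \<longrightarrow> cmod (f z) \<le> A"
      "\<forall>z. (\<forall>k<n. cmod (z k) \<le> 1) \<longrightarrow> cmod (g z) \<le> B" by blast
    then show ?case by (intro exI[of _ "A + B"]) (auto intro!: norm_triangle_mono)
  next
    case (hpoly_mult f g)
    then obtain A B where "\<forall>z. (\<forall>k<n. cmod (z k) \<le> 1) \<longrightarrow> cmod (f z) \<le> A"
      "\<forall>z. (\<forall>k<n. cmod (z k) \<le> 1) \<longrightarrow> cmod (g z) \<le> B" by blast
    then show ?case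
      by (intro exI[of _ "A * B"]) (auto simp: norm_mult intro!: mult_mono intro: order_trans[OF norm_ge_zero])
  qed auto
  then show ?thesis using that by auto
qed

lemma monomial_add: "monomial n \<alpha> z * monomial n \<beta> z = monomial n (\<lambda>k. \<alpha> k + \<beta> k) z"
  by (simp add: monomial_def prod.distrib power_add)

text \<open>The exponents are made to vanish from \<open>n\<close> on, so that multi-indices of
  \<open>S\<close> agreeing on the first \<open>n\<close> places are equal; orthogonality of
  monomials sees only those places.\<close>

lemma hpoly_expand:
  assumes "hpoly n f"
  obtains S a where "finite S" "\<And>\<alpha> k. \<alpha> \<in> S \<Longrightarrow> n \<le> k \<Longrightarrow> \<alpha> k = 0"
    "\<And>z. f z = (\<Sum>\<alpha>\<in>S. a \<alpha> * monomial n \<alpha> z)"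
proof -
  have "\<exists>S a. finite S \<and> (\<forall>\<alpha>\<in>S. \<forall>k\<ge>n. \<alpha> k = 0) \<and> (\<forall>z. f z = (\<Sum>\<alpha>\<in>S. a \<alpha> * monomial n \<alpha> z))"
    using assms
  proof induction
    case (hpoly_const c)
    show ?case
      by (intro exI[of _ "{\<lambda>_. 0}"] exI[of _ "\<lambda>_. c"]) (simp add: monomial_def)
  next
    case (hpoly_coordinate k)
    have "monomial n (\<lambda>j. if j = k then 1 else 0) z = z k" for z
      using hpoly_coordinate by (simp add: monomial_def if_distrib[of "\<lambda>j. z _ ^ j"] cong: if_cong)
    then show ?case using hpoly_coordinate
      by (intro exI[of _ "{\<lambda>j. if j = k then 1 else 0}"] exI[of _ "\<lambda>_. 1"]) auto
  next
    case (hpoly_add f g)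
    then obtain S a T b where S: "finite S" "\<forall>\<alpha>\<in>S. \<forall>k\<ge>n. \<alpha> k = 0" "\<And>z. f z = (\<Sum>\<alpha>\<in>S. a \<alpha> * monomial n \<alpha> z)"
      and T: "finite T" "\<forall>\<alpha>\<in>T. \<forall>k\<ge>n. \<alpha> k = 0" "\<And>z. g z = (\<Sum>\<alpha>\<in>T. b \<alpha> * monomial n \<alpha> z)" by blast
    have "f z + g z = (\<Sum>\<alpha>\<in>S \<union> T. ((if \<alpha> \<in> S then a \<alpha> else 0) + (if \<alpha> \<in> T then b \<alpha> else 0)) * monomial n \<alpha> z)" for z
    proof -
      have "f z = (\<Sum>\<alpha>\<in>S \<union> T. (if \<alpha> \<in> S then a \<alpha> else 0) * monomial n \<alpha> z)"
        unfolding S(3) using S(1) T(1) by (intro sum.mono_neutral_cong_left) auto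
      moreover have "g z = (\<Sum>\<alpha>\<in>S \<union> T. (if \<alpha> \<in> T then b \<alpha> else 0) * monomial n \<alpha> z)"
        unfolding T(3) using S(1) T(1) by (intro sum.mono_neutral_cong_left) auto
      ultimately show ?thesis by (simp only: sum.distrib distrib_right)
    qed
    then show ?case using S(1,2) T(1,2)
      by (intro exI[of _ "S \<union> T"] exI[of _ "\<lambda>\<alpha>. (if \<alpha> \<in> S then a \<alpha> else 0) + (if \<alpha> \<in> T then b \<alpha> else 0)"])
        blast
  next
    case (hpoly_mult f g)
    then obtain S a T b where S: "finite S" "\<forall>\<alpha>\<in>S. \<forall>k\<ge>n. \<alpha> k = 0" "\<And>z. f z = (\<Sum>\<alpha>\<in>S. a \<alpha> * monomial n \<alpha> z)"
      and T: "finite T" "\<forall>\<alpha>\<in>T. \<forall>k\<ge>n. \<alpha> k = 0" "\<And>z. g z = (\<Sum>\<alpha>\<in>T. b \<alpha> * monomial n \<alpha> z)" by blast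
    \<comment> \<open>Different pairs of exponents can have the same sum, so a coefficient of the
      product collects a whole fibre of \<open>h\<close>.\<close>
    define h where "h = (\<lambda>(\<alpha>, \<beta>). (\<lambda>k. \<alpha> k + \<beta> k :: nat) :: nat \<Rightarrow> nat)"
    define c where "c \<gamma> = (\<Sum>p\<in>{p\<in>S \<times> T. h p = \<gamma>}. a (fst p) * b (snd p))" for \<gamma>
    have "f z * g z = (\<Sum>\<gamma>\<in>h ` (S \<times> T). c \<gamma> * monomial n \<gamma> z)" for z
    proof -
      have "f z * g z = (\<Sum>p\<in>S \<times> T. a (fst p) * b (snd p) * monomial n (h p) z)"
        unfolding S(3) T(3) sum_product sum.cartesian_product h_def
        by (intro sum.cong) (auto simp: monomial_add[symmetric] mult_ac)
      also have "\<dots> = (\<Sum>\<gamma>\<in>h ` (S \<times> T). \<Sum>p\<in>{p\<in>S \<times> T. h p = \<gamma>}. a (fst p) * b (snd p) * monomial n (h p) z)"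
        using S(1) T(1) by (intro sum.image_gen) auto
      also have "\<dots> = (\<Sum>\<gamma>\<in>h ` (S \<times> T). c \<gamma> * monomial n \<gamma> z)"
        unfolding c_def sum_distrib_right by (intro sum.cong) auto
      finally show ?thesis .
    qed
    moreover have "\<forall>\<alpha>\<in>h ` (S \<times> T). \<forall>k\<ge>n. \<alpha> k = 0" using S(2) T(2) by (auto simp: h_def)
    ultimately show ?case using S(1) T(1)
      by (intro exI[of _ "h ` (S \<times> T)"] exI[of _ c]) blast
  qed
  then show ?thesis using that by blast
qed

lemma monomial_hpoly: "hpoly n (monomial n \<alpha>)"
proof -
  have "hpoly n (\<lambda>z. \<Prod>k\<in>I. z k ^ \<alpha> k)" if "I \<subseteq> {..<n}" for I
    using that
    by (induction I rule: infinite_finite_induct) (auto intro!: hpoly.intros hpoly_power)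
  then show ?thesis unfolding monomial_def[abs_def] by simp
qed

context moment_measure
begin

lemma hpoly_measurable: "hpoly n f \<Longrightarrow> f \<in> borel_measurable M"
  by (induction rule: hpoly.induct) auto

lemma integrable_bounded:
  fixes f :: "(nat \<Rightarrow> complex) \<Rightarrow> 'b::{banach, second_countable_topology}"
  assumes "f \<in> borel_measurable M" "\<And>z. z \<in> space M \<Longrightarrow> norm (f z) \<le> B"
  shows "integrable M f"
  using assms by (intro integrable_const_bound[where B = B]) auto

lemma hpoly_bounded_on_space:
  assumes "hpoly n f"
  obtains B where "\<And>z. z \<in> space M \<Longrightarrow> cmod (f z) \<le> B" "0 \<le> B"
proof -
  obtain B where B: "\<And>z. (\<And>k. k < n \<Longrightarrow> cmod (z k) \<le> 1) \<Longrightarrow> cmod (f z) \<le> B"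
    using hpoly_bounded[OF assms] by blast
  then have "0 \<le> B" using order_trans[OF norm_ge_zero B[of "\<lambda>_. 0"]] by simp
  then show ?thesis using that[of B] B coordinate_le by blast
qed

lemma hpoly_integrable: "hpoly n f \<Longrightarrow> integrable M f"
  using hpoly_bounded_on_space[of f] hpoly_measurable[of f] integrable_bounded[of f] by metis

lemma hpoly_norm_power_integrable:
  assumes "hpoly n f"
  shows "integrable M (\<lambda>z. cmod (f z) ^ j)"
proof -
  obtain B where "\<And>z. z \<in> space M \<Longrightarrow> cmod (f z) \<le> B" "0 \<le> B"
    using hpoly_bounded_on_space[OF assms] by blast
  then show ?thesis
    using hpoly_measurable[OF assms]
    by (intro integrable_bounded[where B = "B ^ j"]) (auto intro: power_mono)
qed

lemma integrable_monomials: "integrable M (\<lambda>z. monomial n \<alpha> z * cnj (monomial n \<beta> z))"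
proof -
  obtain A B where "\<And>z. z \<in> space M \<Longrightarrow> cmod (monomial n \<alpha> z) \<le> A" "0 \<le> A"
    "\<And>z. z \<in> space M \<Longrightarrow> cmod (monomial n \<beta> z) \<le> B" "0 \<le> B"
    using hpoly_bounded_on_space[OF monomial_hpoly] by metis
  then show ?thesis
    using hpoly_measurable[OF monomial_hpoly]
    by (intro integrable_bounded[where B = "A * B"]) (auto simp: norm_mult intro!: mult_mono)
qed

lemma prod_weight_zero: "(\<Prod>k<n. w 0) = 1"
proof -
  have "(\<integral>z. 1 \<partial>M) = complex_of_real (\<Prod>k<n. w 0)"
    using moments[of "\<lambda>_. 0" "\<lambda>_. 0"] by (simp add: monomial_def)
  moreover have "(\<integral>z. 1 \<partial>M) = (1 :: complex)"
    using total by (simp add: measure_def)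
  ultimately show ?thesis by (metis of_real_eq_1_iff)
qed

text \<open>The mean value property at the centre. Integrating a monomial means pairing it with the
  monomial 1, so orthogonality kills all but the constant term. This removes \<open>g h\<close> on
  the torus and \<open>(2 g h) ^ m\<close> on the polydisc from the upper estimate.\<close>

lemma integral_hpoly:
  assumes "hpoly n f"
  shows "integral\<^sup>L M f = f (\<lambda>_. 0)"
proof -
  obtain S a where S: "finite S" "\<And>z. f z = (\<Sum>\<alpha>\<in>S. a \<alpha> * monomial n \<alpha> z)"
    using hpoly_expand[OF assms] by metis
  have "integral\<^sup>L M (monomial n \<alpha>) = monomial n \<alpha> (\<lambda>_. 0)" for \<alpha>
  proof -
    have one: "monomial n (\<lambda>_. 0) z = 1" for z by (simp add: monomial_def)
    have m: "integral\<^sup>L M (monomial n \<alpha>) = (if \<forall>k<n. \<alpha> k = 0 then of_real (\<Prod>k<n. w (\<alpha> k)) else 0)"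
      using moments[of \<alpha> "\<lambda>_. 0"] unfolding one complex_cnj_one mult_1_right .
    show ?thesis
    proof (cases "\<forall>k<n. \<alpha> k = 0")
      case True
      then have "(\<Prod>k<n. w (\<alpha> k)) = (\<Prod>k<n. w 0)" by (intro prod.cong) auto
      also note prod_weight_zero
      finally have "integral\<^sup>L M (monomial n \<alpha>) = 1"
        using m True by (simp only: if_P of_real_1)
      then show ?thesis using True by (simp add: monomial_def)
    next
      case False
      then have "integral\<^sup>L M (monomial n \<alpha>) = 0"
        using m by (simp only: if_not_P if_False)
      moreover have "monomial n \<alpha> (\<lambda>_. 0) = 0"
        using False unfolding monomial_def by (intro prod_zero) auto
      ultimately show ?thesis by simp
    qed
  qed
  then show ?thesis
    unfolding S(2) by (subst Bochner_Integration.integral_sum) (auto intro: hpoly_integrable monomial_hpoly)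
qed

text \<open>Parseval for finite sums: the double sum collapses to its diagonal because the support
  condition turns agreement below \<open>n\<close> into equality of multi-indices.\<close>

lemma integral_norm_square:
  assumes S: "finite S" "\<And>\<alpha> k. \<alpha> \<in> S \<Longrightarrow> n \<le> k \<Longrightarrow> \<alpha> k = 0"
  shows "(\<integral>z. (cmod (\<Sum>\<alpha>\<in>S. a \<alpha> * monomial n \<alpha> z))\<^sup>2 \<partial>M)
    = (\<Sum>\<alpha>\<in>S. (cmod (a \<alpha>))\<^sup>2 * (\<Prod>k<n. w (\<alpha> k)))"
proof -
  have eq: "(\<forall>k<n. \<alpha> k = \<beta> k) \<longleftrightarrow> \<alpha> = \<beta>" if "\<alpha> \<in> S" "\<beta> \<in> S" for \<alpha> \<beta>
    using S(2)[of \<alpha>] S(2)[of \<beta>] that by (metis ext not_le)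
  have "complex_of_real (\<integral>z. (cmod (\<Sum>\<alpha>\<in>S. a \<alpha> * monomial n \<alpha> z))\<^sup>2 \<partial>M)
      = (\<integral>z. (\<Sum>\<alpha>\<in>S. \<Sum>\<beta>\<in>S. (a \<alpha> * cnj (a \<beta>)) * (monomial n \<alpha> z * cnj (monomial n \<beta> z))) \<partial>M)"
    unfolding integral_complex_of_real[symmetric] complex_norm_square cnj_sum sum_product
    by (intro Bochner_Integration.integral_cong sum.cong) (simp_all add: mult_ac)
  also have "\<dots> = (\<Sum>\<alpha>\<in>S. \<Sum>\<beta>\<in>S. (a \<alpha> * cnj (a \<beta>)) * (if \<forall>k<n. \<alpha> k = \<beta> k then of_real (\<Prod>k<n. w (\<alpha> k)) else 0))"
    unfolding moments[symmetric] by (simp add: integrable_monomials)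
  also have "\<dots> = (\<Sum>\<alpha>\<in>S. \<Sum>\<beta>\<in>S. if \<alpha> = \<beta> then of_real ((cmod (a \<alpha>))\<^sup>2 * (\<Prod>k<n. w (\<alpha> k))) else 0)"
    by (intro sum.cong refl) (auto simp: eq complex_norm_square simp del: of_real_power)
  also have "\<dots> = of_real (\<Sum>\<alpha>\<in>S. (cmod (a \<alpha>))\<^sup>2 * (\<Prod>k<n. w (\<alpha> k)))"
    using S(1) by simp
  finally show ?thesis by (simp only: of_real_eq_iff)
qed

end

text \<open>For each coordinate \<open>k\<close> the \<open>k\<close>-th entries of the tuple form a
  list of length \<open>m\<close> with sum \<open>\<gamma> k\<close>, and stars and bars counts such
  lists. The tuple is determined by these lists because entries from \<open>n\<close> on vanish.
  Only an inequality holds, as \<open>S\<close> may miss some multi-indices.\<close>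

lemma card_weak_compositions:
  fixes n m :: nat
  assumes "\<And>\<alpha> k. \<alpha> \<in> S \<Longrightarrow> n \<le> k \<Longrightarrow> \<alpha> k = 0"
  shows "card {\<sigma> \<in> {..<m} \<rightarrow>\<^sub>E S. (\<lambda>k. \<Sum>i<m. \<sigma> i k) = \<gamma>} \<le> (\<Prod>k<n. (\<gamma> k + m - 1) choose \<gamma> k)"
proof -
  let ?F = "{\<sigma> \<in> {..<m} \<rightarrow>\<^sub>E S. (\<lambda>k. \<Sum>i<m. \<sigma> i k) = \<gamma>}"
  let ?L = "\<lambda>k. {l::nat list. length l = m \<and> sum_list l = \<gamma> k}"
  define \<Phi> where "\<Phi> \<sigma> = (\<lambda>k\<in>{..<n}. map (\<lambda>i. \<sigma> i k) [0..<m])" for \<sigma> :: "nat \<Rightarrow> nat \<Rightarrow> nat"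
  have fin: "finite (?L k)" for k
    by (rule finite_subset[of _ "{l. set l \<subseteq> {..\<gamma> k} \<and> length l = m}"])
      (auto intro: finite_lists_length_eq dest: member_le_sum_list)
  have "inj_on \<Phi> ?F"
  proof (rule inj_onI)
    fix \<sigma> \<tau> assume \<sigma>: "\<sigma> \<in> ?F" and \<tau>: "\<tau> \<in> ?F" and eq: "\<Phi> \<sigma> = \<Phi> \<tau>"
    have "\<sigma> i k = \<tau> i k" if "i < m" for i k
    proof (cases "k < n")
      case True
      then have "map (\<lambda>i. \<sigma> i k) [0..<m] = map (\<lambda>i. \<tau> i k) [0..<m]"
        using fun_cong[OF eq, of k] by (simp add: \<Phi>_def)
      then show ?thesis using that by auto
    next
      case False
      moreover have "\<sigma> i \<in> S" "\<tau> i \<in> S" using \<sigma> \<tau> that by (blast dest: PiE_mem)+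
      ultimately show ?thesis by (simp add: assms)
    qed
    then have "\<sigma> i = \<tau> i" if "i < m" for i using that by blast
    then show "\<sigma> = \<tau>" using \<sigma> \<tau> by (intro PiE_ext[of \<sigma> "{..<m}" "\<lambda>_. S" \<tau>]) auto
  qed
  moreover have "\<Phi> ` ?F \<subseteq> (\<Pi>\<^sub>E k\<in>{..<n}. ?L k)"
  proof (rule image_subsetI)
    fix \<sigma> assume "\<sigma> \<in> ?F"
    then have "(\<Sum>i<m. \<sigma> i k) = \<gamma> k" for k by (metis (mono_tags, lifting) mem_Collect_eq)
    then show "\<Phi> \<sigma> \<in> (\<Pi>\<^sub>E k\<in>{..<n}. ?L k)"
      by (simp add: \<Phi>_def interv_sum_list_conv_sum_set_nat atLeast0LessThan)
  qed
  moreover have "finite (\<Pi>\<^sub>E k\<in>{..<n}. ?L k)" using fin by (intro finite_PiE) auto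
  ultimately have "card ?F \<le> card (\<Pi>\<^sub>E k\<in>{..<n}. ?L k)" by (rule card_inj_on_le)
  also have "\<dots> = (\<Prod>k<n. (\<gamma> k + m - 1) choose \<gamma> k)"
    by (simp add: card_PiE card_length_sum_list)
  finally show ?thesis .
qed

lemma monomial_prod: "(\<Prod>i<m. monomial n (\<sigma> i) z) = monomial n (\<lambda>k. \<Sum>i<m. \<sigma> i k) z"
  unfolding monomial_def by (subst prod.swap) (simp add: power_sum)

text \<open>
  The coefficients of \<open>g^m\<close> are sums over weak compositions into \<open>m\<close> parts, and the moments
  of the weighted measure are the reciprocals of the numbers of such compositions, so
  Cauchy-Schwarz applied to each coefficient gives exactly the required contraction.
\<close>

lemma hpoly_contraction:
  assumes M: "moment_measure M n (moment_weight m)" and T: "moment_measure T n (\<lambda>_. 1)"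
    and g: "hpoly n g"
  shows "(\<integral>z. cmod (g z) ^ (2 * m) \<partial>M) \<le> (\<integral>z. (cmod (g z))\<^sup>2 \<partial>T) ^ m"
proof -
  interpret M: moment_measure M n "moment_weight m" by fact
  interpret T: moment_measure T n "\<lambda>_. 1" by fact
  obtain S a where S: "finite S" "\<And>\<alpha> k. \<alpha> \<in> S \<Longrightarrow> n \<le> k \<Longrightarrow> \<alpha> k = 0"
    and gS: "\<And>z. g z = (\<Sum>\<alpha>\<in>S. a \<alpha> * monomial n \<alpha> z)"
    using hpoly_expand[OF g] by metis
  define E where "E = ({..<m} \<rightarrow>\<^sub>E S)"
  have E: "finite E" unfolding E_def using S(1) by (intro finite_PiE) auto
  define f where "f \<sigma> = (\<lambda>k. \<Sum>i<m. \<sigma> i k)" for \<sigma> :: "nat \<Rightarrow> nat \<Rightarrow> nat"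
  define A where "A \<sigma> = (\<Prod>i<m. a (\<sigma> i))" for \<sigma>
  define F where "F \<gamma> = {\<sigma>\<in>E. f \<sigma> = \<gamma>}" for \<gamma>
  define c where "c \<gamma> = (\<Sum>\<sigma>\<in>F \<gamma>. A \<sigma>)" for \<gamma>
  have fE: "\<gamma> k = 0" if "\<gamma> \<in> f ` E" "n \<le> k" for \<gamma> k
    using that S(2) by (auto simp: f_def E_def PiE_iff)
  have gm: "g z ^ m = (\<Sum>\<gamma>\<in>f ` E. c \<gamma> * monomial n \<gamma> z)" for z
  proof -
    have "g z ^ m = (\<Prod>i<m. \<Sum>\<alpha>\<in>S. a \<alpha> * monomial n \<alpha> z)" by (simp add: gS)
    also have "\<dots> = (\<Sum>\<sigma>\<in>E. \<Prod>i<m. a (\<sigma> i) * monomial n (\<sigma> i) z)"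
      unfolding E_def using S(1) by (intro prod_sum_PiE) auto
    also have "\<dots> = (\<Sum>\<sigma>\<in>E. A \<sigma> * monomial n (f \<sigma>) z)"
      by (simp add: prod.distrib monomial_prod A_def f_def)
    also have "\<dots> = (\<Sum>\<gamma>\<in>f ` E. \<Sum>\<sigma>\<in>F \<gamma>. A \<sigma> * monomial n (f \<sigma>) z)"
      unfolding F_def by (rule sum.image_gen[OF E])
    also have "\<dots> = (\<Sum>\<gamma>\<in>f ` E. c \<gamma> * monomial n \<gamma> z)"
      unfolding c_def sum_distrib_right by (intro sum.cong) (auto simp: F_def)
    finally show ?thesis .
  qed
  have coeff: "(cmod (c \<gamma>))\<^sup>2 * (\<Prod>k<n. moment_weight m (\<gamma> k)) \<le> (\<Sum>\<sigma>\<in>F \<gamma>. (cmod (A \<sigma>))\<^sup>2)" for \<gamma>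
  proof -
    let ?N = "\<Prod>k<n. (\<gamma> k + m - 1) choose \<gamma> k"
    let ?Q = "\<Sum>\<sigma>\<in>F \<gamma>. (cmod (A \<sigma>))\<^sup>2"
    have W: "(\<Prod>k<n. moment_weight m (\<gamma> k)) = 1 / real ?N"
      by (simp add: moment_weight_def prod_dividef)
    have Q: "0 \<le> ?Q" by (intro sum_nonneg) auto
    have "(cmod (c \<gamma>))\<^sup>2 \<le> (\<Sum>\<sigma>\<in>F \<gamma>. cmod (A \<sigma>))\<^sup>2"
      unfolding c_def by (intro power_mono norm_sum) auto
    also have "\<dots> \<le> ?Q * real (card (F \<gamma>))"
      by (rule sum_squared_le_sum_of_squares)
    also have "\<dots> \<le> ?Q * real ?N"
      using card_weak_compositions[of S n m \<gamma>] S(2) Q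
      unfolding F_def E_def f_def by (intro mult_left_mono) (simp_all only: of_nat_le_iff)
    finally have *: "(cmod (c \<gamma>))\<^sup>2 \<le> ?Q * real ?N" .
    show ?thesis
    \<comment> \<open>The binomial product can vanish only for \<open>m = 0\<close>; the weight is
      then 0 by the convention for division by zero.\<close>
    proof (cases "?N = 0")
      case True
      then show ?thesis unfolding W True using Q by simp
    next
      case False
      then have "0 < real ?N" by linarith
      then show ?thesis unfolding W using * by (simp only: mult_1_right times_divide_eq_right pos_divide_le_eq)
    qed
  qed
  have "(\<integral>z. cmod (g z) ^ (2 * m) \<partial>M) = (\<integral>z. (cmod (g z ^ m))\<^sup>2 \<partial>M)"
    by (simp add: norm_power power_mult mult.commute[of 2 m])
  also have "\<dots> = (\<Sum>\<gamma>\<in>f ` E. (cmod (c \<gamma>))\<^sup>2 * (\<Prod>k<n. moment_weight m (\<gamma> k)))"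
    unfolding gm using E fE by (intro M.integral_norm_square) auto
  also have "\<dots> \<le> (\<Sum>\<gamma>\<in>f ` E. \<Sum>\<sigma>\<in>F \<gamma>. (cmod (A \<sigma>))\<^sup>2)"
    by (intro sum_mono coeff)
  also have "\<dots> = (\<Sum>\<sigma>\<in>E. (cmod (A \<sigma>))\<^sup>2)"
    unfolding F_def by (rule sum.image_gen[OF E, symmetric])
  also have "\<dots> = (\<Sum>\<sigma>\<in>E. \<Prod>i<m. (cmod (a (\<sigma> i)))\<^sup>2)"
    by (simp add: A_def prod_norm[symmetric] prod_power_distrib)
  also have "\<dots> = (\<Prod>i<m. \<Sum>\<alpha>\<in>S. (cmod (a \<alpha>))\<^sup>2)"
    unfolding E_def using S(1) by (intro prod_sum_PiE[symmetric]) auto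
  also have "\<dots> = (\<integral>z. (cmod (g z))\<^sup>2 \<partial>T) ^ m"
    unfolding gS by (subst T.integral_norm_square) (use S in auto)
  finally show ?thesis .
qed

section \<open>Approximation of pluriharmonic functions\<close>

lemma polydisc_upd: "z \<in> polydisc n \<Longrightarrow> k < n \<Longrightarrow> cmod w < 1 \<Longrightarrow> z(k := w) \<in> polydisc n"
  by (auto simp: polydisc_def PiE_iff extensional_def)

lemma polydisc_coordinate: "z \<in> polydisc n \<Longrightarrow> k < n \<Longrightarrow> cmod (z k) < 1"
  by (auto simp: polydisc_def PiE_iff)

lemma continuous_on_fun_upd:
  fixes Z :: "'a::topological_space \<Rightarrow> nat \<Rightarrow> complex"
  assumes "continuous_on S Z" "continuous_on S u"
  shows "continuous_on S (\<lambda>p. (Z p)(k := u p))"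
proof (rule continuous_on_coordinatewise_then_product)
  fix i
  show "continuous_on S (\<lambda>p. ((Z p)(k := u p)) i)"
    using assms(2) continuous_on_product_then_coordinatewise[OF assms(1), of i]
    by (cases "i = k") auto
qed

text \<open>\<open>partial_deriv\<close> speaks of parameter 0 only. Moving the base point along the
  line gives the derivative at every parameter whose point lies in the polydisc.\<close>

lemma C1_line:
  assumes f: "C1_on_polydisc n f" "k < n" "v \<in> {1, \<i>}" and z: "z(k := c + t *\<^sub>R v) \<in> polydisc n"
  shows "((\<lambda>s. f (z(k := c + s *\<^sub>R v))) has_vector_derivative
    partial_deriv k v f (z(k := c + t *\<^sub>R v))) (at t)"
proof -
  define y where "y = z(k := c + t *\<^sub>R v)"
  have "(\<lambda>s::real. f (y(k := y k + s *\<^sub>R v))) differentiable (at 0)"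
    using f z unfolding C1_on_polydisc_def y_def by blast
  then have "((\<lambda>s::real. f (y(k := y k + s *\<^sub>R v))) has_vector_derivative partial_deriv k v f y) (at 0)"
    unfolding partial_deriv_def by (simp add: vector_derivative_works)
  moreover have "((\<lambda>s. s - t) has_vector_derivative 1) (at t)"
    by (auto intro!: derivative_eq_intros)
  ultimately have "((\<lambda>s. f (y(k := y k + (s - t) *\<^sub>R v))) has_vector_derivative partial_deriv k v f y) (at t)"
    using vector_diff_chain_at[of "\<lambda>s. s - t" 1 t "\<lambda>s. f (y(k := y k + s *\<^sub>R v))"]
    by (simp add: o_def)
  moreover have "y(k := y k + (s - t) *\<^sub>R v) = z(k := c + s *\<^sub>R v)" for s
    by (simp add: y_def fun_eq_iff algebra_simps)
  ultimately show ?thesis by (simp add: y_def)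
qed

lemma partial_deriv_eqI:
  assumes "((\<lambda>t::real. f (z(k := z k + t *\<^sub>R v))) has_vector_derivative d) (at 0)"
  shows "partial_deriv k v f z = d"
  using assms unfolding partial_deriv_def by (rule vector_derivative_at)

lemma C1_partial:
  assumes "C1_on_polydisc n f" "k < n" "v \<in> {1, \<i>}" "z \<in> polydisc n"
  shows "((\<lambda>t::real. f (z(k := z k + t *\<^sub>R v))) has_vector_derivative partial_deriv k v f z) (at 0)"
  using C1_line[OF assms(1-3), of z "z k" 0] assms(4) by simp

text \<open>The shape \<open>(f + c g) / 2\<close> covers both Wirtinger operators, with
  \<open>c = - \<i>\<close> and \<open>c = \<i>\<close>.\<close>

lemma partial_deriv_combination:
  assumes "C1_on_polydisc n f" "C1_on_polydisc n g" "k < n" "v \<in> {1, \<i>}" "z \<in> polydisc n"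
  shows "((\<lambda>t::real. (\<lambda>z. (f z + c * g z) / 2) (z(k := z k + t *\<^sub>R v))) has_vector_derivative
      (partial_deriv k v f z + c * partial_deriv k v g z) / 2) (at 0)"
  using C1_partial[OF assms(1,3-)] C1_partial[OF assms(2,3-)]
  by (auto intro!: derivative_eq_intros)

lemma C1_combination:
  assumes f: "C1_on_polydisc n f" and g: "C1_on_polydisc n g"
  shows "C1_on_polydisc n (\<lambda>z. (f z + c * g z) / 2)"
  unfolding C1_on_polydisc_def
proof (intro conjI allI impI ballI)
  show "continuous_on (polydisc n) (\<lambda>z. (f z + c * g z) / 2)"
    using f g unfolding C1_on_polydisc_def by (intro continuous_intros) auto
  fix k v assume kv: "k < n" "v \<in> {1, \<i>}"
  show "(\<lambda>t::real. (f (z(k := z k + t *\<^sub>R v)) + c * g (z(k := z k + t *\<^sub>R v))) / 2) differentiable (at 0)"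
    if "z \<in> polydisc n" for z
    by (rule differentiableI_vector[OF partial_deriv_combination[OF f g kv that]])
  have "continuous_on (polydisc n) (\<lambda>z. (partial_deriv k v f z + c * partial_deriv k v g z) / 2)"
    using f g kv unfolding C1_on_polydisc_def by (intro continuous_intros) auto
  then show "continuous_on (polydisc n) (partial_deriv k v (\<lambda>z. (f z + c * g z) / 2))"
    by (rule continuous_on_eq)
      (rule partial_deriv_eqI[symmetric], rule partial_deriv_combination[OF f g kv])
qed

text \<open>Integrate \<open>A\<close> in \<open>t\<close> to get
  \<open>\<phi> s t - \<phi> s 0\<close>, then differentiate under the integral in \<open>s\<close>
  at 0: this gives \<open>B 0 t - B 0 0\<close> as the integral of \<open>C 0\<close>.
  Differentiation in \<open>t\<close> at 0 then yields both \<open>C 0 0\<close> and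
  \<open>E\<close>.\<close>

lemma clairaut:
  fixes \<phi> A B C :: "real \<Rightarrow> real \<Rightarrow> complex"
  assumes \<delta>: "0 < \<delta>"
    and A: "\<And>s t. \<bar>s\<bar> < \<delta> \<Longrightarrow> \<bar>t\<bar> < \<delta> \<Longrightarrow> ((\<lambda>t. \<phi> s t) has_vector_derivative A s t) (at t)"
    and B: "\<And>s t. \<bar>s\<bar> < \<delta> \<Longrightarrow> \<bar>t\<bar> < \<delta> \<Longrightarrow> ((\<lambda>s. \<phi> s t) has_vector_derivative B s t) (at s)"
    and C: "\<And>s t. \<bar>s\<bar> < \<delta> \<Longrightarrow> \<bar>t\<bar> < \<delta> \<Longrightarrow> ((\<lambda>s. A s t) has_vector_derivative C s t) (at s)"
    and E: "((\<lambda>t. B 0 t) has_vector_derivative E) (at 0)"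
    and contA: "continuous_on ({-\<delta><..<\<delta>} \<times> {-\<delta><..<\<delta>}) (\<lambda>(s, t). A s t)"
    and contC: "continuous_on ({-\<delta><..<\<delta>} \<times> {-\<delta><..<\<delta>}) (\<lambda>(s, t). C s t)"
  shows "C 0 0 = E"
proof -
  define \<eta> where "\<eta> = \<delta> / 2"
  have \<eta>: "0 < \<eta>" "\<eta> < \<delta>" using \<delta> by (auto simp: \<eta>_def)
  let ?U = "{-\<delta><..<\<delta>}"
  have contAs: "continuous_on {0..t} (A s)" if "s \<in> ?U" "t \<le> \<eta>" for s t
    by (rule continuous_on_compose2[OF contA, of _ "\<lambda>t. (s, t)", simplified])
      (use that \<eta> in \<open>auto intro!: continuous_intros\<close>)
  have contC0: "continuous_on {0..\<eta>} (C 0)"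
    by (rule continuous_on_compose2[OF contC, of _ "\<lambda>t. (0, t)", simplified])
      (use \<eta> in \<open>auto intro!: continuous_intros\<close>)
  have B_int: "B 0 t = integral {0..t} (C 0) + B 0 0" if t: "0 \<le> t" "t \<le> \<eta>" for t
  proof -
    have "\<phi> s t - \<phi> s 0 = integral {0..t} (A s)" if "s \<in> ?U" for s
      using fundamental_theorem_of_calculus[OF t(1), of "\<phi> s" "A s"] A[of s] t \<eta> that
      by (auto simp: integral_unique has_vector_derivative_at_within)
    then have eq: "integral {0..t} (A s) = \<phi> s t - \<phi> s 0" if "s \<in> ?U" for s
      using that by simp
    have "((\<lambda>s. \<phi> s t - \<phi> s 0) has_vector_derivative B 0 t - B 0 0) (at 0 within ?U)"
      by (intro has_vector_derivative_at_within[OF has_vector_derivative_diff[OF B B]])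
        (use t \<eta> \<delta> in auto)
    then have D1: "((\<lambda>s. integral {0..t} (A s)) has_vector_derivative B 0 t - B 0 0) (at 0 within ?U)"
      by (rule has_vector_derivative_transform[rotated 2]) (use \<delta> eq in auto)
    have D2: "((\<lambda>s. integral (cbox 0 t) (A s)) has_vector_derivative integral (cbox 0 t) (C 0)) (at 0 within ?U)"
    proof (rule leibniz_rule_vector_derivative)
      show "((\<lambda>s. A s r) has_vector_derivative C s r) (at s within ?U)"
        if "s \<in> ?U" "r \<in> cbox 0 t" for s r
        using that t \<eta> by (intro has_vector_derivative_at_within[OF C]) auto
      show "A s integrable_on cbox 0 t" if "s \<in> ?U" for s
        using contAs[OF that t(2)] by (simp add: integrable_continuous_real)
      show "continuous_on (?U \<times> cbox 0 t) (\<lambda>(s, t). C s t)"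
        by (rule continuous_on_subset[OF contC]) (use t \<eta> in auto)
    qed (use \<delta> in auto)
    have "at 0 within ?U = at 0" using \<delta> by (intro at_within_open) auto
    then have "B 0 t - B 0 0 = integral {0..t} (C 0)"
      using vector_derivative_unique_at[of "\<lambda>s. integral {0..t} (A s)" _ 0] D1 D2 by simp
    then show ?thesis by (simp add: algebra_simps)
  qed
  \<comment> \<open>The integral formula is available for \<open>t >= 0\<close> only, so the two
    derivatives are compared from the right.\<close>
  have "((\<lambda>t. integral {0..t} (C 0) + B 0 0) has_vector_derivative C 0 0) (at 0 within {0..\<eta>})"
    using integral_has_vector_derivative[OF contC0, of 0] \<eta>
    by (auto intro!: derivative_eq_intros)
  then have 1: "((\<lambda>t. B 0 t) has_vector_derivative C 0 0) (at 0 within {0..\<eta>})"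
    by (rule has_vector_derivative_transform[rotated 2]) (use \<eta> in simp, rule B_int, auto)
  have 2: "((\<lambda>t. B 0 t) has_vector_derivative E) (at 0 within {0..\<eta>})"
    using E by (rule has_vector_derivative_at_within)
  have "at 0 within {0..\<eta>} \<noteq> bot"
    using \<eta> by (simp add: trivial_limit_within islimpt_Icc)
  then show ?thesis by (rule vector_derivative_unique_within[OF _ 1 2])
qed

lemma partial_deriv_commute:
  assumes f: "C2_on_polydisc n f" and jk: "j < n" "k < n" and vw: "v \<in> {1, \<i>}" "w \<in> {1, \<i>}"
    and z: "z \<in> polydisc n"
  shows "partial_deriv j v (partial_deriv k w f) z = partial_deriv k w (partial_deriv j v f) z"
proof -
  \<comment> \<open>The factor 1/3 leaves room for two displacements in the same coordinate, which
    is what happens when \<open>j = k\<close>.\<close>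
  define \<delta> where "\<delta> = (1 - max (cmod (z j)) (cmod (z k))) / 3"
  have zjk: "cmod (z j) < 1" "cmod (z k) < 1" using z jk by (auto intro: polydisc_coordinate)
  then have \<delta>: "0 < \<delta>" by (simp add: \<delta>_def)
  define p where "p = (\<lambda>s t. z(j := z j + s *\<^sub>R v, k := (z(j := z j + s *\<^sub>R v)) k + t *\<^sub>R w))"
  have p': "p s t = z(k := z k + t *\<^sub>R w, j := (z(k := z k + t *\<^sub>R w)) j + s *\<^sub>R v)" for s t
    by (auto simp: p_def fun_eq_iff)
  have nvw: "cmod v = 1" "cmod w = 1" using vw by auto
  have \<delta>3: "cmod (z j) + 3 * \<delta> \<le> 1" "cmod (z k) + 3 * \<delta> \<le> 1"
  proof -
    have "3 * \<delta> = 1 - max (cmod (z j)) (cmod (z k))" by (simp add: \<delta>_def)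
    then show "cmod (z j) + 3 * \<delta> \<le> 1" "cmod (z k) + 3 * \<delta> \<le> 1" by linarith+
  qed
  have p_in: "p s t \<in> polydisc n" if st: "\<bar>s\<bar> < \<delta>" "\<bar>t\<bar> < \<delta>" for s t
  proof -
    have 1: "cmod (z j + s *\<^sub>R v) < 1"
      using norm_triangle_ineq[of "z j" "s *\<^sub>R v"] st \<delta> \<delta>3 by (simp add: nvw)
    have 2: "cmod (z k + t *\<^sub>R w) < 1"
      using norm_triangle_ineq[of "z k" "t *\<^sub>R w"] st \<delta> \<delta>3 by (simp add: nvw)
    have 3: "cmod (z j + s *\<^sub>R v + t *\<^sub>R w) < 1"
      using norm_triangle_ineq[of "z j" "s *\<^sub>R v"] norm_triangle_ineq[of "z j + s *\<^sub>R v" "t *\<^sub>R w"] st \<delta> \<delta>3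
      by (simp add: nvw)
    show ?thesis
      unfolding p_def using 1 2 3 z jk by (intro polydisc_upd) auto
  qed
  have C1: "C1_on_polydisc n f" "C1_on_polydisc n (partial_deriv k w f)" "C1_on_polydisc n (partial_deriv j v f)"
    using f jk vw unfolding C2_on_polydisc_def by blast+
  have cont_p: "continuous_on S (\<lambda>x. p (fst x) (snd x))" for S
  proof -
    have "continuous_on S (\<lambda>x. (z(j := z j + fst x *\<^sub>R v)) k)"
      by (cases "k = j") (auto intro!: continuous_intros)
    then show ?thesis
      unfolding p_def by (intro continuous_on_fun_upd continuous_intros)
  qed
  have cont: "continuous_on ({-\<delta><..<\<delta>} \<times> {-\<delta><..<\<delta>}) (\<lambda>(s, t). F (p s t))"
    if "continuous_on (polydisc n) F" for F :: "(nat \<Rightarrow> complex) \<Rightarrow> complex"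
    unfolding case_prod_beta
    by (rule continuous_on_compose2[OF that cont_p]) (auto intro!: p_in simp: abs_less_iff)
  have line_t: "((\<lambda>t. F (p s t)) has_vector_derivative partial_deriv k w F (p s t)) (at t)"
    if "C1_on_polydisc n F" "\<bar>s\<bar> < \<delta>" "\<bar>t\<bar> < \<delta>" for F s t
    using C1_line[OF that(1) jk(2) vw(2), of "z(j := z j + s *\<^sub>R v)"] p_in[OF that(2,3)]
    unfolding p_def by blast
  have line_s: "((\<lambda>s. F (p s t)) has_vector_derivative partial_deriv j v F (p s t)) (at s)"
    if "C1_on_polydisc n F" "\<bar>s\<bar> < \<delta>" "\<bar>t\<bar> < \<delta>" for F s t
    using C1_line[OF that(1) jk(1) vw(1), of "z(k := z k + t *\<^sub>R w)"] p_in[OF that(2,3)]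
    unfolding p' by blast
  have p0: "p 0 0 = z" by (simp add: p_def)
  have "partial_deriv j v (partial_deriv k w f) (p 0 0) = partial_deriv k w (partial_deriv j v f) (p 0 0)"
  proof (rule clairaut[OF \<delta>, where \<phi> = "\<lambda>s t. f (p s t)" and A = "\<lambda>s t. partial_deriv k w f (p s t)"
        and B = "\<lambda>s t. partial_deriv j v f (p s t)" and C = "\<lambda>s t. partial_deriv j v (partial_deriv k w f) (p s t)"])
    show "continuous_on ({-\<delta><..<\<delta>} \<times> {-\<delta><..<\<delta>}) (\<lambda>(s, t). partial_deriv k w f (p s t))"
      "continuous_on ({-\<delta><..<\<delta>} \<times> {-\<delta><..<\<delta>}) (\<lambda>(s, t). partial_deriv j v (partial_deriv k w f) (p s t))"
      using C1 jk vw by (auto intro!: cont simp: C1_on_polydisc_def)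
  qed (use C1 \<delta> in \<open>auto intro: line_s line_t\<close>)
  then show ?thesis by (simp add: p0)
qed

lemma wirtinger_eq: "wirtinger j f = (\<lambda>z. (partial_deriv j 1 f z + (- \<i>) * partial_deriv j \<i> f z) / 2)"
  by (simp add: wirtinger_def fun_eq_iff)

lemma wirtinger_bar_eq: "wirtinger_bar j f = (\<lambda>z. (partial_deriv j 1 f z + \<i> * partial_deriv j \<i> f z) / 2)"
  by (simp add: wirtinger_bar_def fun_eq_iff)

lemma C1_wirtinger:
  assumes "C2_on_polydisc n f" "j < n"
  shows "C1_on_polydisc n (wirtinger j f)" "C1_on_polydisc n (wirtinger_bar j f)"
proof -
  have C1: "C1_on_polydisc n (partial_deriv j v f)" if "v \<in> {1, \<i>}" for v
    using assms that unfolding C2_on_polydisc_def by blast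
  show "C1_on_polydisc n (wirtinger j f)" "C1_on_polydisc n (wirtinger_bar j f)"
    unfolding wirtinger_eq wirtinger_bar_eq by (intro C1_combination C1; simp)+
qed

text \<open>Turns the hypothesis of pluriharmonicity around: every \<open>wirtinger k f\<close> is
  annihilated by all \<open>wirtinger_bar j\<close>, hence is holomorphic in each variable.\<close>

lemma wirtinger_commute:
  assumes f: "C2_on_polydisc n f" and jk: "j < n" "k < n" and z: "z \<in> polydisc n"
  shows "wirtinger_bar j (wirtinger k f) z = wirtinger k (wirtinger_bar j f) z"
proof -
  have C1: "C1_on_polydisc n (partial_deriv i v f)" if "i < n" "v \<in> {1, \<i>}" for i v
    using f that unfolding C2_on_polydisc_def by blast
  have A: "partial_deriv j v (wirtinger k f) z
      = (partial_deriv j v (partial_deriv k 1 f) z + (- \<i>) * partial_deriv j v (partial_deriv k \<i> f) z) / 2"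
    if "v \<in> {1, \<i>}" for v
    unfolding wirtinger_eq by (intro partial_deriv_eqI partial_deriv_combination[of n] C1 jk that z) auto
  have B: "partial_deriv k v (wirtinger_bar j f) z
      = (partial_deriv k v (partial_deriv j 1 f) z + \<i> * partial_deriv k v (partial_deriv j \<i> f) z) / 2"
    if "v \<in> {1, \<i>}" for v
    unfolding wirtinger_bar_eq by (intro partial_deriv_eqI partial_deriv_combination[of n] C1 jk that z) auto
  have "partial_deriv j v (partial_deriv k w f) z = partial_deriv k w (partial_deriv j v f) z"
    if "v \<in> {1, \<i>}" "w \<in> {1, \<i>}" for v w
    by (rule partial_deriv_commute[OF f jk that z])
  then show ?thesis
    unfolding wirtinger_bar_def[of j "wirtinger k f"] wirtinger_def[of k "wirtinger_bar j f"]
    by (simp add: A B) (simp add: field_simps)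
qed

text \<open>The partial derivatives give a total real derivative because the one in direction
  \<open>\<i>\<close> is continuous near the point. By the Cauchy-Riemann equation it is
  \<open>\<i>\<close> times the one in direction 1, so the total derivative is multiplication by a
  complex number.\<close>

lemma C1_holomorphic:
  assumes G: "C1_on_polydisc n G" and j: "j < n" and z: "z \<in> polydisc n"
    and CR: "\<And>z. z \<in> polydisc n \<Longrightarrow> wirtinger_bar j G z = 0"
  shows "(\<lambda>w. G (z(j := w))) holomorphic_on ball 0 1"
proof (rule holomorphic_onI)
  fix w0 :: complex assume w0: "w0 \<in> ball 0 1"
  define g where "g = (\<lambda>x y. G (z(j := Complex x y)))"
  define a where "a = (\<lambda>w. partial_deriv j 1 G (z(j := w)))"
  have in_pd: "z(j := w) \<in> polydisc n" if "cmod w < 1" for w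
    using polydisc_upd[OF z j that] .
  have b: "partial_deriv j \<i> G (z(j := w)) = \<i> * a w" if "cmod w < 1" for w
  proof -
    have "a w + \<i> * partial_deriv j \<i> G (z(j := w)) = 0"
      using CR[OF in_pd[OF that]] by (simp add: wirtinger_bar_def a_def)
    then have "\<i> * (a w + \<i> * partial_deriv j \<i> G (z(j := w))) = 0" by simp
    then show ?thesis by (simp add: algebra_simps)
  qed
  have conta: "continuous_on (ball 0 1) a"
  proof -
    have cG: "continuous_on (polydisc n) (partial_deriv j 1 G)"
      using G j by (auto simp: C1_on_polydisc_def)
    show ?thesis
      unfolding a_def
      by (rule continuous_on_compose2[OF cG continuous_on_fun_upd])
        (auto intro: in_pd continuous_intros)
  qed
  define \<delta> where "\<delta> = (1 - cmod w0) / 2"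
  have \<delta>: "0 < \<delta>" using w0 by (simp add: \<delta>_def)
  define X where "X = {Re w0 - \<delta><..<Re w0 + \<delta>}"
  define Y where "Y = {Im w0 - \<delta><..<Im w0 + \<delta>}"
  have XY: "cmod (Complex x y) < 1" if "x \<in> X" "y \<in> Y" for x y
  proof -
    have "cmod (Complex x y - w0) \<le> \<bar>Re (Complex x y - w0)\<bar> + \<bar>Im (Complex x y - w0)\<bar>"
      by (rule cmod_le)
    also have "\<dots> < 2 * \<delta>" using that by (auto simp: X_def Y_def)
    finally show ?thesis
      using norm_triangle_ineq[of "Complex x y - w0" w0] by (simp add: \<delta>_def)
  qed
  have e: "Complex 0 y + s *\<^sub>R 1 = Complex s y" "Complex x 0 + s *\<^sub>R \<i> = Complex x s" for x y s
    by (auto simp: complex_eq_iff)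
  have w0XY: "Re w0 \<in> X" "Im w0 \<in> Y" using \<delta> by (auto simp: X_def Y_def)
  have fx: "((\<lambda>x. g x (Im w0)) has_derivative (\<lambda>tx. tx *\<^sub>R a w0)) (at (Re w0) within X)"
    using C1_line[OF G j, of 1 z "Complex 0 (Im w0)" "Re w0"] in_pd[of w0] w0
    unfolding e has_vector_derivative_def g_def a_def
    by (auto intro: has_derivative_at_withinI)
  have fy: "(g x has_derivative blinfun_apply (blinfun_scaleR_left (\<i> * a (Complex x y)))) (at y within Y)"
    if "x \<in> X" "y \<in> Y" for x y
    using C1_line[OF G j, of \<i> z "Complex x 0" y] in_pd[OF XY[OF that]] b[OF XY[OF that]]
    unfolding e has_vector_derivative_def g_def
    by (auto intro: has_derivative_at_withinI)
  have "continuous_on (X \<times> Y) (\<lambda>(x, y). blinfun_scaleR_left (\<i> * a (Complex x y)))"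
    unfolding case_prod_beta
    by (intro bounded_linear.continuous_on[OF bounded_linear_blinfun_scaleR_left]
        continuous_on_mult continuous_on_const continuous_on_compose2[OF conta])
      (auto intro!: continuous_intros XY)
  then have "continuous (at (Re w0, Im w0) within X \<times> Y)
      (\<lambda>(x, y). blinfun_scaleR_left (\<i> * a (Complex x y)))"
    using w0XY by (simp add: continuous_on_eq_continuous_within)
  from has_derivative_partialsI[OF fx fy this w0XY(2)]
  have *: "((\<lambda>(x, y). g x y) has_derivative
      (\<lambda>(tx, ty). tx *\<^sub>R a w0 + blinfun_scaleR_left (\<i> * a (Complex (Re w0) (Im w0))) ty))
      (at (Re w0, Im w0) within X \<times> Y)"
    by (simp add: Y_def)
  have D: "((\<lambda>p. g (fst p) (snd p)) has_derivative
      (\<lambda>p. fst p *\<^sub>R a w0 + snd p *\<^sub>R (\<i> * a w0))) (at (Re w0, Im w0))"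
  proof -
    have "open (X \<times> Y)" by (auto simp: X_def Y_def intro: open_Times)
    then have "at (Re w0, Im w0) within X \<times> Y = at (Re w0, Im w0)"
      using \<delta> by (intro at_within_open) (auto simp: X_def Y_def)
    then show ?thesis using * by (simp add: case_prod_unfold)
  qed
  have "((\<lambda>w. (\<lambda>p. g (fst p) (snd p)) (Re w, Im w)) has_derivative
      (\<lambda>w. (\<lambda>p. fst p *\<^sub>R a w0 + snd p *\<^sub>R (\<i> * a w0)) (Re w, Im w))) (at w0)"
    by (rule has_derivative_compose[of "\<lambda>w. (Re w, Im w)" "\<lambda>w. (Re w, Im w)" w0 UNIV])
      (use D in \<open>auto intro!: derivative_eq_intros\<close>)
  moreover have "(\<lambda>w. (\<lambda>p. fst p *\<^sub>R a w0 + snd p *\<^sub>R (\<i> * a w0)) (Re w, Im w)) = (\<lambda>w. a w0 * w)"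
    by (auto simp: fun_eq_iff complex_eq_iff algebra_simps)
  ultimately have "((\<lambda>w. g (Re w) (Im w)) has_derivative (\<lambda>w. a w0 * w)) (at w0)"
    by simp
  then have "((\<lambda>w. G (z(j := w))) has_field_derivative a w0) (at w0)"
    by (simp add: g_def has_field_derivative_def)
  then show "(\<lambda>w. G (z(j := w))) field_differentiable at w0 within ball 0 1"
    by (auto simp: field_differentiable_def intro: has_field_derivative_at_within)
qed

section \<open>Interpolation in one variable\<close>

text \<open>Cauchy's inequality on the circle of radius \<open>R\<close> bounds the
  \<open>j\<close>-th Taylor coefficient by \<open>M / R ^ j\<close>; on the smaller disc the tail
  is dominated by a geometric series in \<open>r / R\<close>.\<close>

lemma taylor_remainder_bound:
  assumes r: "0 < r" "r < R" "R < 1" and \<phi>: "\<phi> holomorphic_on ball 0 1"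
    and M: "\<And>w. cmod w \<le> R \<Longrightarrow> cmod (\<phi> w) \<le> M" and z: "cmod z \<le> r"
  shows "cmod (\<phi> z - (\<Sum>j<N. (deriv ^^ j) \<phi> 0 / fact j * z ^ j)) \<le> M * (r / R) ^ N / (1 - r / R)"
proof -
  define c where "c j = (deriv ^^ j) \<phi> 0 / fact j" for j
  define q where "q = r / R"
  have q: "0 < q" "q < 1" using r by (auto simp: q_def)
  have M0: "0 \<le> M" using order_trans[OF norm_ge_zero M[of 0]] r by simp
  have cj: "cmod (c j) \<le> M / R ^ j" for j
  proof -
    have "cmod ((deriv ^^ j) \<phi> 0) \<le> fact j * M / R ^ j"
    proof (rule Cauchy_inequality)
      show "\<phi> holomorphic_on ball 0 R" by (rule holomorphic_on_subset[OF \<phi>]) (use r in auto)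
      show "continuous_on (cball 0 R) \<phi>"
        by (rule continuous_on_subset[OF holomorphic_on_imp_continuous_on[OF \<phi>]]) (use r in auto)
    qed (use r M in auto)
    then show ?thesis by (simp add: c_def norm_divide field_simps)
  qed
  have coeff_le: "cmod (c j * z ^ j) \<le> M * q ^ j" for j
  proof -
    have "cmod (c j * z ^ j) \<le> M / R ^ j * r ^ j"
      unfolding norm_mult norm_power using cj z M0 r by (intro mult_mono power_mono) auto
    then show ?thesis by (simp add: q_def power_divide)
  qed
  have sums: "(\<lambda>j. c j * z ^ j) sums \<phi> z"
    using holomorphic_power_series[OF \<phi>, of z] z r by (simp add: c_def)
  have geo: "(\<lambda>j. M * q ^ (j + N)) sums (M * q ^ N / (1 - q))"
    using sums_mult[OF geometric_sums[of q], of "M * q ^ N"] q by (simp add: power_add mult_ac)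
  have "\<phi> z - (\<Sum>j<N. c j * z ^ j) = (\<Sum>j. c (j + N) * z ^ (j + N))"
    using suminf_minus_initial_segment[OF sums_summable[OF sums], of N] sums_unique[OF sums] by simp
  also have "cmod \<dots> \<le> (\<Sum>j. M * q ^ (j + N))"
    using coeff_le by (intro norm_suminf_le sums_summable[OF geo]) auto
  also have "\<dots> = M * q ^ N / (1 - q)" using geo by (rule sums_unique[symmetric])
  finally show ?thesis by (simp add: c_def q_def)
qed

text \<open>Discrete orthogonality. The bounds on \<open>i\<close> and \<open>j\<close> ensure that
  \<open>N\<close> divides \<open>i - j\<close> only when they coincide.\<close>

lemma sum_roots_of_unity:
  fixes i j N :: nat
  assumes "i < N" "j < N"
  shows "(\<Sum>l<N. cis (2 * pi * real l / real N) ^ i * cnj (cis (2 * pi * real l / real N)) ^ j)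
    = (if i = j then of_nat N else 0)"
proof -
  define x where "x = cis (2 * pi * (real i - real j) / real N)"
  have N: "0 < real N" using assms by simp
  have "cis (2 * pi * real l / real N) ^ i * cnj (cis (2 * pi * real l / real N)) ^ j = x ^ l" for l
    by (simp add: x_def Complex.DeMoivre cis_mult cis_cnj) (simp add: algebra_simps diff_divide_distrib)
  then have eq: "(\<Sum>l<N. cis (2 * pi * real l / real N) ^ i * cnj (cis (2 * pi * real l / real N)) ^ j) = (\<Sum>l<N. x ^ l)"
    by simp
  show ?thesis
  proof (cases "i = j")
    case True
    then show ?thesis unfolding eq by (simp add: x_def)
  next
    case False
    have "x \<noteq> 1"
    proof
      assume "x = 1"
      then obtain k :: int where "2 * pi * (real i - real j) / real N = of_int (2 * k) * pi"
        unfolding x_def cis_conv_exp exp_eq_1 by auto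
      then have "(real i - real j) * (2 * pi) = of_int k * real N * (2 * pi)" using N by (simp add: field_simps)
      then have "real i - real j = of_int k * real N" by (simp only: mult_cancel_right) simp
      then have "of_int (int i - int j) = (of_int (k * int N) :: real)" by simp
      then have k: "int i - int j = k * int N" by (simp only: of_int_eq_iff)
      then have "int N dvd int i - int j" by simp
      then have "int i mod int N = int j mod int N" by (simp add: mod_eq_dvd_iff)
      then show False using assms False by simp
    qed
    moreover have "x ^ N = 1"
    proof -
      have "x ^ N = cis (2 * pi * (real i - real j))" using N by (simp add: x_def Complex.DeMoivre)
      also have "\<dots> = cis (2 * pi * of_int (int i - int j))" by simp
      also have "\<dots> = 1" by (rule cis_multiple_2pi) simp
      finally show ?thesis .
    qed
    ultimately show ?thesis unfolding eq using False by (simp add: geometric_sum)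
  qed
qed

text \<open>
  Interpolation at the \<open>N\<close>-th roots of unity on the circle of radius \<open>r\<close> reproduces
  polynomials of degree less than \<open>N\<close>, and its operator norm grows only linearly in \<open>N\<close>
  while the Taylor remainder decays geometrically.
\<close>

lemma disc_interpolation:
  assumes r: "0 < r" "r < R" "R < 1" and \<epsilon>: "0 < \<epsilon>"
  shows "\<exists>(N::nat) (a :: nat \<Rightarrow> complex) (P :: nat \<Rightarrow> nat \<Rightarrow> complex). (\<forall>l. cmod (a l) \<le> r) \<and>
    (\<forall>\<phi> z. \<phi> holomorphic_on ball 0 1 \<longrightarrow> (\<forall>w. cmod w \<le> R \<longrightarrow> cmod (\<phi> w) \<le> M) \<longrightarrow> cmod z \<le> r
      \<longrightarrow> cmod (\<phi> z - (\<Sum>l<N. \<phi> (a l) * (\<Sum>j<N. P l j * z ^ j))) \<le> \<epsilon>)"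
proof -
  define q where "q = r / R"
  have q: "0 < q" "q < 1" using r by (auto simp: q_def)
  \<comment> \<open>This is the eventual error: one Taylor remainder at \<open>z\<close> and
    \<open>N\<close> remainders at the nodes, each entering with a weight of modulus at most
    1.\<close>
  have "(\<lambda>N. M / (1 - q) * (q ^ N + real N * q ^ N)) \<longlonglongrightarrow> M / (1 - q) * (0 + 0)"
    using q by (intro tendsto_intros powser_times_n_limit_0 LIMSEQ_power_zero) auto
  then have "\<forall>\<^sub>F N in sequentially. M / (1 - q) * (q ^ N + real N * q ^ N) < \<epsilon>"
    using \<epsilon> by (auto dest: order_tendstoD(2))
  then have "\<forall>\<^sub>F N in sequentially. M / (1 - q) * (q ^ N + real N * q ^ N) < \<epsilon> \<and> 0 < N"
    using eventually_gt_at_top[of 0] by eventually_elim auto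
  from eventually_happens'[OF sequentially_bot this]
  obtain N where N: "M / (1 - q) * (q ^ N + real N * q ^ N) < \<epsilon>" "0 < N"
    by blast
  define e where "e l = cis (2 * pi * real l / real N)" for l
  define a where "a l = of_real r * e l" for l
  \<comment> \<open>The coefficients of the Lagrange basis for the nodes \<open>a l\<close>,
    obtained by discrete Fourier inversion.\<close>
  define P where "P l j = (cnj (e l) / of_real r) ^ j / of_nat N" for l j
  have a: "cmod (a l) \<le> r" for l using r by (simp add: a_def e_def norm_mult)
  have reproduce: "(\<Sum>l<N. (\<Sum>i<N. c i * a l ^ i) * (\<Sum>j<N. P l j * z ^ j)) = (\<Sum>i<N. c i * z ^ i)" for c z
  proof -
    have "(\<Sum>l<N. (\<Sum>i<N. c i * a l ^ i) * (\<Sum>j<N. P l j * z ^ j))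
        = (\<Sum>l<N. \<Sum>i<N. \<Sum>j<N. (c i * of_real r ^ i * (z / of_real r) ^ j / of_nat N) * (e l ^ i * cnj (e l) ^ j))"
      unfolding sum_product
      by (intro sum.cong refl) (simp add: a_def P_def power_mult_distrib power_divide)
    also have "\<dots> = (\<Sum>i<N. \<Sum>l<N. \<Sum>j<N. (c i * of_real r ^ i * (z / of_real r) ^ j / of_nat N) * (e l ^ i * cnj (e l) ^ j))"
      by (rule sum.swap)
    also have "\<dots> = (\<Sum>i<N. \<Sum>j<N. \<Sum>l<N. (c i * of_real r ^ i * (z / of_real r) ^ j / of_nat N) * (e l ^ i * cnj (e l) ^ j))"
      by (intro sum.cong refl sum.swap)
    also have "\<dots> = (\<Sum>i<N. \<Sum>j<N. if i = j then c i * z ^ i else 0)"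
    proof (intro sum.cong refl)
      fix i j assume "i \<in> {..<N}" "j \<in> {..<N}"
      then show "(\<Sum>l<N. (c i * of_real r ^ i * (z / of_real r) ^ j / of_nat N) * (e l ^ i * cnj (e l) ^ j))
          = (if i = j then c i * z ^ i else 0)"
        unfolding sum_distrib_left[symmetric] e_def using r N(2)
        by (subst sum_roots_of_unity) (auto simp: power_divide)
    qed
    also have "\<dots> = (\<Sum>i<N. c i * z ^ i)" by simp
    finally show ?thesis .
  qed
  have weight: "cmod (\<Sum>j<N. P l j * z ^ j) \<le> 1" if z: "cmod z \<le> r" for l z
  proof -
    have "cmod (P l j * z ^ j) \<le> 1 / real N" for j
    proof -
      have "cmod (P l j * z ^ j) = (cmod z / r) ^ j / real N"
        using r by (simp add: P_def e_def norm_mult norm_divide norm_power power_divide)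
      also have "\<dots> \<le> 1 / real N"
        using z r by (intro divide_right_mono power_le_one) auto
      finally show ?thesis .
    qed
    then have "cmod (\<Sum>j<N. P l j * z ^ j) \<le> (\<Sum>j<N. 1 / real N)"
      by (intro sum_norm_le)
    then show ?thesis using N(2) by simp
  qed
  show ?thesis
  proof (intro exI[of _ N] exI[of _ a] exI[of _ P] conjI allI impI)
    fix \<phi> z assume \<phi>: "\<phi> holomorphic_on ball 0 1" and M: "\<forall>w. cmod w \<le> R \<longrightarrow> cmod (\<phi> w) \<le> M"
      and z: "cmod z \<le> r"
    define c where "c j = (deriv ^^ j) \<phi> 0 / fact j" for j
    define \<rho> where "\<rho> z = \<phi> z - (\<Sum>j<N. c j * z ^ j)" for z
    have \<rho>: "cmod (\<rho> w) \<le> M / (1 - q) * q ^ N" if "cmod w \<le> r" for w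
      using taylor_remainder_bound[OF r \<phi> M[rule_format] that, of N] by (simp add: \<rho>_def c_def q_def)
    have B0: "0 \<le> M / (1 - q) * q ^ N" using order_trans[OF norm_ge_zero \<rho>[OF z]] .
    have "\<phi> z - (\<Sum>l<N. \<phi> (a l) * (\<Sum>j<N. P l j * z ^ j))
        = (\<rho> z + (\<Sum>j<N. c j * z ^ j)) - (\<Sum>l<N. (\<rho> (a l) + (\<Sum>i<N. c i * a l ^ i)) * (\<Sum>j<N. P l j * z ^ j))"
      by (simp add: \<rho>_def)
    also have "\<dots> = \<rho> z - (\<Sum>l<N. \<rho> (a l) * (\<Sum>j<N. P l j * z ^ j))"
      unfolding distrib_right sum.distrib reproduce by simp
    also have "cmod \<dots> \<le> cmod (\<rho> z) + (\<Sum>l<N. cmod (\<rho> (a l)) * cmod (\<Sum>j<N. P l j * z ^ j))"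
      by (rule order_trans[OF norm_triangle_ineq4]) (auto intro!: add_left_mono order_trans[OF norm_sum] simp: norm_mult)
    also have "\<dots> \<le> M / (1 - q) * q ^ N + (\<Sum>l<N. M / (1 - q) * q ^ N * 1)"
      using \<rho>[OF z] \<rho>[OF a] weight[OF z] B0 by (intro add_mono sum_mono mult_mono) auto
    also have "\<dots> = M / (1 - q) * (q ^ N + real N * q ^ N)" by (simp add: algebra_simps)
    finally show "cmod (\<phi> z - (\<Sum>l<N. \<phi> (a l) * (\<Sum>j<N. P l j * z ^ j))) \<le> \<epsilon>" using N(1) by linarith
  qed (fact a)
qed

section \<open>Polynomial approximation of separately holomorphic functions\<close>

definition closed_polydisc :: "nat \<Rightarrow> real \<Rightarrow> (nat \<Rightarrow> complex) set" where
  "closed_polydisc n r = (\<Pi>\<^sub>E k\<in>{..<n}. cball 0 r)"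

lemma mem_closed_polydisc:
  "z \<in> closed_polydisc n r \<longleftrightarrow> (\<forall>k<n. cmod (z k) \<le> r) \<and> z \<in> extensional {..<n}"
  unfolding closed_polydisc_def PiE_iff by (simp add: Ball_def)

lemma mem_polydisc:
  "z \<in> polydisc n \<longleftrightarrow> (\<forall>k<n. cmod (z k) < 1) \<and> z \<in> extensional {..<n}"
  unfolding polydisc_def PiE_iff by (simp add: Ball_def)

lemma closed_polydisc_subset: "r < 1 \<Longrightarrow> closed_polydisc n r \<subseteq> polydisc n"
  by (force simp: mem_closed_polydisc mem_polydisc)

lemma closed_polydisc_upd:
  "z \<in> closed_polydisc n r \<Longrightarrow> k < n \<Longrightarrow> cmod w \<le> r \<Longrightarrow> z(k := w) \<in> closed_polydisc n r"
  by (simp add: mem_closed_polydisc extensional_def)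

lemma closed_polydisc_mono: "r \<le> R \<Longrightarrow> closed_polydisc n r \<subseteq> closed_polydisc n R"
  by (force simp: mem_closed_polydisc)

lemma closed_polydisc_coordinate: "z \<in> closed_polydisc n r \<Longrightarrow> k < n \<Longrightarrow> cmod (z k) \<le> r"
  by (simp add: mem_closed_polydisc)

lemma compact_closed_polydisc: "compact (closed_polydisc n r)"
proof -
  \<comment> \<open>Rewritten as a product over all indices, with the compact factor
    \<open>{undefined}\<close> from \<open>n\<close> on, the set falls under Tychonoff's
    theorem.\<close>
  have eq: "closed_polydisc n r = (\<Pi>\<^sub>E k\<in>UNIV. if k < n then cball 0 r else {undefined})"
  proof (rule set_eqI)
    fix z :: "nat \<Rightarrow> complex"
    have "z \<in> closed_polydisc n r \<longleftrightarrow> (\<forall>k. if k < n then cmod (z k) \<le> r else z k = undefined)"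
      unfolding mem_closed_polydisc extensional_def by simp metis
    also have "\<dots> \<longleftrightarrow> (\<forall>k. z k \<in> (if k < n then cball 0 r else {undefined}))"
      by (intro all_cong1) simp
    also have "\<dots> \<longleftrightarrow> z \<in> (\<Pi>\<^sub>E k\<in>UNIV. if k < n then cball 0 r else {undefined})"
      by (simp only: PiE_UNIV_domain mem_Collect_eq Pi_iff ball_UNIV)
    finally show "z \<in> closed_polydisc n r \<longleftrightarrow> z \<in> (\<Pi>\<^sub>E k\<in>UNIV. if k < n then cball 0 r else {undefined})" .
  qed
  have "compactin (product_topology (\<lambda>_. euclidean) UNIV)
      (\<Pi>\<^sub>E k\<in>UNIV. if k < n then cball (0::complex) r else {undefined})"
    by (subst compactin_PiE) auto
  then show ?thesis unfolding eq by (simp add: euclidean_product_topology)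
qed

lemma bounded_on_closed_polydisc:
  assumes "continuous_on (polydisc n) G" "r < 1"
  obtains M where "\<And>z. z \<in> closed_polydisc n r \<Longrightarrow> cmod (G z) \<le> M"
proof -
  have "compact (G ` closed_polydisc n r)"
    by (intro compact_continuous_image compact_closed_polydisc
        continuous_on_subset[OF assms(1) closed_polydisc_subset[OF assms(2)]])
  then obtain M where "\<forall>x\<in>G ` closed_polydisc n r. cmod x \<le> M"
    using compact_imp_bounded bounded_iff by metis
  then show ?thesis using that by auto
qed

text \<open>The intermediate stage of interpolating variable by variable: the first \<open>k\<close>
  arguments of \<open>G\<close> are frozen at fixed nodes and their variables survive only in the
  polynomial factor. Stage 0 contains \<open>G\<close>, stage \<open>n\<close> consists of
  polynomials. The nodes must not depend on \<open>z\<close>, which is why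
  \<open>disc_interpolation\<close> chooses them before the function.\<close>

inductive partial_interpolant ::
    "nat \<Rightarrow> real \<Rightarrow> ((nat \<Rightarrow> complex) \<Rightarrow> complex) \<Rightarrow> nat \<Rightarrow> ((nat \<Rightarrow> complex) \<Rightarrow> complex) \<Rightarrow> bool"
  for n r G k where
  zero: "partial_interpolant n r G k (\<lambda>z. 0)"
| frozen: "hpoly n H \<Longrightarrow> (\<And>j. j < k \<Longrightarrow> cmod (b j) \<le> r)
    \<Longrightarrow> partial_interpolant n r G k (\<lambda>z. H z * G (\<lambda>j. if j < k then b j else z j))"
| add: "partial_interpolant n r G k F \<Longrightarrow> partial_interpolant n r G k F'
    \<Longrightarrow> partial_interpolant n r G k (\<lambda>z. F z + F' z)"

lemma partial_interpolant_sum: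
  "(\<And>i. i \<in> I \<Longrightarrow> partial_interpolant n r G k (F i)) \<Longrightarrow> partial_interpolant n r G k (\<lambda>z. \<Sum>i\<in>I. F i z)"
  by (induction I rule: infinite_finite_induct) (auto intro: partial_interpolant.intros)

text \<open>Each step interpolates one more variable, using only holomorphy of slices. A single
  bound \<open>M\<close> on the closed polydisc of radius \<open>R\<close> serves all slices, so the
  one-variable error estimate is uniform in the remaining variables.\<close>

lemma separately_holomorphic_approx:
  assumes cont: "continuous_on (polydisc n) G"
    and hol: "\<And>z k. z \<in> polydisc n \<Longrightarrow> k < n \<Longrightarrow> (\<lambda>w. G (z(k := w))) holomorphic_on ball 0 1"
    and r: "0 < r" "r < 1" and \<epsilon>: "0 < \<epsilon>"
  obtains P where "hpoly n P" "\<And>z. z \<in> closed_polydisc n r \<Longrightarrow> cmod (G z - P z) \<le> \<epsilon>"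
proof -
  define R where "R = (1 + r) / 2"
  have R: "r < R" "R < 1" using r by (auto simp: R_def)
  obtain M where M: "\<And>z. z \<in> closed_polydisc n R \<Longrightarrow> cmod (G z) \<le> M"
    using bounded_on_closed_polydisc[OF cont R(2)] by blast
  have step: "\<exists>F'. partial_interpolant n r G (Suc k) F' \<and> (\<forall>z\<in>closed_polydisc n r. cmod (F z - F' z) \<le> \<epsilon>)"
    if "partial_interpolant n r G k F" "k < n" "0 < \<epsilon>" for F k \<epsilon>
    using that
  proof (induction arbitrary: \<epsilon>)
    case zero
    then show ?case by (intro exI[of _ "\<lambda>_. 0"]) (auto intro: partial_interpolant.zero)
  next
    case (add F1 F2)
    from add.IH(1)[of "\<epsilon> / 2"] add.IH(2)[of "\<epsilon> / 2"] add.prems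
    obtain F1' F2' where F': "partial_interpolant n r G (Suc k) F1'" "partial_interpolant n r G (Suc k) F2'"
      and le: "\<And>z. z \<in> closed_polydisc n r \<Longrightarrow> cmod (F1 z - F1' z) \<le> \<epsilon> / 2"
        "\<And>z. z \<in> closed_polydisc n r \<Longrightarrow> cmod (F2 z - F2' z) \<le> \<epsilon> / 2"
      by auto
    have "cmod ((F1 z + F2 z) - (F1' z + F2' z)) \<le> \<epsilon>" if "z \<in> closed_polydisc n r" for z
      using norm_triangle_ineq[of "F1 z - F1' z" "F2 z - F2' z"] le[OF that]
      by (simp add: algebra_simps)
    then show ?case using F' by (intro exI[of _ "\<lambda>z. F1' z + F2' z"]) (auto intro: partial_interpolant.add)
  next
    case (frozen H b)
    obtain B where B: "\<And>z. (\<And>k. k < n \<Longrightarrow> cmod (z k) \<le> 1) \<Longrightarrow> cmod (H z) \<le> B"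
      using hpoly_bounded[OF frozen.hyps(1)] by blast
    have B0: "0 \<le> B" using order_trans[OF norm_ge_zero B[of "\<lambda>_. 0"]] by simp
    \<comment> \<open>\<open>B\<close> bounds the polynomial factor \<open>H\<close>, by which the
      interpolation error gets multiplied; the \<open>+ 1\<close> covers
      \<open>B = 0\<close>.\<close>
    define \<eta> where "\<eta> = \<epsilon> / (B + 1)"
    have \<eta>: "0 < \<eta>" using frozen.prems B0 by (simp add: \<eta>_def)
    from disc_interpolation[OF r(1) R \<eta>, of M] obtain N a P where a: "\<forall>l. cmod (a l) \<le> r"
      and int: "\<forall>\<phi> z. \<phi> holomorphic_on ball 0 1 \<longrightarrow> (\<forall>w. cmod w \<le> R \<longrightarrow> cmod (\<phi> w) \<le> M) \<longrightarrow> cmod z \<le> r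
      \<longrightarrow> cmod (\<phi> z - (\<Sum>l<N. \<phi> (a l) * (\<Sum>j<N. P l j * z ^ j))) \<le> \<eta>"
      by (elim exE conjE) (rule that)
    define F' where "F' z = (\<Sum>l<N. (H z * (\<Sum>j<N. P l j * z k ^ j))
        * G (\<lambda>j. if j < Suc k then (b(k := a l)) j else z j))" for z
    have "partial_interpolant n r G (Suc k) F'"
      unfolding F'_def
      by (intro partial_interpolant_sum partial_interpolant.frozen hpoly_mult frozen.hyps(1) hpoly_sum
          hpoly_power hpoly_const hpoly_coordinate)
        (use frozen a in \<open>auto simp: less_Suc_eq\<close>)
    moreover have "cmod (H z * G (\<lambda>j. if j < k then b j else z j) - F' z) \<le> \<epsilon>"
      if z: "z \<in> closed_polydisc n r" for z
    proof -
      define y where "y = (\<lambda>j. if j < k then b j else z j)"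
      have y: "y \<in> closed_polydisc n r"
        using z frozen by (auto simp: y_def mem_closed_polydisc extensional_def)
      have yR: "y \<in> closed_polydisc n R" "y \<in> polydisc n"
        using y closed_polydisc_mono[of r R n] closed_polydisc_subset[of r n] R r by auto
      define \<phi> where "\<phi> w = G (y(k := w))" for w
      have "\<phi> (z k) = G y" by (simp add: \<phi>_def y_def fun_upd_idem)
      moreover have "\<phi> (a l) = G (\<lambda>j. if j < Suc k then (b(k := a l)) j else z j)" for l
        unfolding \<phi>_def y_def by (rule arg_cong[where f = G]) (auto simp: fun_eq_iff)
      moreover have "cmod (\<phi> (z k) - (\<Sum>l<N. \<phi> (a l) * (\<Sum>j<N. P l j * z k ^ j))) \<le> \<eta>"
      proof (rule int[rule_format])
        show "\<phi> holomorphic_on ball 0 1" unfolding \<phi>_def using hol yR frozen.prems by blast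
        show "cmod (\<phi> w) \<le> M" if "cmod w \<le> R" for w
          unfolding \<phi>_def using that yR frozen.prems by (intro M closed_polydisc_upd) auto
        show "cmod (z k) \<le> r" using closed_polydisc_coordinate[OF z] frozen.prems by blast
      qed
      ultimately have *: "cmod (G y - (\<Sum>l<N. G (\<lambda>j. if j < Suc k then (b(k := a l)) j else z j)
          * (\<Sum>j<N. P l j * z k ^ j))) \<le> \<eta>" by simp
      have "H z * G y - F' z = H z * (G y - (\<Sum>l<N. G (\<lambda>j. if j < Suc k then (b(k := a l)) j else z j)
          * (\<Sum>j<N. P l j * z k ^ j)))"
      proof -
        define S where "S l = (\<Sum>j<N. P l j * z k ^ j)" for l
        show ?thesis
          unfolding F'_def S_def[symmetric] by (simp add: right_diff_distrib sum_distrib_left mult_ac)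
      qed
      moreover have "cmod (H z) \<le> B"
      proof (rule B)
        show "cmod (z k) \<le> 1" if "k < n" for k
          using closed_polydisc_coordinate[OF z that] r by simp
      qed
      ultimately have "cmod (H z * G y - F' z) \<le> B * \<eta>"
        using * B0 by (simp only: norm_mult) (intro mult_mono; simp)
      also have "\<dots> \<le> \<epsilon>" using B0 frozen.prems by (simp add: \<eta>_def field_simps)
      finally show ?thesis by (simp add: y_def)
    qed
    ultimately show ?case by blast
  qed
  have "\<exists>F. partial_interpolant n r G k F \<and> (\<forall>z\<in>closed_polydisc n r. cmod (G z - F z) \<le> \<epsilon>)"
    if "k \<le> n" "0 < \<epsilon>" for k \<epsilon>
    using that
  proof (induction k arbitrary: \<epsilon>)
    case 0
    show ?case
      using partial_interpolant.frozen[OF hpoly_const[of n 1], of 0 "\<lambda>_. 0" r G] 0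
      by (intro exI[of _ G]) auto
  next
    case (Suc k)
    from Suc.IH[of "\<epsilon> / 2"] Suc.prems obtain F where F: "partial_interpolant n r G k F"
      "\<And>z. z \<in> closed_polydisc n r \<Longrightarrow> cmod (G z - F z) \<le> \<epsilon> / 2" by auto
    from step[OF F(1), of "\<epsilon> / 2"] Suc.prems obtain F' where F': "partial_interpolant n r G (Suc k) F'"
      "\<And>z. z \<in> closed_polydisc n r \<Longrightarrow> cmod (F z - F' z) \<le> \<epsilon> / 2" by auto
    have "cmod (G z - F' z) \<le> \<epsilon>" if "z \<in> closed_polydisc n r" for z
      using norm_triangle_ineq[of "G z - F z" "F z - F' z"] F(2)[OF that] F'(2)[OF that] by simp
    then show ?case using F'(1) by blast
  qed
  from this[of n \<epsilon>] \<epsilon> obtain F where F: "partial_interpolant n r G n F"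
    "\<And>z. z \<in> closed_polydisc n r \<Longrightarrow> cmod (G z - F z) \<le> \<epsilon>" by auto
  from F(1) have "\<exists>P. hpoly n P \<and> (\<forall>z\<in>closed_polydisc n r. F z = P z)"
  proof induction
    case zero
    then show ?case by (auto intro: hpoly_const)
  next
    case (frozen H b)
    \<comment> \<open>With all \<open>n\<close> variables frozen, the remaining arguments are
      \<open>undefined\<close> by extensionality, so \<open>G\<close> is evaluated at a point
      independent of \<open>z\<close>.\<close>
    have "(\<lambda>j. if j < n then b j else z j) = (\<lambda>j. if j < n then b j else undefined)"
      if "z \<in> closed_polydisc n r" for z
      using that by (auto simp: mem_closed_polydisc extensional_def)
    then show ?case
      using frozen hpoly_mult[OF frozen(1) hpoly_const[of n "G (\<lambda>j. if j < n then b j else undefined)"]]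
      by (intro exI[of _ "\<lambda>z. H z * G (\<lambda>j. if j < n then b j else undefined)"]) auto
  next
    case (add F1 F2)
    then obtain P1 P2 where "hpoly n P1" "\<forall>z\<in>closed_polydisc n r. F1 z = P1 z"
      "hpoly n P2" "\<forall>z\<in>closed_polydisc n r. F2 z = P2 z" by blast
    then show ?case by (intro exI[of _ "\<lambda>z. P1 z + P2 z"]) (auto intro: hpoly_add)
  qed
  then show ?thesis using that F(2) by metis
qed

section \<open>Integration of the Wirtinger derivatives\<close>

lemma hpoly_antiderivative:
  assumes P: "hpoly n P" and k: "k < n"
  obtains A where "hpoly n A"
    "\<And>z w. ((\<lambda>w. A (z(k := w))) has_field_derivative P (z(k := w))) (at w)"
proof -
  obtain S a where S: "finite S" and PS: "\<And>z. P z = (\<Sum>\<alpha>\<in>S. a \<alpha> * monomial n \<alpha> z)"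
    using hpoly_expand[OF P] by metis
  define A where "A z = (\<Sum>\<alpha>\<in>S. (a \<alpha> / of_nat (Suc (\<alpha> k))) * (monomial n \<alpha> z * z k))" for z
  have "hpoly n A"
    unfolding A_def[abs_def]
    by (intro hpoly_sum hpoly_mult hpoly_const monomial_hpoly hpoly_coordinate k)
  moreover have "((\<lambda>w. A (z(k := w))) has_field_derivative P (z(k := w))) (at w)" for z w
  proof -
    have mono: "monomial n \<alpha> (z(k := w)) = w ^ \<alpha> k * (\<Prod>i\<in>{..<n} - {k}. z i ^ \<alpha> i)" for \<alpha> w
    proof -
      have "monomial n \<alpha> (z(k := w)) = w ^ \<alpha> k * (\<Prod>i\<in>{..<n} - {k}. (z(k := w)) i ^ \<alpha> i)"
        unfolding monomial_def using k by (subst prod.remove[of _ k]) auto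
      also have "(\<Prod>i\<in>{..<n} - {k}. (z(k := w)) i ^ \<alpha> i) = (\<Prod>i\<in>{..<n} - {k}. z i ^ \<alpha> i)"
        by (intro prod.cong) auto
      finally show ?thesis .
    qed
    have "((\<lambda>w. (a \<alpha> / of_nat (Suc (\<alpha> k))) * (monomial n \<alpha> (z(k := w)) * w))
        has_field_derivative a \<alpha> * monomial n \<alpha> (z(k := w))) (at w)" for \<alpha>
    proof -
      let ?c = "\<Prod>i\<in>{..<n} - {k}. z i ^ \<alpha> i"
      have "((\<lambda>w. (a \<alpha> * ?c / of_nat (Suc (\<alpha> k))) * w ^ Suc (\<alpha> k))
          has_field_derivative (a \<alpha> * ?c / of_nat (Suc (\<alpha> k))) * (of_nat (Suc (\<alpha> k)) * w ^ \<alpha> k)) (at w)"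
        by (intro DERIV_cmult) (use DERIV_power[OF DERIV_ident, where n = "Suc (\<alpha> k)"] in \<open>simp del: of_nat_Suc\<close>)
      moreover have "(a \<alpha> * ?c / of_nat (Suc (\<alpha> k))) * w ^ Suc (\<alpha> k)
          = (a \<alpha> / of_nat (Suc (\<alpha> k))) * (monomial n \<alpha> (z(k := w)) * w)" for w
        by (simp add: mono)
      moreover have "(a \<alpha> * ?c / of_nat (Suc (\<alpha> k))) * (of_nat (Suc (\<alpha> k)) * w ^ \<alpha> k)
          = a \<alpha> * monomial n \<alpha> (z(k := w))"
        by (simp only: mono) (simp del: of_nat_Suc)
      ultimately show ?thesis by (simp only:)
    qed
    then show ?thesis
      unfolding A_def PS by (auto intro!: DERIV_sum)
  qed
  ultimately show ?thesis by (rule that)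
qed

lemma hpoly_substitute:
  assumes "hpoly n P" "\<And>k. k < n \<Longrightarrow> hpoly n (\<lambda>z. \<sigma> z k)"
  shows "hpoly n (\<lambda>z. P (\<sigma> z))"
  using assms by (induction) (auto intro: hpoly.intros)

text \<open>The hypotheses range over a symmetric interval so that real and imaginary parts of
  either sign can be inserted for \<open>T\<close>.\<close>

lemma segment_increment_bound:
  fixes F :: "real \<Rightarrow> complex"
  assumes "\<And>t. \<bar>t\<bar> \<le> \<bar>T\<bar> \<Longrightarrow> (F has_vector_derivative F' t) (at t)"
    and "\<And>t. \<bar>t\<bar> \<le> \<bar>T\<bar> \<Longrightarrow> cmod (F' t) \<le> B"
  shows "cmod (F T - F 0) \<le> B * \<bar>T\<bar>"
proof -
  have "cmod (F T - F 0) \<le> B * norm (T - 0)"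
  proof (rule differentiable_bound[where S = "{-\<bar>T\<bar>..\<bar>T\<bar>}" and f' = "\<lambda>t h. h *\<^sub>R F' t"])
    fix t assume t: "t \<in> {-\<bar>T\<bar>..\<bar>T\<bar>}"
    then have "\<bar>t\<bar> \<le> \<bar>T\<bar>" by auto
    note t = assms[OF this]
    show "(F has_derivative (\<lambda>h. h *\<^sub>R F' t)) (at t within {-\<bar>T\<bar>..\<bar>T\<bar>})"
      using t(1) by (simp add: has_vector_derivative_def has_derivative_at_withinI)
    show "onorm (\<lambda>h. h *\<^sub>R F' t) \<le> B"
      using t(2) order_trans[OF norm_ge_zero t(2)]
      by (intro onorm_le) (simp, subst mult.commute, simp add: mult_right_mono)
  qed auto
  then show ?thesis by simp
qed

text \<open>
  Moving along \<open>0, Re z\<^sub>k, z\<^sub>k\<close> in one coordinate at a time needs only partial derivatives and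
  so avoids a chain rule in several variables.
\<close>

lemma coordinate_leg_bound:
  assumes f: "C1_on_polydisc n f" and k: "k < n" and r: "r < 1" and z: "z \<in> closed_polydisc n r"
    and A: "\<And>z w. ((\<lambda>w. A (z(k := w))) has_field_derivative P (z(k := w))) (at w)"
    and B: "\<And>z w. ((\<lambda>w. B (z(k := w))) has_field_derivative Q (z(k := w))) (at w)"
    and P: "\<And>z. z \<in> closed_polydisc n r \<Longrightarrow> cmod (wirtinger k f z - P z) \<le> \<epsilon>"
    and Q: "\<And>z. z \<in> closed_polydisc n r \<Longrightarrow> cmod (wirtinger_bar k f z - cnj (Q z)) \<le> \<epsilon>"
  shows "cmod ((f z - A z - cnj (B z)) - (f (z(k := 0)) - A (z(k := 0)) - cnj (B (z(k := 0))))) \<le> 4 * \<epsilon>"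
proof -
  define \<Delta> where "\<Delta> w = f (z(k := w)) - A (z(k := w)) - cnj (B (z(k := w)))" for w
  have \<epsilon>: "0 \<le> \<epsilon>" using order_trans[OF norm_ge_zero P[OF z]] .
  have deriv: "((\<lambda>s. \<Delta> (c + s *\<^sub>R v)) has_vector_derivative
      (partial_deriv k v f (z(k := c + t *\<^sub>R v)) - v * P (z(k := c + t *\<^sub>R v)) - cnj (v * Q (z(k := c + t *\<^sub>R v))))) (at t)"
    and small: "cmod (partial_deriv k v f (z(k := c + t *\<^sub>R v)) - v * P (z(k := c + t *\<^sub>R v))
      - cnj (v * Q (z(k := c + t *\<^sub>R v)))) \<le> 2 * \<epsilon>"
    if v: "v \<in> {1, \<i>}" and in_disc: "cmod (c + t *\<^sub>R v) \<le> r" for c v t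
  proof -
    let ?y = "z(k := c + t *\<^sub>R v)"
    have y: "?y \<in> closed_polydisc n r" by (rule closed_polydisc_upd[OF z k in_disc])
    have "?y \<in> polydisc n" using y closed_polydisc_subset[OF r] by blast
    note df = C1_line[OF f k v this]
    have line: "((\<lambda>s. c + s *\<^sub>R v) has_vector_derivative v) (at t)"
      by (auto intro!: derivative_eq_intros)
    have dA: "((\<lambda>s. A (z(k := c + s *\<^sub>R v))) has_vector_derivative v * P ?y) (at t)"
      using field_vector_diff_chain_at[OF line A] by (simp add: o_def)
    have dB: "((\<lambda>s. B (z(k := c + s *\<^sub>R v))) has_vector_derivative v * Q ?y) (at t)"
      using field_vector_diff_chain_at[OF line B] by (simp add: o_def)
    show "((\<lambda>s. \<Delta> (c + s *\<^sub>R v)) has_vector_derivative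
      (partial_deriv k v f ?y - v * P ?y - cnj (v * Q ?y))) (at t)"
      unfolding \<Delta>_def by (intro has_vector_derivative_diff has_vector_derivative_cnj df dA dB)
    \<comment> \<open>Inverting the definitions of the Wirtinger operators, so that their polynomial
      approximations control both real partial derivatives.\<close>
    have p: "partial_deriv k 1 f ?y = wirtinger k f ?y + wirtinger_bar k f ?y"
      "partial_deriv k \<i> f ?y = \<i> * (wirtinger k f ?y - wirtinger_bar k f ?y)"
      by (simp_all add: wirtinger_def wirtinger_bar_def field_simps)
    have "cmod (partial_deriv k v f ?y - v * P ?y - cnj (v * Q ?y))
        = (if v = 1 then cmod ((wirtinger k f ?y - P ?y) + (wirtinger_bar k f ?y - cnj (Q ?y)))
           else cmod (\<i> * ((wirtinger k f ?y - P ?y) - (wirtinger_bar k f ?y - cnj (Q ?y)))))"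
    proof (cases "v = 1")
      case True
      then show ?thesis using p(1) by (simp add: algebra_simps)
    next
      case False
      then have vi: "v = \<i>" using v by simp
      have "partial_deriv k v f ?y - v * P ?y - cnj (v * Q ?y)
          = \<i> * ((wirtinger k f ?y - P ?y) - (wirtinger_bar k f ?y - cnj (Q ?y)))"
        using p(2) unfolding vi by (simp add: algebra_simps)
      then show ?thesis using False by (simp only: if_False)
    qed
    also have "\<dots> \<le> cmod (wirtinger k f ?y - P ?y) + cmod (wirtinger_bar k f ?y - cnj (Q ?y))"
      unfolding norm_mult by (simp add: norm_triangle_ineq norm_triangle_ineq4)
    also have "\<dots> \<le> 2 * \<epsilon>" using P[OF y] Q[OF y] by simp
    finally show "cmod (partial_deriv k v f ?y - v * P ?y - cnj (v * Q ?y)) \<le> 2 * \<epsilon>" .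
  qed
  define x where "x = Re (z k)"
  define y where "y = Im (z k)"
  have zk: "cmod (z k) \<le> r" using closed_polydisc_coordinate[OF z k] .
  have xy: "\<bar>x\<bar> \<le> 1" "\<bar>y\<bar> \<le> 1" "\<bar>x\<bar> \<le> r"
    using abs_Re_le_cmod[of "z k"] abs_Im_le_cmod[of "z k"] zk r by (auto simp: x_def y_def)
  have "cmod (\<Delta> (0 + x *\<^sub>R 1) - \<Delta> (0 + 0 *\<^sub>R 1)) \<le> 2 * \<epsilon> * \<bar>x\<bar>"
    by (rule segment_increment_bound, rule deriv, simp_all add: small)
      (use xy in \<open>auto intro!: small[of 1 0, simplified]\<close>)
  moreover have "cmod (\<Delta> (of_real x + y *\<^sub>R \<i>) - \<Delta> (of_real x + 0 *\<^sub>R \<i>)) \<le> 2 * \<epsilon> * \<bar>y\<bar>"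
  proof (rule segment_increment_bound)
    \<comment> \<open>On the vertical leg the modulus is at most that of \<open>z k\<close>, so the
      path never leaves the closed disc of radius \<open>r\<close>.\<close>
    fix t assume t: "\<bar>t\<bar> \<le> \<bar>y\<bar>"
    have "cmod (of_real x + t *\<^sub>R \<i>) = sqrt (x\<^sup>2 + t\<^sup>2)" by (simp add: cmod_def)
    also have "\<dots> \<le> sqrt (x\<^sup>2 + y\<^sup>2)" using t by (simp add: abs_le_square_iff)
    also have "\<dots> = cmod (z k)" by (simp add: cmod_def x_def y_def)
    finally have *: "cmod (of_real x + t *\<^sub>R \<i>) \<le> r" using zk by simp
    show "((\<lambda>s. \<Delta> (of_real x + s *\<^sub>R \<i>)) has_vector_derivative
      (partial_deriv k \<i> f (z(k := of_real x + t *\<^sub>R \<i>)) - \<i> * P (z(k := of_real x + t *\<^sub>R \<i>))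
        - cnj (\<i> * Q (z(k := of_real x + t *\<^sub>R \<i>))))) (at t)"
      by (rule deriv) (use * in auto)
    show "cmod (partial_deriv k \<i> f (z(k := of_real x + t *\<^sub>R \<i>)) - \<i> * P (z(k := of_real x + t *\<^sub>R \<i>))
        - cnj (\<i> * Q (z(k := of_real x + t *\<^sub>R \<i>)))) \<le> 2 * \<epsilon>"
      by (rule small) (use * in auto)
  qed
  \<comment> \<open>Two legs of length at most 1, each with derivative at most
    \<open>2 * \<epsilon>\<close>: this is the 4 of the claim.\<close>
  moreover have "2 * \<epsilon> * \<bar>x\<bar> \<le> 2 * \<epsilon>" "2 * \<epsilon> * \<bar>y\<bar> \<le> 2 * \<epsilon>"
    using xy \<epsilon> by (simp_all add: mult_left_le)
  moreover have "of_real x + y *\<^sub>R \<i> = z k" by (simp add: complex_eq_iff x_def y_def)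
  moreover have "0 + x *\<^sub>R 1 = of_real x + 0 *\<^sub>R \<i>" by (simp add: scaleR_conv_of_real)
  ultimately have "cmod (\<Delta> (z k) - \<Delta> 0) \<le> 4 * \<epsilon>"
    using norm_triangle_ineq[of "\<Delta> (z k) - \<Delta> (of_real x)" "\<Delta> (of_real x) - \<Delta> 0"] by simp
  then show ?thesis by (simp add: \<Delta>_def)
qed

lemma wirtinger_cnj:
  assumes "C1_on_polydisc n f" "k < n" "z \<in> polydisc n"
  shows "wirtinger_bar k (\<lambda>z. cnj (f z)) z = cnj (wirtinger k f z)"
proof -
  have "partial_deriv k v (\<lambda>z. cnj (f z)) z = cnj (partial_deriv k v f z)" if "v \<in> {1, \<i>}" for v
    using C1_partial[OF assms(1,2) that assms(3)]
    by (intro partial_deriv_eqI has_vector_derivative_cnj)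
  then show ?thesis by (simp add: wirtinger_def wirtinger_bar_def)
qed

lemma C1_cnj:
  assumes f: "C1_on_polydisc n f"
  shows "C1_on_polydisc n (\<lambda>z. cnj (f z))"
  unfolding C1_on_polydisc_def
proof (intro conjI allI impI ballI)
  show "continuous_on (polydisc n) (\<lambda>z. cnj (f z))"
    using f unfolding C1_on_polydisc_def by (intro continuous_intros) auto
  fix k v assume kv: "k < n" "v \<in> {1, \<i>}"
  have D: "((\<lambda>t::real. cnj (f (z(k := z k + t *\<^sub>R v)))) has_vector_derivative cnj (partial_deriv k v f z)) (at 0)"
    if "z \<in> polydisc n" for z
    by (intro has_vector_derivative_cnj C1_partial[OF f kv that])
  show "(\<lambda>t::real. cnj (f (z(k := z k + t *\<^sub>R v)))) differentiable (at 0)"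
    if "z \<in> polydisc n" for z
    by (rule differentiableI_vector[OF D[OF that]])
  have "continuous_on (polydisc n) (\<lambda>z. cnj (partial_deriv k v f z))"
    using f kv unfolding C1_on_polydisc_def by (intro continuous_intros) auto
  then show "continuous_on (polydisc n) (partial_deriv k v (\<lambda>z. cnj (f z)))"
    by (rule continuous_on_eq) (rule partial_deriv_eqI[symmetric], rule D)
qed

text \<open>The Wirtinger derivatives are approximated by polynomials for each \<open>k\<close>
  separately, and these approximations need not form a closed differential. Compatibility is avoided
  by a staircase path that switches the coordinates on one after the other: leg \<open>k\<close>
  uses only the primitives of the \<open>k\<close>-th approximations, and the errors of the legs add
  up.\<close>

lemma pluriharmonic_approx:
  assumes f: "pluriharmonic n f" and r: "0 < r" "r < 1" and \<epsilon>: "0 < \<epsilon>"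
  obtains g h where "hpoly n g" "hpoly n h" "h (\<lambda>_. 0) = 0"
    "\<And>z. z \<in> closed_polydisc n r \<Longrightarrow> cmod (f z - (g z + cnj (h z))) \<le> \<epsilon>"
proof -
  \<comment> \<open>There are \<open>n\<close> legs with an error of at most
    \<open>4 * \<eta>\<close> each; the \<open>+ 1\<close> covers \<open>n = 0\<close>.\<close>
  define \<eta> where "\<eta> = \<epsilon> / (4 * (real n + 1))"
  have \<eta>: "0 < \<eta>" using \<epsilon> by (simp add: \<eta>_def)
  have C2: "C2_on_polydisc n f" using f by (simp add: pluriharmonic_def)
  then have C1: "C1_on_polydisc n f" by (simp add: C2_on_polydisc_def)
  have zero: "wirtinger j (wirtinger_bar k f) z = 0" if "j < n" "k < n" "z \<in> polydisc n" for j k z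
    using f that by (simp add: pluriharmonic_def)
  have "\<exists>A. hpoly n A \<and> (\<exists>P. (\<forall>z w. ((\<lambda>w. A (z(k := w))) has_field_derivative P (z(k := w))) (at w)) \<and>
      (\<forall>z\<in>closed_polydisc n r. cmod (wirtinger k f z - P z) \<le> \<eta>))" if k: "k < n" for k
  proof -
    have "C1_on_polydisc n (wirtinger k f)" using C1_wirtinger[OF C2 k] by blast
    moreover from this have "continuous_on (polydisc n) (wirtinger k f)" by (simp add: C1_on_polydisc_def)
    moreover have "wirtinger_bar j (wirtinger k f) z = 0" if "j < n" "z \<in> polydisc n" for j z
      using wirtinger_commute[OF C2 that(1) k that(2)] zero[OF k that] by simp
    ultimately obtain P where P: "hpoly n P" "\<And>z. z \<in> closed_polydisc n r \<Longrightarrow> cmod (wirtinger k f z - P z) \<le> \<eta>"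
      using separately_holomorphic_approx[of n "wirtinger k f" r \<eta>] C1_holomorphic[of n "wirtinger k f"] r \<eta>
      by metis
    obtain A where "hpoly n A" "\<And>z w. ((\<lambda>w. A (z(k := w))) has_field_derivative P (z(k := w))) (at w)"
      using hpoly_antiderivative[OF P(1) k] by metis
    then show ?thesis using P(2) by blast
  qed
  then obtain A P where A: "\<And>k. k < n \<Longrightarrow> hpoly n (A k)"
    "\<And>k z w. k < n \<Longrightarrow> ((\<lambda>w. A k (z(k := w))) has_field_derivative P k (z(k := w))) (at w)"
    "\<And>k z. k < n \<Longrightarrow> z \<in> closed_polydisc n r \<Longrightarrow> cmod (wirtinger k f z - P k z) \<le> \<eta>"
    by metis
  have "\<exists>B. hpoly n B \<and> (\<exists>Q. (\<forall>z w. ((\<lambda>w. B (z(k := w))) has_field_derivative Q (z(k := w))) (at w)) \<and>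
      (\<forall>z\<in>closed_polydisc n r. cmod (wirtinger_bar k f z - cnj (Q z)) \<le> \<eta>))" if k: "k < n" for k
  proof -
    let ?G = "\<lambda>z. cnj (wirtinger_bar k f z)"
    have W: "C1_on_polydisc n (wirtinger_bar k f)" using C1_wirtinger[OF C2 k] by blast
    then have "C1_on_polydisc n ?G" by (rule C1_cnj)
    moreover from this have "continuous_on (polydisc n) ?G" by (simp add: C1_on_polydisc_def)
    moreover have "wirtinger_bar j ?G z = 0" if "j < n" "z \<in> polydisc n" for j z
      using wirtinger_cnj[OF W that] zero[OF that(1) k that(2)] by simp
    ultimately obtain Q where Q: "hpoly n Q" "\<And>z. z \<in> closed_polydisc n r \<Longrightarrow> cmod (?G z - Q z) \<le> \<eta>"
      using separately_holomorphic_approx[of n ?G r \<eta>] C1_holomorphic[of n ?G] r \<eta>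
      by metis
    obtain B where "hpoly n B" "\<And>z w. ((\<lambda>w. B (z(k := w))) has_field_derivative Q (z(k := w))) (at w)"
      using hpoly_antiderivative[OF Q(1) k] by metis
    moreover have "cmod (wirtinger_bar k f z - cnj (Q z)) \<le> \<eta>" if "z \<in> closed_polydisc n r" for z
      using Q(2)[OF that] complex_mod_cnj[of "wirtinger_bar k f z - cnj (Q z)"] by simp
    ultimately show ?thesis by blast
  qed
  then obtain B Q where B: "\<And>k. k < n \<Longrightarrow> hpoly n (B k)"
    "\<And>k z w. k < n \<Longrightarrow> ((\<lambda>w. B k (z(k := w))) has_field_derivative Q k (z(k := w))) (at w)"
    "\<And>k z. k < n \<Longrightarrow> z \<in> closed_polydisc n r \<Longrightarrow> cmod (wirtinger_bar k f z - cnj (Q k z)) \<le> \<eta>"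
    by metis
  \<comment> \<open>The corners of the staircase. The value \<open>undefined\<close> from
    \<open>n\<close> on keeps them in the closed polydisc, and substituting them into a polynomial
    yields a polynomial again.\<close>
  define \<sigma> where "\<sigma> m z = (\<lambda>i. if i < m then z i else if i < n then 0 else undefined)"
    for m and z :: "nat \<Rightarrow> complex"
  have \<sigma>_hpoly: "hpoly n (\<lambda>z. F (\<sigma> m z))" if "hpoly n F" for F m
    using that
  proof (rule hpoly_substitute)
    show "hpoly n (\<lambda>z. \<sigma> m z k)" if "k < n" for k
      using that by (cases "k < m") (auto simp: \<sigma>_def intro: hpoly.intros)
  qed
  define g0 where "g0 z = f (\<sigma> 0 z) + (\<Sum>k<n. A k (\<sigma> (Suc k) z) - A k (\<sigma> k z))" for z
  define h0 where "h0 z = (\<Sum>k<n. B k (\<sigma> (Suc k) z) - B k (\<sigma> k z))" for z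
  \<comment> \<open>Normalization at the origin: the constant taken from \<open>h0\<close> goes,
    conjugated, into \<open>g\<close>, so the sum \<open>g + cnj h\<close> does not change.\<close>
  define h where "h z = h0 z - h0 (\<lambda>_. 0)" for z
  define g where "g z = g0 z + cnj (h0 (\<lambda>_. 0))" for z
  have "f (\<sigma> 0 z) = f (\<lambda>i. if i < n then 0 else undefined)" for z by (simp add: \<sigma>_def)
  then have g0: "hpoly n g0"
    unfolding g0_def by (auto intro!: hpoly_add hpoly_const hpoly_sum hpoly_diff \<sigma>_hpoly A(1))
  have h0: "hpoly n h0"
    unfolding h0_def by (auto intro!: hpoly_sum hpoly_diff \<sigma>_hpoly B(1))
  have gh: "hpoly n g" "hpoly n h" "h (\<lambda>_. 0) = 0"
    unfolding g_def[abs_def] h_def[abs_def] by (auto intro!: hpoly_add hpoly_diff hpoly_const g0 h0)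
  have "cmod (f z - (g z + cnj (h z))) \<le> \<epsilon>" if z: "z \<in> closed_polydisc n r" for z
  proof -
    define E where "E k = (f (\<sigma> (Suc k) z) - A k (\<sigma> (Suc k) z) - cnj (B k (\<sigma> (Suc k) z)))
        - (f (\<sigma> k z) - A k (\<sigma> k z) - cnj (B k (\<sigma> k z)))" for k
    have E: "cmod (E k) \<le> 4 * \<eta>" if k: "k < n" for k
    proof -
      have in_D: "\<sigma> (Suc k) z \<in> closed_polydisc n r"
        using z k r by (auto simp: mem_closed_polydisc \<sigma>_def extensional_def)
      have eq: "\<sigma> k z = (\<sigma> (Suc k) z)(k := 0)"
        using k by (auto simp: \<sigma>_def fun_eq_iff less_Suc_eq)
      show ?thesis unfolding E_def eq
        by (rule coordinate_leg_bound[OF C1 k r(2) in_D, where P = "P k" and Q = "Q k"])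
          (rule A(2,3)[OF k] B(2,3)[OF k], assumption?)+
    qed
    have "\<sigma> n z = z" using z by (auto simp: \<sigma>_def mem_closed_polydisc extensional_def)
    then have "f z - f (\<sigma> 0 z) = (\<Sum>k<n. f (\<sigma> (Suc k) z) - f (\<sigma> k z))"
      using sum_lessThan_telescope[of "\<lambda>k. f (\<sigma> k z)" n] by simp
    then have "f z - (g z + cnj (h z)) = (\<Sum>k<n. E k)"
      by (simp add: g_def h_def g0_def h0_def E_def sum_subtractf sum.distrib algebra_simps)
    also have "cmod \<dots> \<le> (\<Sum>k<n. 4 * \<eta>)" using E by (intro sum_norm_le) auto
    also have "\<dots> = real n * (4 * \<eta>)" by simp
    also have "\<dots> \<le> (real n + 1) * (4 * \<eta>)" using \<eta> by (intro mult_right_mono) auto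
    also have "\<dots> = \<epsilon>" by (simp add: \<eta>_def field_simps)
    finally show ?thesis .
  qed
  then show ?thesis using gh that by blast
qed

section \<open>The upper bound\<close>

text \<open>Used to compare a value at an extensional point, such as the dilated origin, with the
  value at the zero function.\<close>

lemma hpoly_cong: "hpoly n P \<Longrightarrow> (\<And>k. k < n \<Longrightarrow> z k = w k) \<Longrightarrow> P z = P w"
  by (induction rule: hpoly.induct) auto

text \<open>Minkowski's inequality in pointwise form: convexity of the \<open>m\<close>-th power
  with weights \<open>a / (a + b)\<close> and \<open>b / (a + b)\<close>. If the integrals of
  \<open>u ^ m\<close> and \<open>v ^ m\<close> are at most \<open>a ^ m\<close> and
  \<open>b ^ m\<close>, integration bounds that of \<open>(u + v) ^ m\<close> by
  \<open>(a + b) ^ m\<close>.\<close>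

lemma power_sum_convex:
  fixes u v a b :: real
  assumes "0 \<le> u" "0 \<le> v" "0 < a" "0 < b" "1 \<le> m"
  shows "(u + v) ^ m \<le> (a + b) ^ m * (a / (a + b) * (u / a) ^ m + b / (a + b) * (v / b) ^ m)"
proof -
  obtain k where k: "m = Suc k" using assms(5) by (cases m) auto
  define S where "S = a + b"
  have S: "0 < S" using assms by (simp add: S_def)
  define x where "x = (u + v) / S"
  have x: "0 \<le> x" using assms S by (simp add: x_def)
  have pq: "a / S + b / S = 1" "a / S * (u / a) + b / S * (v / b) = x"
    using assms S by (simp_all add: S_def x_def add_divide_distrib[symmetric])
  have "a / S * (x ^ m + real m * x ^ k * (u / a - x)) + b / S * (x ^ m + real m * x ^ k * (v / b - x))
      = (a / S + b / S) * x ^ m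
        + real m * x ^ k * ((a / S * (u / a) + b / S * (v / b)) - (a / S + b / S) * x)"
    by (simp only: distrib_left distrib_right right_diff_distrib left_diff_distrib mult_ac)
  also have "\<dots> = x ^ m" unfolding pq by simp
  finally have "x ^ m = a / S * (x ^ m + real m * x ^ k * (u / a - x)) + b / S * (x ^ m + real m * x ^ k * (v / b - x))"
    by simp
  also have "\<dots> \<le> a / S * (u / a) ^ m + b / S * (v / b) ^ m"
    using assms S x unfolding k by (intro add_mono mult_left_mono power_above_tangent) auto
  finally have "S ^ m * x ^ m \<le> S ^ m * (a / S * (u / a) ^ m + b / S * (v / b) ^ m)"
    using S by (intro mult_left_mono) auto
  moreover have "S ^ m * x ^ m = (u + v) ^ m" using S by (simp add: x_def power_mult_distrib[symmetric])
  ultimately show ?thesis by (simp add: S_def)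
qed

text \<open>Besides convergence of the integrals, this supplies the measurability of
  \<open>F\<close>, which is obtained as a pointwise limit of measurable functions. Boundedness
  makes a constant an integrable majorant.\<close>

lemma (in moment_measure) integral_power_limit:
  fixes F :: "(nat \<Rightarrow> complex) \<Rightarrow> complex"
  assumes P: "\<And>j. P j \<in> borel_measurable M"
    and lim: "\<And>j z. z \<in> space M \<Longrightarrow> cmod (F z - P j z) \<le> 1 / real (Suc j)"
    and K: "\<And>z. z \<in> space M \<Longrightarrow> cmod (F z) \<le> K"
  shows "F \<in> borel_measurable M" "integrable M (\<lambda>z. cmod (F z) ^ p)"
    "(\<lambda>j. \<integral>z. cmod (P j z) ^ p \<partial>M) \<longlonglongrightarrow> (\<integral>z. cmod (F z) ^ p \<partial>M)"
proof -
  have tends: "(\<lambda>j. P j z) \<longlonglongrightarrow> F z" if "z \<in> space M" for z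
  proof (rule LIMSEQ_I)
    fix e :: real assume "0 < e"
    then obtain N where N: "1 / real (Suc N) < e"
      using reals_Archimedean by (auto simp: inverse_eq_divide)
    have "norm (P j z - F z) < e" if "j \<ge> N" for j
    proof -
      have "norm (P j z - F z) \<le> 1 / real (Suc j)"
        using lim[OF \<open>z \<in> space M\<close>, of j] by (simp add: norm_minus_commute)
      also have "\<dots> \<le> 1 / real (Suc N)" using that by (simp add: frac_le)
      finally show ?thesis using N by simp
    qed
    then show "\<exists>N. \<forall>j\<ge>N. norm (P j z - F z) < e" by blast
  qed
  show F: "F \<in> borel_measurable M"
    using P tends by (rule borel_measurable_LIMSEQ_metric)
  have Pb: "cmod (P j z) \<le> K + 1" if "z \<in> space M" for j z
  proof -
    have "1 / real (Suc j) \<le> 1" by simp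
    moreover have "cmod (P j z) \<le> cmod (F z) + cmod (F z - P j z)"
      using norm_triangle_ineq4[of "F z" "F z - P j z"] by simp
    ultimately show ?thesis
      using lim[OF that, of j] K[OF that] by linarith
  qed
  show "integrable M (\<lambda>z. cmod (F z) ^ p)"
    using F K by (intro integrable_bounded[where B = "K ^ p"]) (auto intro: power_mono)
  show "(\<lambda>j. \<integral>z. cmod (P j z) ^ p \<partial>M) \<longlonglongrightarrow> (\<integral>z. cmod (F z) ^ p \<partial>M)"
  proof (rule integral_dominated_convergence[where w = "\<lambda>_. (K + 1) ^ p"])
    show "AE z in M. (\<lambda>j. cmod (P j z) ^ p) \<longlonglongrightarrow> cmod (F z) ^ p"
      by (intro AE_I2 tendsto_intros tends)
    show "AE z in M. norm (cmod (P j z) ^ p) \<le> (K + 1) ^ p" for j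
      by (intro AE_I2) (auto intro: power_mono Pb)
  qed (use P F in auto)
qed

lemma hpoly_pair_contraction:
  assumes m: "1 \<le> m" and M: "moment_measure M n (moment_weight m)" and T: "moment_measure T n (\<lambda>_. 1)"
    and g: "hpoly n g" and h: "hpoly n h" and h0: "h (\<lambda>_. 0) = 0"
  shows "(\<integral>z. cmod (g z + cnj (h z)) ^ (2 * m) \<partial>M)
    \<le> D_const m ^ (2 * m) * (\<integral>z. cmod (g z + cnj (h z)) ^ 2 \<partial>T) ^ m"
proof -
  interpret M: moment_measure M n "moment_weight m" by fact
  interpret T: moment_measure T n "\<lambda>_. 1" by fact
  define A where "A = (\<integral>z. (cmod (g z))\<^sup>2 \<partial>T)"
  define B where "B = (\<integral>z. (cmod (h z))\<^sup>2 \<partial>T)"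
  have A0: "0 \<le> A" "0 \<le> B" by (auto simp: A_def B_def)
  have gh: "hpoly n (\<lambda>z. g z * h z)" "hpoly n (\<lambda>z. (2 * g z * h z) ^ m)"
    by (intro hpoly.intros hpoly_power g h)+
  note int_T = T.hpoly_norm_power_integrable[OF g, of 2] T.hpoly_norm_power_integrable[OF h, of 2]
    T.hpoly_integrable[OF gh(1)]
  \<comment> \<open>On the torus the cross term is \<open>2 Re (g h)\<close>, whose mean is its
    value 0 at the origin; the squared Hardy norm is therefore exactly \<open>A + B\<close>.\<close>
  have "(\<integral>z. cmod (g z + cnj (h z)) ^ 2 \<partial>T)
      = (\<integral>z. ((cmod (g z))\<^sup>2 + (cmod (h z))\<^sup>2) + 2 * Re (g z * h z) \<partial>T)"
    by (intro Bochner_Integration.integral_cong refl)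
      (simp add: cmod_power2, simp add: power2_eq_square algebra_simps)
  also have "\<dots> = (A + B) + 2 * Re (\<integral>z. g z * h z \<partial>T)"
    using int_T by (simp add: A_def B_def del: times_complex.sel)
  also have "(\<integral>z. g z * h z \<partial>T) = 0" using T.integral_hpoly[OF gh(1)] h0 by simp
  finally have norm_T: "(\<integral>z. cmod (g z + cnj (h z)) ^ 2 \<partial>T) = A + B" by simp
  have int_g: "integrable M (\<lambda>z. ((cmod (g z))\<^sup>2) ^ m)" and int_h: "integrable M (\<lambda>z. ((cmod (h z))\<^sup>2) ^ m)"
    using M.hpoly_norm_power_integrable[OF g, of "2 * m"] M.hpoly_norm_power_integrable[OF h, of "2 * m"]
    by (simp_all add: power_mult)
  have le_A: "(\<integral>z. ((cmod (g z))\<^sup>2) ^ m \<partial>M) \<le> A ^ m" and le_B: "(\<integral>z. ((cmod (h z))\<^sup>2) ^ m \<partial>M) \<le> B ^ m"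
    using hpoly_contraction[OF M T g] hpoly_contraction[OF M T h]
    by (simp_all add: power_mult A_def B_def)
  have int_Q: "integrable M (\<lambda>z. ((cmod (g z))\<^sup>2 + (cmod (h z))\<^sup>2) ^ m)"
  proof -
    obtain a where a: "\<And>z. z \<in> space M \<Longrightarrow> cmod (g z) \<le> a" "0 \<le> a"
      using M.hpoly_bounded_on_space[OF g] by blast
    obtain b where b: "\<And>z. z \<in> space M \<Longrightarrow> cmod (h z) \<le> b" "0 \<le> b"
      using M.hpoly_bounded_on_space[OF h] by blast
    show ?thesis
      using M.hpoly_measurable[OF g] M.hpoly_measurable[OF h] a b
      by (intro M.integrable_bounded[where B = "(a\<^sup>2 + b\<^sup>2) ^ m"]) (auto intro!: power_mono add_mono)
  qed
  \<comment> \<open>The shift by \<open>\<delta>\<close> keeps the convexity weights positive when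
    \<open>g\<close> or \<open>h\<close> vanishes on the torus; it is removed by a limit.\<close>
  have le_delta: "(\<integral>z. ((cmod (g z))\<^sup>2 + (cmod (h z))\<^sup>2) ^ m \<partial>M) \<le> ((A + \<delta>) + (B + \<delta>)) ^ m" if \<delta>: "0 < \<delta>" for \<delta>
  proof -
    let ?a = "A + \<delta>" and ?b = "B + \<delta>"
    have ab: "0 < ?a" "0 < ?b" using A0 \<delta> by auto
    have "(\<integral>z. ((cmod (g z))\<^sup>2 + (cmod (h z))\<^sup>2) ^ m \<partial>M)
        \<le> (\<integral>z. (?a + ?b) ^ m * (?a / (?a + ?b) * ((cmod (g z))\<^sup>2 / ?a) ^ m
            + ?b / (?a + ?b) * ((cmod (h z))\<^sup>2 / ?b) ^ m) \<partial>M)"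
      using int_g int_h
      by (intro integral_mono int_Q power_sum_convex ab m) (auto simp: power_divide)
    also have "\<dots> = (?a + ?b) ^ m * (?a / (?a + ?b) * ((\<integral>z. ((cmod (g z))\<^sup>2) ^ m \<partial>M) / ?a ^ m)
        + ?b / (?a + ?b) * ((\<integral>z. ((cmod (h z))\<^sup>2) ^ m \<partial>M) / ?b ^ m))"
      using int_g int_h by (simp add: power_divide)
    also have "\<dots> \<le> (?a + ?b) ^ m * (?a / (?a + ?b) * 1 + ?b / (?a + ?b) * 1)"
    proof -
      have "(\<integral>z. ((cmod (g z))\<^sup>2) ^ m \<partial>M) \<le> ?a ^ m" "(\<integral>z. ((cmod (h z))\<^sup>2) ^ m \<partial>M) \<le> ?b ^ m"
        using le_A le_B power_mono[of A ?a m] power_mono[of B ?b m] A0 \<delta> by linarith+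
      then show ?thesis using ab by (intro mult_left_mono add_mono) (auto simp: field_simps)
    qed
    also have "\<dots> = (?a + ?b) ^ m"
    proof -
      have "?a / (?a + ?b) * 1 + ?b / (?a + ?b) * 1 = (?a + ?b) / (?a + ?b)"
        by (simp only: mult_1_right add_divide_distrib)
      also have "\<dots> = 1" using ab by simp
      finally show ?thesis by simp
    qed
    finally show ?thesis .
  qed
  have le_AB: "(\<integral>z. ((cmod (g z))\<^sup>2 + (cmod (h z))\<^sup>2) ^ m \<partial>M) \<le> (A + B) ^ m"
  proof (rule tendsto_lowerbound)
    have "((\<lambda>\<delta>. ((A + \<delta>) + (B + \<delta>)) ^ m) \<longlongrightarrow> ((A + 0) + (B + 0)) ^ m) (at_right 0)"
      by (intro tendsto_intros)
    then show "((\<lambda>\<delta>. ((A + \<delta>) + (B + \<delta>)) ^ m) \<longlongrightarrow> (A + B) ^ m) (at_right 0)" by simp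
    show "\<forall>\<^sub>F \<delta> in at_right 0. (\<integral>z. ((cmod (g z))\<^sup>2 + (cmod (h z))\<^sup>2) ^ m \<partial>M) \<le> ((A + \<delta>) + (B + \<delta>)) ^ m"
      using eventually_at_right_less[of 0] by eventually_elim (rule le_delta)
  qed simp
  have int_gh: "integrable M (\<lambda>z. cmod (g z + cnj (h z)) ^ (2 * m))"
  proof -
    obtain a where a: "\<And>z. z \<in> space M \<Longrightarrow> cmod (g z) \<le> a" "0 \<le> a"
      using M.hpoly_bounded_on_space[OF g] by blast
    obtain b where b: "\<And>z. z \<in> space M \<Longrightarrow> cmod (h z) \<le> b" "0 \<le> b"
      using M.hpoly_bounded_on_space[OF h] by blast
    have "cmod (g z + cnj (h z)) \<le> a + b" if "z \<in> space M" for z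
      using norm_triangle_ineq[of "g z" "cnj (h z)"] a(1)[OF that] b(1)[OF that] by simp
    then show ?thesis
      using M.hpoly_measurable[OF g] M.hpoly_measurable[OF h]
      by (intro M.integrable_bounded[where B = "(a + b) ^ (2 * m)"]) (auto intro: power_mono)
  qed
  have "(\<integral>z. cmod (g z + cnj (h z)) ^ (2 * m) \<partial>M)
      \<le> (\<integral>z. D_const m ^ (2 * m) * ((cmod (g z))\<^sup>2 + (cmod (h z))\<^sup>2) ^ m
          + hv_coeff m * Re ((2 * g z * h z) ^ m) \<partial>M)"
    using int_Q M.hpoly_integrable[OF gh(2)]
    by (intro integral_mono int_gh hollenbeck_verbitsky m) auto
  also have "\<dots> = D_const m ^ (2 * m) * (\<integral>z. ((cmod (g z))\<^sup>2 + (cmod (h z))\<^sup>2) ^ m \<partial>M)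
      + hv_coeff m * Re (\<integral>z. (2 * g z * h z) ^ m \<partial>M)"
    using int_Q M.hpoly_integrable[OF gh(2)] by simp
  also have "(\<integral>z. (2 * g z * h z) ^ m \<partial>M) = 0"
    using M.integral_hpoly[OF gh(2)] h0 m by (simp add: power_0_left)
  also have "D_const m ^ (2 * m) * (\<integral>z. ((cmod (g z))\<^sup>2 + (cmod (h z))\<^sup>2) ^ m \<partial>M) + hv_coeff m * Re 0
      \<le> D_const m ^ (2 * m) * (A + B) ^ m"
    using le_AB by (simp add: power_mult mult_left_mono)
  finally show ?thesis unfolding norm_T .
qed

section \<open>From polynomials to functions of the Hardy space\<close>

definition dilate :: "nat \<Rightarrow> real \<Rightarrow> (nat \<Rightarrow> complex) \<Rightarrow> nat \<Rightarrow> complex" where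
  "dilate n \<rho> z = (\<lambda>k\<in>{..<n}. \<rho> *\<^sub>R z k)"

lemma dilate_closed_polydisc:
  assumes "\<And>k. k < n \<Longrightarrow> cmod (z k) \<le> 1" "0 \<le> \<rho>"
  shows "dilate n \<rho> z \<in> closed_polydisc n \<rho>"
  using assms by (auto simp: mem_closed_polydisc dilate_def mult_left_le)

text \<open>Dilation by \<open>\<rho> < 1\<close> sends the spaces of both measures into
  \<open>closed_polydisc n \<rho>\<close>, where polynomial pairs approximate \<open>f\<close>
  uniformly; hence both sides of the polynomial inequality pass to the limit.\<close>

lemma dilated_contraction:
  assumes m: "2 \<le> m" and f: "pluriharmonic n f" and \<rho>: "0 < \<rho>" "\<rho> < 1"
  shows "integrable (bergman_measure n m) (\<lambda>z. cmod (f (dilate n \<rho> z)) ^ (2 * m))"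
    "integrable (torus_measure n) (\<lambda>z. cmod (f (dilate n \<rho> z)) ^ 2)"
    "(\<integral>z. cmod (f (dilate n \<rho> z)) ^ (2 * m) \<partial>bergman_measure n m)
      \<le> D_const m ^ (2 * m) * (\<integral>z. cmod (f (dilate n \<rho> z)) ^ 2 \<partial>torus_measure n) ^ m"
proof -
  interpret M: moment_measure "bergman_measure n m" n "moment_weight m"
    by (rule moment_measure_bergman[OF m])
  interpret T: moment_measure "torus_measure n" n "\<lambda>_. 1"
    by (rule moment_measure_torus)
  have "\<exists>g h. hpoly n g \<and> hpoly n h \<and> h (\<lambda>_. 0) = 0 \<and>
      (\<forall>z\<in>closed_polydisc n \<rho>. cmod (f z - (g z + cnj (h z))) \<le> 1 / real (Suc j))" for j
    using pluriharmonic_approx[OF f \<rho>, of "1 / real (Suc j)"]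
    by (metis of_nat_0_less_iff zero_less_Suc zero_less_divide_1_iff)
  then obtain g h where g: "\<And>j. hpoly n (g j)" and h: "\<And>j. hpoly n (h j)" and h0: "\<And>j. h j (\<lambda>_. 0) = 0"
    and approx: "\<And>j z. z \<in> closed_polydisc n \<rho> \<Longrightarrow> cmod (f z - (g j z + cnj (h j z))) \<le> 1 / real (Suc j)"
    by metis
  have dil: "hpoly n (\<lambda>z. P (dilate n \<rho> z))" if "hpoly n P" for P
    using that
  proof (rule hpoly_substitute)
    show "hpoly n (\<lambda>z. dilate n \<rho> z k)" if "k < n" for k
      using that by (auto simp: dilate_def scaleR_conv_of_real intro!: hpoly.intros)
  qed
  have dil0: "h j (dilate n \<rho> (\<lambda>_. 0)) = 0" for j
    using hpoly_cong[OF h, of "dilate n \<rho> (\<lambda>_. 0)" "\<lambda>_. 0" j] h0 by (simp add: dilate_def)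
  define P where "P j z = g j (dilate n \<rho> z) + cnj (h j (dilate n \<rho> z))" for j z
  define F where "F z = f (dilate n \<rho> z)" for z
  have "continuous_on (polydisc n) f"
    using f by (simp add: pluriharmonic_def C2_on_polydisc_def C1_on_polydisc_def)
  then obtain K where K: "\<And>z. z \<in> closed_polydisc n \<rho> \<Longrightarrow> cmod (f z) \<le> K"
    using bounded_on_closed_polydisc[of n f \<rho>] \<rho> by metis
  have MP: "P j \<in> borel_measurable (bergman_measure n m)" for j
    unfolding P_def[abs_def]
    using M.hpoly_measurable[OF dil[OF g, of j]] M.hpoly_measurable[OF dil[OF h, of j]] by measurable
  have TP: "P j \<in> borel_measurable (torus_measure n)" for j
    unfolding P_def[abs_def]
    using T.hpoly_measurable[OF dil[OF g, of j]] T.hpoly_measurable[OF dil[OF h, of j]] by measurable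
  have M_in: "dilate n \<rho> z \<in> closed_polydisc n \<rho>" if "z \<in> space (bergman_measure n m)" for z
    using M.coordinate_le[OF that] \<rho> by (intro dilate_closed_polydisc) auto
  have T_in: "dilate n \<rho> z \<in> closed_polydisc n \<rho>" if "z \<in> space (torus_measure n)" for z
    using T.coordinate_le[OF that] \<rho> by (intro dilate_closed_polydisc) auto
  have close: "cmod (F z - P j z) \<le> 1 / real (Suc j)" if "dilate n \<rho> z \<in> closed_polydisc n \<rho>" for j z
    unfolding F_def P_def by (rule approx[OF that])
  have bound: "cmod (F z) \<le> K" if "dilate n \<rho> z \<in> closed_polydisc n \<rho>" for z
    unfolding F_def by (rule K[OF that])
  note lim_M = M.integral_power_limit(2,3)[OF MP close[OF M_in] bound[OF M_in], of "2 * m"]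
  note lim_T = T.integral_power_limit(2,3)[OF TP close[OF T_in] bound[OF T_in], of 2]
  show "integrable (bergman_measure n m) (\<lambda>z. cmod (f (dilate n \<rho> z)) ^ (2 * m))"
    "integrable (torus_measure n) (\<lambda>z. cmod (f (dilate n \<rho> z)) ^ 2)"
    using lim_M(1) lim_T(1) by (simp_all add: F_def)
  have "(\<integral>z. cmod (F z) ^ (2 * m) \<partial>bergman_measure n m)
      \<le> D_const m ^ (2 * m) * (\<integral>z. cmod (F z) ^ 2 \<partial>torus_measure n) ^ m"
  proof (rule LIMSEQ_le[OF lim_M(2)])
    show "(\<lambda>j. D_const m ^ (2 * m) * (\<integral>z. cmod (P j z) ^ 2 \<partial>torus_measure n) ^ m)
        \<longlonglongrightarrow> D_const m ^ (2 * m) * (\<integral>z. cmod (F z) ^ 2 \<partial>torus_measure n) ^ m"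
      by (intro tendsto_intros lim_T(2))
    show "\<exists>N. \<forall>j\<ge>N. (\<integral>z. cmod (P j z) ^ (2 * m) \<partial>bergman_measure n m)
        \<le> D_const m ^ (2 * m) * (\<integral>z. cmod (P j z) ^ 2 \<partial>torus_measure n) ^ m"
      unfolding P_def
      by (intro exI[of _ 0] allI impI hpoly_pair_contraction[OF _ moment_measure_bergman[OF m]
            moment_measure_torus dil[OF g] dil[OF h] dil0])
        (use m in simp)
  qed
  then show "(\<integral>z. cmod (f (dilate n \<rho> z)) ^ (2 * m) \<partial>bergman_measure n m)
      \<le> D_const m ^ (2 * m) * (\<integral>z. cmod (f (dilate n \<rho> z)) ^ 2 \<partial>torus_measure n) ^ m"
    by (simp add: F_def)
qed

lemma powr_real_nat: "0 \<le> x \<Longrightarrow> 0 < j \<Longrightarrow> x powr real j = x ^ j"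
  by (cases "x = 0") (auto simp: powr_realpow)

lemma Lp_norm_nat:
  assumes "0 < j"
  shows "Lp_norm M (real j) F = (let I = \<integral>\<^sup>+ x. ennreal (cmod (F x) ^ j) \<partial>M
    in if I = \<infinity> then \<infinity> else ennreal (enn2real I powr (1 / real j)))"
  unfolding Lp_norm_def by (simp add: powr_real_nat assms)

lemma Lp_norm_integrable:
  assumes "0 < j" "integrable M (\<lambda>x. cmod (F x) ^ j)"
  shows "Lp_norm M (real j) F = ennreal ((\<integral>x. cmod (F x) ^ j \<partial>M) powr (1 / real j))"
  using assms nn_integral_eq_integral[OF assms(2)]
  by (simp add: Lp_norm_nat Let_def)

lemma Lp_norm_le:
  assumes j: "0 < j" and X: "0 \<le> X" and I: "(\<integral>\<^sup>+ x. ennreal (cmod (F x) ^ j) \<partial>M) \<le> ennreal (X ^ j)"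
  shows "Lp_norm M (real j) F \<le> ennreal X"
proof -
  let ?I = "\<integral>\<^sup>+ x. ennreal (cmod (F x) ^ j) \<partial>M"
  have fin: "?I \<noteq> \<infinity>" using I by (auto simp: top_unique)
  have "enn2real ?I \<le> X ^ j" using I X by (simp add: enn2real_leI)
  then have "enn2real ?I powr (1 / real j) \<le> (X ^ j) powr (1 / real j)"
    by (intro powr_mono2) auto
  also have "\<dots> = X"
  proof (cases "X = 0")
    case False
    then have "(X ^ j) powr (1 / real j) = (X powr real j) powr (1 / real j)"
      using X by (simp add: powr_realpow)
    also have "\<dots> = X" using False X j by (simp add: powr_powr)
    finally show ?thesis .
  qed (use j in \<open>simp add: power_0_left\<close>)
  finally show ?thesis using fin by (simp add: Lp_norm_nat[OF j] Let_def ennreal_leI)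
qed

lemma D_const_nonneg: "0 \<le> D_const m"
proof (cases "m = 0")
  case False
  then have "pi / (4 * real m) \<le> pi / 2" by (intro divide_left_mono) auto
  then show ?thesis unfolding D_const_def
    by (intro mult_nonneg_nonneg cos_ge_zero) (auto intro: order_trans[of _ 0])
qed (simp add: D_const_def)

text \<open>The torus integral of each dilation is bounded by the squared Hardy norm by definition
  of the supremum. On the Bergman side the dilations converge pointwise by continuity, and with no
  majorant at hand Fatou's lemma carries the bound over to \<open>f\<close>.\<close>

lemma bergman_norm_le_hardy_norm:
  assumes m: "2 \<le> m" and f: "f \<in> hardy_space n 2"
  shows "bergman_norm n m (real m * 2) f \<le> ennreal (D_const m) * hardy_norm n 2 f"
proof -
  have pl: "pluriharmonic n f" and fin: "hardy_norm n 2 f < \<infinity>" using f by (auto simp: hardy_space_def)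
  define H where "H = enn2real (hardy_norm n 2 f)"
  have H: "hardy_norm n 2 f = ennreal H" "0 \<le> H" using fin by (simp_all add: H_def)
  have torus_le: "(\<integral>z. cmod (f (dilate n \<rho> z)) ^ 2 \<partial>torus_measure n) \<le> H\<^sup>2" if \<rho>: "0 < \<rho>" "\<rho> < 1" for \<rho>
  proof -
    let ?J = "\<integral>z. cmod (f (dilate n \<rho> z)) ^ 2 \<partial>torus_measure n"
    have J: "0 \<le> ?J" by simp
    have "Lp_norm (torus_measure n) (real 2) (\<lambda>z. f (dilate n \<rho> z)) \<le> hardy_norm n 2 f"
      unfolding hardy_norm_def dilate_def using \<rho> by (intro SUP_upper2[of \<rho>]) auto
    then have "ennreal (?J powr (1 / real 2)) \<le> ennreal H"
      unfolding H(1) by (subst (asm) Lp_norm_integrable) (auto intro: dilated_contraction[OF m pl \<rho>])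
    then have "sqrt ?J \<le> H" using H(2) J by (simp add: powr_half_sqrt)
    then show ?thesis using J by (simp add: sqrt_le_D)
  qed
  define X where "X = D_const m * H"
  have X: "0 \<le> X" using D_const_nonneg H by (simp add: X_def)
  have bergman_le: "(\<integral>\<^sup>+ z. ennreal (cmod (f (dilate n \<rho> z)) ^ (2 * m)) \<partial>bergman_measure n m) \<le> ennreal (X ^ (2 * m))"
    if \<rho>: "0 < \<rho>" "\<rho> < 1" for \<rho>
  proof -
    note dc = dilated_contraction[OF m pl \<rho>]
    have "(\<integral>z. cmod (f (dilate n \<rho> z)) ^ (2 * m) \<partial>bergman_measure n m) \<le> D_const m ^ (2 * m) * (H\<^sup>2) ^ m"
      using torus_le[OF \<rho>] D_const_nonneg
      by (intro order_trans[OF dc(3)] mult_left_mono power_mono) auto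
    also have "\<dots> = X ^ (2 * m)" by (simp add: X_def power_mult power_mult_distrib)
    finally show ?thesis
      by (subst nn_integral_eq_integral[OF dc(1)]) (auto simp: ennreal_leI)
  qed
  define \<rho> where "\<rho> j = 1 - 1 / real (j + 2)" for j :: nat
  have \<rho>: "0 < \<rho> j" "\<rho> j < 1" for j by (auto simp: \<rho>_def)
  have \<rho>_lim: "\<rho> \<longlonglongrightarrow> 1"
  proof -
    have "(\<lambda>j. 1 / real (j + 2)) \<longlonglongrightarrow> 0"
      using LIMSEQ_ignore_initial_segment[OF lim_1_over_n, of 2] by simp
    from tendsto_diff[OF tendsto_const[of 1] this] show ?thesis unfolding \<rho>_def by simp
  qed
  have lim: "(\<lambda>j. f (dilate n (\<rho> j) z)) \<longlonglongrightarrow> f z" if z: "z \<in> polydisc n" for z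
  proof -
    have cont: "continuous_on (polydisc n) f"
      using pl by (simp add: pluriharmonic_def C2_on_polydisc_def C1_on_polydisc_def)
    have "continuous_on UNIV (\<lambda>r. dilate n r z)"
    proof (rule continuous_on_coordinatewise_then_product)
      show "continuous_on UNIV (\<lambda>r. dilate n r z k)" for k
        by (cases "k < n") (auto simp: dilate_def intro!: continuous_intros)
    qed
    from continuous_on_tendsto_compose[OF this \<rho>_lim]
    have "(\<lambda>j. dilate n (\<rho> j) z) \<longlonglongrightarrow> dilate n 1 z" by simp
    also have "dilate n 1 z = z"
      using z by (auto simp: dilate_def mem_polydisc extensional_def)
    finally have "(\<lambda>j. dilate n (\<rho> j) z) \<longlonglongrightarrow> z" .
    moreover have "dilate n (\<rho> j) z \<in> polydisc n" for j
      using dilate_closed_polydisc[of n z "\<rho> j"] closed_polydisc_subset[of "\<rho> j" n] \<rho>[of j] z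
      by (auto simp: mem_polydisc less_imp_le)
    ultimately show ?thesis
      by (intro continuous_on_tendsto_compose[OF cont _ z]) simp_all
  qed
  have "(\<integral>\<^sup>+ z. ennreal (cmod (f z) ^ (2 * m)) \<partial>bergman_measure n m)
      = (\<integral>\<^sup>+ z. liminf (\<lambda>j. ennreal (cmod (f (dilate n (\<rho> j) z)) ^ (2 * m))) \<partial>bergman_measure n m)"
  proof (intro nn_integral_cong)
    fix z assume "z \<in> space (bergman_measure n m)"
    then have "z \<in> polydisc n" by (simp add: space_bergman)
    then have "(\<lambda>j. ennreal (cmod (f (dilate n (\<rho> j) z)) ^ (2 * m))) \<longlonglongrightarrow> ennreal (cmod (f z) ^ (2 * m))"
      by (intro tendsto_intros lim)
    from lim_imp_Liminf[OF _ this]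
    show "ennreal (cmod (f z) ^ (2 * m)) = liminf (\<lambda>j. ennreal (cmod (f (dilate n (\<rho> j) z)) ^ (2 * m)))"
      by simp
  qed
  also have "\<dots> \<le> liminf (\<lambda>j. \<integral>\<^sup>+ z. ennreal (cmod (f (dilate n (\<rho> j) z)) ^ (2 * m)) \<partial>bergman_measure n m)"
    using dilated_contraction(1)[OF m pl \<rho>] by (intro nn_integral_liminf) (auto dest: borel_measurable_integrable)
  also have "\<dots> \<le> liminf (\<lambda>j. ennreal (X ^ (2 * m)))"
    by (intro Liminf_mono always_eventually allI bergman_le \<rho>)
  also have "\<dots> = ennreal (X ^ (2 * m))" by (simp add: Liminf_const)
  finally have "Lp_norm (bergman_measure n m) (real (2 * m)) f \<le> ennreal X"
    using m X by (intro Lp_norm_le) auto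
  then show ?thesis
    using D_const_nonneg H by (simp add: bergman_norm_def X_def ennreal_mult mult.commute)
qed

lemma best_const_le:
  assumes "2 \<le> m"
  shows "best_const 2 m n \<le> ereal (D_const m)"
  unfolding best_const_def using bergman_norm_le_hardy_norm[OF assms] D_const_nonneg
  by (intro Inf_lower) auto

section \<open>The lower bound\<close>

text \<open>The form \<open>A + cnj B\<close> with two different functions is stable: a partial
  derivative in coordinate 0 has it again, with \<open>v A'\<close> and \<open>v B'\<close>, so
  second derivatives come from a second application. The formula for \<open>F\<close> is asked for
  on the polydisc only, since partial derivatives are known only there.\<close>

lemma C1_holomorphic_pair:
  assumes A: "A holomorphic_on ball 0 1" and B: "B holomorphic_on ball 0 1" and n: "0 < n"
    and F: "\<And>z. z \<in> polydisc n \<Longrightarrow> F z = A (z 0) + cnj (B (z 0))"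
  shows "C1_on_polydisc n F"
    and "\<And>k v z. k < n \<Longrightarrow> z \<in> polydisc n \<Longrightarrow> partial_deriv k v F z
      = (if k = 0 then v * deriv A (z 0) + cnj (v * deriv B (z 0)) else 0)"
proof -
  let ?d = "\<lambda>k v z. if k = 0 then v * deriv A (z 0) + cnj (v * deriv B (z 0)) else 0"
  have D: "((\<lambda>t::real. F (z(k := z k + t *\<^sub>R v))) has_vector_derivative ?d k v z) (at 0)"
    if k: "k < n" and z: "z \<in> polydisc n" for k v z
  proof -
    have "\<exists>\<delta>>0. \<forall>t. \<bar>t\<bar> < \<delta> \<longrightarrow> cmod (z k + t *\<^sub>R v) < 1"
    proof -
      define \<delta> where "\<delta> = (1 - cmod (z k)) / (cmod v + 1)"
      have zk: "cmod (z k) < 1" by (rule polydisc_coordinate[OF z k])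
      have v1: "0 < cmod v + 1" by (rule add_nonneg_pos) auto
      have "cmod (z k + t *\<^sub>R v) < 1" if t: "\<bar>t\<bar> < \<delta>" for t
      proof -
        have "cmod (z k + t *\<^sub>R v) \<le> cmod (z k) + \<bar>t\<bar> * cmod v"
          using norm_triangle_ineq[of "z k" "t *\<^sub>R v"] by simp
        also have "\<bar>t\<bar> * cmod v \<le> \<bar>t\<bar> * (cmod v + 1)" by (intro mult_left_mono) auto
        also have "\<bar>t\<bar> * (cmod v + 1) < \<delta> * (cmod v + 1)" using t v1 by (intro mult_strict_right_mono)
        also have "\<delta> * (cmod v + 1) = 1 - cmod (z k)" using v1 by (simp add: \<delta>_def)
        finally show ?thesis by simp
      qed
      moreover have "0 < \<delta>" using zk v1 by (simp add: \<delta>_def)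
      ultimately show ?thesis by blast
    qed
    then obtain \<delta> where \<delta>: "0 < \<delta>" "\<And>t. \<bar>t\<bar> < \<delta> \<Longrightarrow> cmod (z k + t *\<^sub>R v) < 1" by blast
    have "((\<lambda>t::real. A ((z(k := z k + t *\<^sub>R v)) 0) + cnj (B ((z(k := z k + t *\<^sub>R v)) 0)))
        has_vector_derivative ?d k v z) (at 0)"
    proof (cases "k = 0")
      case True
      have z0: "z 0 \<in> ball 0 1" using polydisc_coordinate[OF z n] by simp
      have line: "((\<lambda>t. z 0 + t *\<^sub>R v) has_vector_derivative v) (at 0)"
        by (auto intro!: derivative_eq_intros)
      have "(A has_field_derivative deriv A (z 0)) (at (z 0 + 0 *\<^sub>R v))"
        "(B has_field_derivative deriv B (z 0)) (at (z 0 + 0 *\<^sub>R v))"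
        using holomorphic_derivI[OF A open_ball z0] holomorphic_derivI[OF B open_ball z0] by simp_all
      from this[THEN field_vector_diff_chain_at[OF line]] True show ?thesis
        by (auto simp: o_def intro!: has_vector_derivative_add has_vector_derivative_cnj simp del: complex_cnj_mult)
    qed simp
    then show ?thesis
    proof (rule has_vector_derivative_transform_within_open)
      show "open {-\<delta><..<\<delta>}" "0 \<in> {-\<delta><..<\<delta>}" using \<delta> by auto
      fix t assume "t \<in> {-\<delta><..<\<delta>}"
      then have "z(k := z k + t *\<^sub>R v) \<in> polydisc n" using \<delta>(2) by (intro polydisc_upd z k) auto
      then show "A ((z(k := z k + t *\<^sub>R v)) 0) + cnj (B ((z(k := z k + t *\<^sub>R v)) 0)) = F (z(k := z k + t *\<^sub>R v))"
        by (rule F[symmetric])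
    qed
  qed
  show pd: "partial_deriv k v F z = ?d k v z" if "k < n" "z \<in> polydisc n" for k v z
    using D[OF that] by (rule partial_deriv_eqI)
  have coord: "continuous_on (polydisc n) (\<lambda>z. z 0 :: complex)"
    by (rule continuous_on_subset[OF continuous_on_product_coordinates]) auto
  have comp: "continuous_on (polydisc n) (\<lambda>z. H (z 0))" if "H holomorphic_on ball 0 1" for H
    by (rule continuous_on_compose2[OF holomorphic_on_imp_continuous_on[OF that] coord])
      (use polydisc_coordinate n in auto)
  show "C1_on_polydisc n F"
    unfolding C1_on_polydisc_def
  proof (intro conjI allI impI ballI)
    have "continuous_on (polydisc n) (\<lambda>z. A (z 0) + cnj (B (z 0)))"
      by (intro continuous_intros comp A B)
    then show "continuous_on (polydisc n) F" by (rule continuous_on_eq) (simp add: F)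
    fix k v assume k: "k < n"
    show "(\<lambda>t::real. F (z(k := z k + t *\<^sub>R v))) differentiable (at 0)" if "z \<in> polydisc n" for z
      by (rule differentiableI_vector[OF D[OF k that]])
    have "continuous_on (polydisc n) (\<lambda>z. ?d k v z)"
    proof (cases "k = 0")
      case True
      have "continuous_on (polydisc n) (\<lambda>z. v * deriv A (z 0) + cnj (v * deriv B (z 0)))"
        by (intro continuous_intros comp[OF holomorphic_deriv[OF A open_ball]] comp[OF holomorphic_deriv[OF B open_ball]])
      then show ?thesis using True by simp
    qed simp
    then show "continuous_on (polydisc n) (partial_deriv k v F)"
      by (rule continuous_on_eq) (simp add: pd k)
  qed
qed

text \<open>\<open>wirtinger_bar 0\<close> removes the holomorphic summand and leaves the conjugate
  of \<open>G'\<close>, which every \<open>wirtinger j\<close> annihilates.\<close>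

lemma pluriharmonic_real_part:
  assumes G: "G holomorphic_on ball 0 1" and n: "0 < n"
  shows "pluriharmonic n (\<lambda>z. G (z 0) + cnj (G (z 0)))" (is "pluriharmonic n ?f")
proof -
  have dG: "(\<lambda>w. c * deriv G w) holomorphic_on ball 0 1" for c
    by (intro holomorphic_intros holomorphic_deriv G open_ball)
  note f = C1_holomorphic_pair[OF G G n refl]
  have partial_f: "partial_deriv k v ?f z = (if k = 0 then v * deriv G (z 0) + cnj (v * deriv G (z 0)) else 0)"
    if "k < n" "z \<in> polydisc n" for k v z
    using f(2)[OF that] by simp
  have C1: "C1_on_polydisc n (partial_deriv k v ?f)" if k: "k < n" for k v
  proof (cases "k = 0")
    case True
    show ?thesis
      by (rule C1_holomorphic_pair(1)[OF dG[of v] dG[of v] n]) (use partial_f[OF k] True in simp)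
  next
    case False
    show ?thesis
      by (rule C1_holomorphic_pair(1)[of "\<lambda>_. 0" "\<lambda>_. 0", OF _ _ n]) (use partial_f[OF k] False in auto)
  qed
  have W: "wirtinger_bar k ?f z = (if k = 0 then cnj (deriv G (z 0)) else 0)"
    if "k < n" "z \<in> polydisc n" for k z
    using partial_f[OF that] by (auto simp: wirtinger_bar_def field_simps)
  have "wirtinger j (wirtinger_bar k ?f) z = 0" if j: "j < n" and k: "k < n" and z: "z \<in> polydisc n" for j k z
  proof -
    \<comment> \<open>The factor 1 or 0 treats \<open>k = 0\<close> and the other indices, where
      \<open>wirtinger_bar k\<close> gives 0, at once.\<close>
    have "partial_deriv j v (wirtinger_bar k ?f) z
        = (if j = 0 then cnj (v * deriv (\<lambda>w. (if k = 0 then 1 else 0) * deriv G w) (z 0)) else 0)" for v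
      using C1_holomorphic_pair(2)[OF _ dG[of "if k = 0 then 1 else 0"] n _ j z,
          of "\<lambda>_. 0" "wirtinger_bar k ?f"] W[OF k] by simp
    then show ?thesis by (simp add: wirtinger_def)
  qed
  then show ?thesis
    using f(1) C1 by (simp add: pluriharmonic_def C2_on_polydisc_def)
qed

text \<open>With truncated subtraction the coefficient formula is also correct for \<open>j = 0\<close>.\<close>

lemma binomial_series:
  fixes x :: complex
  assumes "cmod x < 1"
  shows "(\<lambda>i. of_nat ((i + j - 1) choose i) * x ^ i) sums (1 / (1 - x)) ^ j"
    and "summable (\<lambda>i. cmod (of_nat ((i + j - 1) choose i) * x ^ i))"
proof -
  have S: "(\<lambda>i. of_nat ((i + j - 1) choose i) * x ^ i) sums (1 / (1 - x)) ^ j \<and>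
      summable (\<lambda>i. cmod (of_nat ((i + j - 1) choose i) * x ^ i))"
    using assms
  proof (induction j)
    case 0
    have e: "of_nat ((i + 0 - 1) choose i) * x ^ i = (if i = 0 then 1 else 0)" for i
      by (cases i) auto
    show ?case unfolding e
      using sums_single[of 0 "\<lambda>_. 1 :: complex"] summable_single[of 0 "\<lambda>_. 1 :: real"]
      by (simp add: if_distrib[of cmod] cong: if_cong)
  next
    case (Suc j)
    note IH = Suc.IH[OF Suc.prems]
    have geo: "summable (\<lambda>i. cmod (x ^ i))" using Suc.prems by (simp add: norm_power summable_geometric)
    have hockey: "(\<Sum>l\<le>i. (l + j - 1) choose l) = (i + Suc j - 1) choose i" for i
    proof (cases j)
      case 0
      have "(\<Sum>l\<le>i. (l + j - 1) choose l) = (\<Sum>l\<le>i. if l = 0 then 1 else 0)"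
        using 0 by (intro sum.cong refl) (auto simp: gr0_conv_Suc)
      then show ?thesis using 0 by simp
    next
      case (Suc r)
      then show ?thesis using sum_choose_lower[of r i] by (simp add: add.commute)
    qed
    have conv: "(\<Sum>l\<le>i. (of_nat ((l + j - 1) choose l) * y ^ l) * y ^ (i - l))
        = of_nat ((i + Suc j - 1) choose i) * y ^ i" for i and y :: complex
    proof -
      have "(\<Sum>l\<le>i. (of_nat ((l + j - 1) choose l) * y ^ l) * y ^ (i - l))
          = (\<Sum>l\<le>i. of_nat ((l + j - 1) choose l) * y ^ i)"
        by (intro sum.cong refl) (simp add: mult.assoc flip: power_add)
      also have "\<dots> = of_nat (\<Sum>l\<le>i. (l + j - 1) choose l) * y ^ i"
        by (simp add: sum_distrib_right)
      finally show ?thesis unfolding hockey .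
    qed
    have "(\<lambda>i. of_nat ((i + Suc j - 1) choose i) * x ^ i) sums ((1 / (1 - x)) ^ j * (1 / (1 - x)))"
      using Cauchy_product_sums[OF conjunct2[OF IH] geo] sums_unique[OF conjunct1[OF IH]]
        sums_unique[OF geometric_sums[OF Suc.prems]]
      unfolding conv by simp
    moreover have "summable (\<lambda>i. cmod (of_nat ((i + Suc j - 1) choose i) * x ^ i))"
    proof -
      \<comment> \<open>Absolute convergence is the Cauchy product evaluated at the point
        \<open>|x|\<close>, where all terms are their own moduli.\<close>
      let ?y = "complex_of_real (cmod x)"
      have "summable (\<lambda>i. cmod (cmod (of_nat ((i + j - 1) choose i) * x ^ i)))" "summable (\<lambda>i. cmod (cmod (x ^ i)))"
        using IH geo by simp_all
      then have "summable (\<lambda>i. cmod (of_nat ((i + j - 1) choose i) * ?y ^ i))" "summable (\<lambda>i. cmod (?y ^ i))"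
        by (simp_all add: norm_mult norm_power)
      from summable_Cauchy_product[OF this] have "summable (\<lambda>i. of_nat ((i + Suc j - 1) choose i) * ?y ^ i)"
        unfolding conv .
      then have "summable (\<lambda>i. complex_of_real (real ((i + Suc j - 1) choose i) * cmod x ^ i))"
        by simp
      then show ?thesis by (simp only: summable_complex_of_real norm_mult norm_power norm_of_nat)
    qed
    ultimately show ?case by simp
  qed
  then show "(\<lambda>i. of_nat ((i + j - 1) choose i) * x ^ i) sums (1 / (1 - x)) ^ j"
    "summable (\<lambda>i. cmod (of_nat ((i + j - 1) choose i) * x ^ i))" by auto
qed

section \<open>Parseval's identity in the first coordinate\<close>

context moment_measure
begin

lemma moments_first_coordinate:
  assumes n: "0 < n" and w0: "w 0 = 1"
  shows "(\<integral>z. z 0 ^ a * cnj (z 0) ^ b \<partial>M) = (if a = b then of_real (w a) else 0)"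
    "integrable M (\<lambda>z. z 0 ^ a * cnj (z 0) ^ b)"
proof -
  define e where "e c = (\<lambda>k::nat. if k = 0 then c else 0 :: nat)" for c
  have mono: "monomial n (e c) z = z 0 ^ c" for c z
    unfolding monomial_def using n by (subst prod.remove[of _ 0]) (auto simp: e_def)
  have wt: "(\<Prod>k<n. w (e c k)) = w c" for c
    using n by (subst prod.remove[of _ 0]) (auto simp: e_def w0)
  have eq: "(\<forall>k<n. e a k = e b k) \<longleftrightarrow> a = b"
    using n by (auto simp: e_def)
  show "(\<integral>z. z 0 ^ a * cnj (z 0) ^ b \<partial>M) = (if a = b then of_real (w a) else 0)"
    using moments[of "e a" "e b"] unfolding mono wt eq by simp
  show "integrable M (\<lambda>z. z 0 ^ a * cnj (z 0) ^ b)"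
    using integrable_monomials[of "e a" "e b"] unfolding mono by simp
qed

text \<open>Nonnegative summable coefficients bound all partial sums on the closed disc by the sum
  of the coefficients, so the finite Parseval identities pass to the limit by dominated
  convergence.\<close>

lemma parseval_first_coordinate:
  assumes n: "0 < n" and w0: "w 0 = 1"
    and A: "\<And>x. cmod x \<le> 1 \<Longrightarrow> (\<lambda>i. of_real (a i) * x ^ i) sums A x"
    and B: "\<And>x. cmod x \<le> 1 \<Longrightarrow> (\<lambda>i. of_real (b i) * x ^ i) sums B x"
    and a: "summable a" "\<And>i. 0 \<le> a i" and b: "summable b" "\<And>i. 0 \<le> b i"
  shows "integrable M (\<lambda>z. A (z 0) * cnj (B (z 0)))"
    "(\<lambda>i. a i * b i * w i) sums Re (\<integral>z. A (z 0) * cnj (B (z 0)) \<partial>M)"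
    "(\<lambda>z. A (z 0)) \<in> borel_measurable M"
    "\<And>z. z \<in> space M \<Longrightarrow> cmod (A (z 0)) \<le> suminf a"
proof -
  define S where "S c K x = (\<Sum>i<K. of_real (c i) * x ^ i)" for c :: "nat \<Rightarrow> real" and K and x :: complex
  have z0: "cmod (z 0) \<le> 1" if "z \<in> space M" for z using coordinate_le[OF that n] .
  have S_le: "cmod (S c K x) \<le> suminf c" if "cmod x \<le> 1" "summable c" "\<And>i. 0 \<le> c i" for c K x
  proof -
    have "cmod (S c K x) \<le> (\<Sum>i<K. c i)"
      unfolding S_def using that
      by (intro sum_norm_le) (simp add: norm_mult norm_power mult_left_le power_le_one)
    also have "\<dots> \<le> suminf c" using that by (intro sum_le_suminf) auto
    finally show ?thesis .
  qed
  have S_meas: "(\<lambda>z. S c K (z 0)) \<in> borel_measurable M" for c K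
    unfolding S_def using coordinate[OF n] by measurable
  have limA: "(\<lambda>K. S a K (z 0)) \<longlonglongrightarrow> A (z 0)" and limB: "(\<lambda>K. S b K (z 0)) \<longlonglongrightarrow> B (z 0)"
    if "z \<in> space M" for z
    using A[OF z0[OF that]] B[OF z0[OF that]] by (simp_all add: sums_def S_def)
  show measA: "(\<lambda>z. A (z 0)) \<in> borel_measurable M"
    by (rule borel_measurable_LIMSEQ_metric[where f = "\<lambda>K z. S a K (z 0)"]) (rule S_meas, rule limA)
  have measB: "(\<lambda>z. B (z 0)) \<in> borel_measurable M"
    by (rule borel_measurable_LIMSEQ_metric[where f = "\<lambda>K z. S b K (z 0)"]) (rule S_meas, rule limB)
  have A_le: "cmod (A (z 0)) \<le> suminf a" and B_le: "cmod (B (z 0)) \<le> suminf b" if "z \<in> space M" for z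
    using S_le[OF z0[OF that] a] S_le[OF z0[OF that] b]
    by (auto intro!: Lim_bounded[OF tendsto_norm[OF limA[OF that]]] Lim_bounded[OF tendsto_norm[OF limB[OF that]]])
  then show "\<And>z. z \<in> space M \<Longrightarrow> cmod (A (z 0)) \<le> suminf a" by blast
  have pos: "0 \<le> suminf a" "0 \<le> suminf b" using a b by (auto intro: suminf_nonneg)
  show "integrable M (\<lambda>z. A (z 0) * cnj (B (z 0)))"
    using measA measB A_le B_le pos
    by (intro integrable_bounded[where B = "suminf a * suminf b"]) (auto simp: norm_mult intro!: mult_mono)
  have partial: "(\<integral>z. S a K (z 0) * cnj (S b K (z 0)) \<partial>M) = of_real (\<Sum>i<K. a i * b i * w i)" for K
  proof -
    have "(\<integral>z. S a K (z 0) * cnj (S b K (z 0)) \<partial>M)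
        = (\<integral>z. (\<Sum>i<K. \<Sum>j<K. of_real (a i * b j) * (z 0 ^ i * cnj (z 0) ^ j)) \<partial>M)"
      unfolding S_def cnj_sum sum_product
      by (intro Bochner_Integration.integral_cong sum.cong refl) (simp add: mult_ac)
    also have "\<dots> = (\<Sum>i<K. \<Sum>j<K. of_real (a i * b j) * (if i = j then of_real (w i) else 0))"
      using moments_first_coordinate[OF n w0] by simp
    also have "\<dots> = (\<Sum>i<K. \<Sum>j<K. if i = j then of_real (a i * b i * w i) else 0)"
      by (intro sum.cong refl) auto
    also have "\<dots> = of_real (\<Sum>i<K. a i * b i * w i)" by simp
    finally show ?thesis .
  qed
  have "(\<lambda>K. \<integral>z. S a K (z 0) * cnj (S b K (z 0)) \<partial>M) \<longlonglongrightarrow> (\<integral>z. A (z 0) * cnj (B (z 0)) \<partial>M)"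
  proof (rule integral_dominated_convergence[where w = "\<lambda>_. suminf a * suminf b"])
    show "AE z in M. (\<lambda>K. S a K (z 0) * cnj (S b K (z 0))) \<longlonglongrightarrow> A (z 0) * cnj (B (z 0))"
      by (intro AE_I2 tendsto_intros limA limB)
    show "AE z in M. norm (S a K (z 0) * cnj (S b K (z 0))) \<le> suminf a * suminf b" for K
      using S_le z0 a b pos by (intro AE_I2) (auto simp: norm_mult intro!: mult_mono)
  qed (use S_meas measA measB in auto)
  from tendsto_Re[OF this] show "(\<lambda>i. a i * b i * w i) sums Re (\<integral>z. A (z 0) * cnj (B (z 0)) \<partial>M)"
    unfolding partial sums_def by simp
qed

end

section \<open>Factorial estimates and the origin of \<open>L_m\<close>\<close>

text \<open>Moving the two arguments one step further apart multiplies the product by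
  \<open>(c + d + 1) / (c - d)\<close>, which is at least 1.\<close>

lemma fact_log_convex:
  "d \<le> c \<Longrightarrow> (fact c)\<^sup>2 \<le> fact (c + d) * (fact (c - d) :: real)"
proof (induction d)
  case (Suc d)
  obtain e where e: "c - d = Suc e" "c - Suc d = e" using Suc.prems by (metis Suc_diff_Suc Suc_le_lessD)
  have le: "real (Suc e) \<le> real (c + Suc d)" using e by linarith
  have "(fact c)\<^sup>2 \<le> fact (c + d) * (fact (Suc e) :: real)" using Suc e by simp
  also have "\<dots> = fact (c + d) * (real (Suc e) * fact e)" by simp
  also have "\<dots> \<le> fact (c + d) * (real (c + Suc d) * fact e)"
    using le by (intro mult_left_mono mult_right_mono) auto
  also have "\<dots> = fact (c + Suc d) * fact e" by simp
  finally show ?case unfolding e .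
qed (simp add: power2_eq_square)

text \<open>In factorials this is log-convexity about \<open>i + m - 1\<close>, the midpoint of
  \<open>i + j - 1\<close> and \<open>i + (2 m - j) - 1\<close>. The constant on the left is the
  limit of the ratio of the two sides' binomial factors as \<open>i\<close> grows, so the comparison
  is asymptotically sharp.\<close>

lemma binomial_product_ge:
  assumes j: "1 \<le> j" "j < 2 * m"
  shows "(fact (m - 1))\<^sup>2 / (fact (j - 1) * fact (2 * m - j - 1)) * real ((i + m - 1) choose i)
    \<le> real ((i + j - 1) choose i) * real ((i + (2 * m - j) - 1) choose i) * moment_weight m i"
proof -
  define l where "l = 2 * m - j"
  have l: "1 \<le> l" "j + l = 2 * m" and m: "1 \<le> m" using j by (auto simp: l_def)
  have bin: "real ((i + p - 1) choose i) = fact (i + p - 1) / (fact i * fact (p - 1))" if "1 \<le> p" for p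
  proof -
    have "i + p - 1 - i = p - 1" using that by simp
    then show ?thesis using binomial_fact[of i "i + p - 1", where ?'a = real] that by simp
  qed
  have "(fact (i + m - 1))\<^sup>2 \<le> fact (i + j - 1) * (fact (i + l - 1) :: real)"
  proof (cases "m \<le> j")
    case True
    have "i + m - 1 + (j - m) = i + j - 1" "i + m - 1 - (j - m) = i + l - 1" "j - m \<le> i + m - 1"
      using True l m by auto
    then show ?thesis using fact_log_convex[of "j - m" "i + m - 1"] by simp
  next
    case False
    have "i + m - 1 + (m - j) = i + l - 1" "i + m - 1 - (m - j) = i + j - 1" "m - j \<le> i + m - 1"
      using False l m j by auto
    then show ?thesis using fact_log_convex[of "m - j" "i + m - 1"] by (simp add: mult.commute)
  qed
  then have "(fact (i + m - 1))\<^sup>2 * (fact (m - 1) / (fact i * fact (j - 1) * fact (l - 1) * fact (i + m - 1)))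
      \<le> fact (i + j - 1) * fact (i + l - 1) * (fact (m - 1) / (fact i * fact (j - 1) * fact (l - 1) * fact (i + m - 1) :: real))"
    by (intro mult_right_mono) auto
  then show ?thesis
    unfolding l_def[symmetric] moment_weight_def bin[OF j(1)] bin[OF l(1)] bin[OF m]
    by (simp add: field_simps power2_eq_square)
qed

text \<open>This is how the closed form of \<open>L_m\<close> arises. Each summand is
  \<open>(m - 1)!^2 / (2 m - 2)!\<close> times a product of binomials from the rows
  \<open>2 m\<close> and \<open>2 m - 2\<close>, and Vandermonde's identity sums these to
  \<open>(4 m - 2) choose (2 m - 1)\<close>.\<close>

lemma L_const_power:
  assumes m: "2 \<le> m"
  shows "2 ^ m * L_const m ^ (2 * m)
    = (\<Sum>j = 1..<2 * m. real ((2 * m) choose j) * ((fact (m - 1))\<^sup>2 / (fact (j - 1) * fact (2 * m - j - 1))))"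
proof -
  let ?X = "fact (4 * m - 2) * (fact (m - 1))\<^sup>2 / (2 ^ m * (fact (2 * m - 1))\<^sup>2 * fact (2 * m - 2)) :: real"
  have X: "0 < ?X" by simp
  have "L_const m ^ (2 * m) = L_const m powr real (2 * m)"
    using X by (subst powr_realpow) (simp_all add: L_const_def)
  also have "\<dots> = ?X"
    unfolding L_const_def powr_powr using X m by simp
  finally have L: "L_const m ^ (2 * m) = ?X" .
  have "(\<Sum>j = 1..<2 * m. real ((2 * m) choose j) * ((fact (m - 1))\<^sup>2 / (fact (j - 1) * fact (2 * m - j - 1))))
      = (\<Sum>j = 1..<2 * m. (fact (m - 1))\<^sup>2 / fact (2 * m - 2) * (real ((2 * m) choose j) * real ((2 * m - 2) choose (2 * m - 1 - j))))"
  proof (intro sum.cong refl)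
    fix j assume j: "j \<in> {1..<2 * m}"
    have "2 * m - 2 - (2 * m - 1 - j) = j - 1" "2 * m - 1 - j = 2 * m - j - 1" using j by auto
    then have "real ((2 * m - 2) choose (2 * m - 1 - j)) = fact (2 * m - 2) / (fact (2 * m - j - 1) * fact (j - 1))"
      using binomial_fact[of "2 * m - 1 - j" "2 * m - 2", where ?'a = real] j by auto
    then show "real ((2 * m) choose j) * ((fact (m - 1))\<^sup>2 / (fact (j - 1) * fact (2 * m - j - 1)))
      = (fact (m - 1))\<^sup>2 / fact (2 * m - 2) * (real ((2 * m) choose j) * real ((2 * m - 2) choose (2 * m - 1 - j)))"
      by (simp add: mult_ac)
  qed
  also have "\<dots> = (fact (m - 1))\<^sup>2 / fact (2 * m - 2) * real (\<Sum>j = 1..<2 * m. ((2 * m) choose j) * ((2 * m - 2) choose (2 * m - 1 - j)))"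
    by (simp add: sum_distrib_left)
  \<comment> \<open>The added term \<open>j = 0\<close> vanishes, since its second binomial has
    lower index \<open>2 * m - 1\<close> above \<open>2 * m - 2\<close>.\<close>
  also have "(\<Sum>j = 1..<2 * m. ((2 * m) choose j) * ((2 * m - 2) choose (2 * m - 1 - j)))
      = (\<Sum>j\<le>2 * m - 1. ((2 * m) choose j) * ((2 * m - 2) choose (2 * m - 1 - j)))"
    using m by (intro sum.mono_neutral_left) (auto simp: not_less Suc_le_eq)
  also have "\<dots> = (4 * m - 2) choose (2 * m - 1)"
    using vandermonde[of "2 * m" "2 * m - 2" "2 * m - 1"] m by simp
  also have "real ((4 * m - 2) choose (2 * m - 1)) = fact (4 * m - 2) / (fact (2 * m - 1))\<^sup>2"
  proof -
    have "4 * m - 2 - (2 * m - 1) = 2 * m - 1" using m by simp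
    then show ?thesis
      using binomial_fact[of "2 * m - 1" "4 * m - 2", where ?'a = real] m by (simp add: power2_eq_square)
  qed
  finally show ?thesis unfolding L by (simp add: mult_ac)
qed

lemma power_series_resolvent:
  assumes r: "0 < r" "r < 1" and x: "cmod x \<le> 1"
  shows "(\<lambda>i. of_real (real ((i + j - 1) choose i) * r ^ i) * x ^ i) sums (1 / (1 - of_real r * x)) ^ j"
proof -
  have "cmod (of_real r * x) < 1"
  proof -
    have "r * cmod x \<le> r * 1" using r x by (intro mult_left_mono) auto
    then have "r * cmod x < 1" using r by linarith
    then show ?thesis using r by (simp add: norm_mult)
  qed
  from binomial_series(1)[OF this, of j] show ?thesis
    by (simp add: power_mult_distrib mult_ac)
qed

lemma real_binomial_series:
  fixes r :: real
  assumes r: "0 < r" "r < 1"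
  shows "(\<lambda>i. real ((i + j - 1) choose i) * r ^ i) sums (1 / (1 - r)) ^ j"
proof -
  have "(\<lambda>i. complex_of_real (real ((i + j - 1) choose i) * r ^ i)) sums of_real ((1 / (1 - r)) ^ j)"
    using power_series_resolvent[OF r, of 1 j] by simp
  then show ?thesis by (simp only: sums_of_real_iff)
qed

lemma parseval_resolvent:
  assumes M: "moment_measure M n w" and n: "0 < n" and w0: "w 0 = 1" and r: "0 < r" "r < 1"
  shows "integrable M (\<lambda>z. (1 / (1 - of_real r * z 0)) ^ j * cnj ((1 / (1 - of_real r * z 0)) ^ l))"
    "(\<lambda>i. (real ((i + j - 1) choose i) * r ^ i) * (real ((i + l - 1) choose i) * r ^ i) * w i)
      sums Re (\<integral>z. (1 / (1 - of_real r * z 0)) ^ j * cnj ((1 / (1 - of_real r * z 0)) ^ l) \<partial>M)"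
proof -
  interpret moment_measure M n w by fact
  have s: "summable (\<lambda>i. real ((i + p - 1) choose i) * r ^ i)" for p
    using real_binomial_series[OF r] by (rule sums_summable)
  have nn: "0 \<le> real ((i + p - 1) choose i) * r ^ i" for i p using r by simp
  note P = parseval_first_coordinate[where A = "\<lambda>x. (1 / (1 - of_real r * x)) ^ j" and B = "\<lambda>x. (1 / (1 - of_real r * x)) ^ l",
      OF n w0 power_series_resolvent[OF r] power_series_resolvent[OF r] s nn s nn]
  show "integrable M (\<lambda>z. (1 / (1 - of_real r * z 0)) ^ j * cnj ((1 / (1 - of_real r * z 0)) ^ l))"
    by (rule P(1))
  show "(\<lambda>i. (real ((i + j - 1) choose i) * r ^ i) * (real ((i + l - 1) choose i) * r ^ i) * w i)
      sums Re (\<integral>z. (1 / (1 - of_real r * z 0)) ^ j * cnj ((1 / (1 - of_real r * z 0)) ^ l) \<partial>M)"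
    by (rule P(2))
qed

text \<open>Twice the real part of the Szego kernel at the point \<open>r\<close> of the first disc.
  For this kernel the contraction into the Bergman space is an equality, both sides being
  \<open>(1 - r^2) ^ (-m)\<close>.\<close>

definition resolvent_pair :: "real \<Rightarrow> (nat \<Rightarrow> complex) \<Rightarrow> complex" where
  "resolvent_pair r z = 1 / (1 - of_real r * z 0) + cnj (1 / (1 - of_real r * z 0))"

lemma resolvent_pair_pluriharmonic:
  assumes r: "0 < r" "r < 1" and n: "0 < n"
  shows "pluriharmonic n (resolvent_pair r)"
proof -
  have "1 - of_real r * w \<noteq> 0" if "w \<in> ball 0 1" for w :: complex
  proof
    assume "1 - of_real r * w = 0"
    then have "cmod (of_real r * w) = 1" by (simp add: algebra_simps)
    moreover have "cmod (of_real r * w) \<le> r"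
      using that r mult_left_le[of "cmod w" r] by (simp add: norm_mult)
    ultimately show False using r by simp
  qed
  then have "(\<lambda>w. 1 / (1 - of_real r * w)) holomorphic_on ball 0 1"
    by (intro holomorphic_intros) auto
  from pluriharmonic_real_part[OF this n] show ?thesis
    unfolding resolvent_pair_def[abs_def] .
qed

lemma resolvent_pair_hardy_norm:
  assumes r: "0 < r" "r < 1" and n: "0 < n"
  shows "hardy_norm n 2 (resolvent_pair r) \<le> ennreal (sqrt (2 / (1 - r\<^sup>2) + 2))"
  unfolding hardy_norm_def
proof (rule SUP_least)
  fix \<rho> :: real assume "\<rho> \<in> {0<..<1}"
  then have \<rho>: "0 < \<rho>" "\<rho> < 1" by auto
  \<comment> \<open>Dilating the argument only changes the parameter \<open>r\<close> into
    \<open>s\<close>, and the resulting norm increases with it.\<close>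
  define s where "s = r * \<rho>"
  have s: "0 < s" "s < 1" "s \<le> r" using r \<rho> mult_strict_mono[of r 1 \<rho> 1] mult_left_le[of \<rho> r] by (auto simp: s_def)
  define A where "A z = 1 / (1 - of_real s * z 0)" for z :: "nat \<Rightarrow> complex"
  note T = moment_measure_torus[of n]
  note P1 = parseval_resolvent[OF T n refl s(1,2), of 1 1]
  \<comment> \<open>With exponents 2 and 0 the identity gives the mean of \<open>A ^ 2\<close>: the
    second series is the constant 1, so only the term \<open>i = 0\<close> survives.\<close>
  note P2 = parseval_resolvent[OF T n refl s(1,2), of 2 0]
  have eq: "cmod (resolvent_pair r (\<lambda>k\<in>{..<n}. \<rho> *\<^sub>R z k)) ^ 2
      = 2 * Re (A z * cnj (A z)) + 2 * Re (A z ^ 2)" for z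
  proof -
    have "resolvent_pair r (\<lambda>k\<in>{..<n}. \<rho> *\<^sub>R z k) = A z + cnj (A z)"
      using n by (simp add: resolvent_pair_def A_def s_def scaleR_conv_of_real mult.assoc)
    moreover have "cmod (A z + cnj (A z)) ^ 2 = 2 * Re (A z * cnj (A z)) + 2 * Re (A z ^ 2)"
      by (simp add: cmod_power2) (simp add: power2_eq_square algebra_simps)
    ultimately show ?thesis by simp
  qed
  have i1: "integrable (torus_measure n) (\<lambda>z. A z * cnj (A z))" and i2: "integrable (torus_measure n) (\<lambda>z. A z ^ 2)"
    using P1(1) P2(1) by (simp_all add: A_def)
  have "Re (\<integral>z. A z * cnj (A z) \<partial>torus_measure n) = 1 / (1 - s\<^sup>2)"
  proof (rule sums_unique2)
    show "(\<lambda>i. (s\<^sup>2) ^ i) sums Re (\<integral>z. A z * cnj (A z) \<partial>torus_measure n)"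
      using P1(2) by (simp add: A_def power2_eq_square power_mult_distrib)
    show "(\<lambda>i. (s\<^sup>2) ^ i) sums (1 / (1 - s\<^sup>2))"
      using s by (intro geometric_sums) (simp add: abs_square_less_1)
  qed
  moreover have "Re (\<integral>z. A z ^ 2 \<partial>torus_measure n) = 1"
  proof (rule sums_unique2)
    have "real ((i + 2 - 1) choose i) * s ^ i * (real ((i + 0 - 1) choose i) * s ^ i) * 1 = (if i = 0 then 1 else 0)" for i
      by (cases i) auto
    then show "(\<lambda>i. if i = 0 then 1 else 0 :: real) sums Re (\<integral>z. A z ^ 2 \<partial>torus_measure n)"
      using P2(2) by (simp add: A_def)
    show "(\<lambda>i. if i = 0 then 1 else 0 :: real) sums 1" using sums_single[of 0 "\<lambda>_. 1 :: real"] by simp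
  qed
  ultimately have I: "(\<integral>z. 2 * Re (A z * cnj (A z)) + 2 * Re (A z ^ 2) \<partial>torus_measure n) = 2 / (1 - s\<^sup>2) + 2"
    using i1 i2 by (simp del: times_complex.sel)
  have int: "integrable (torus_measure n) (\<lambda>z. 2 * Re (A z * cnj (A z)) + 2 * Re (A z ^ 2))"
    using i1 i2 by (intro Bochner_Integration.integrable_add integrable_mult_right integrable_Re)
  have "2 / (1 - s\<^sup>2) \<le> 2 / (1 - r\<^sup>2)"
    using s r by (intro divide_left_mono) (auto simp: abs_square_less_1 power_mono intro!: mult_pos_pos)
  then have le: "2 / (1 - s\<^sup>2) + 2 \<le> 2 / (1 - r\<^sup>2) + 2" by simp
  have pos: "0 \<le> 2 / (1 - s\<^sup>2) + 2" using s by (simp add: abs_square_le_1)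
  have "Lp_norm (torus_measure n) (real 2) (\<lambda>\<omega>. resolvent_pair r (\<lambda>k\<in>{..<n}. \<rho> *\<^sub>R \<omega> k))
      = ennreal ((2 / (1 - s\<^sup>2) + 2) powr (1 / real 2))"
    by (subst Lp_norm_integrable) (simp_all only: eq int I pos2)
  also have "\<dots> \<le> ennreal (sqrt (2 / (1 - r\<^sup>2) + 2))"
    using le pos by (intro ennreal_leI) (simp add: powr_half_sqrt)
  finally show "Lp_norm (torus_measure n) 2 (\<lambda>\<omega>. resolvent_pair r (\<lambda>k\<in>{..<n}. \<rho> *\<^sub>R \<omega> k))
      \<le> ennreal (sqrt (2 / (1 - r\<^sup>2) + 2))" by simp
qed

lemma resolvent_pair_bergman:
  assumes m: "2 \<le> m" and r: "0 < r" "r < 1" and n: "0 < n"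
  shows "integrable (bergman_measure n m) (\<lambda>z. cmod (resolvent_pair r z) ^ (2 * m))"
    "2 ^ m * L_const m ^ (2 * m) * (1 / (1 - r\<^sup>2)) ^ m
      \<le> (\<integral>z. cmod (resolvent_pair r z) ^ (2 * m) \<partial>bergman_measure n m)"
proof -
  let ?M = "bergman_measure n m"
  define A where "A z = 1 / (1 - of_real r * z 0)" for z :: "nat \<Rightarrow> complex"
  have w0: "moment_weight m 0 = 1" by (simp add: moment_weight_def)
  note P = parseval_resolvent[OF moment_measure_bergman[OF m, of n] n w0 r, folded A_def]
  define J where "J j = Re (\<integral>z. A z ^ j * cnj (A z ^ (2 * m - j)) \<partial>?M)" for j
  have eq: "cmod (resolvent_pair r z) ^ (2 * m)
      = (\<Sum>j\<le>2 * m. real ((2 * m) choose j) * Re (A z ^ j * cnj (A z ^ (2 * m - j))))" for z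
  proof -
    have "resolvent_pair r z = of_real (2 * Re (A z))"
      by (simp add: resolvent_pair_def A_def[symmetric] complex_add_cnj)
    then have "of_real (cmod (resolvent_pair r z) ^ (2 * m)) = resolvent_pair r z ^ (2 * m)"
      by (simp add: power_mult flip: of_real_power) (simp add: power_mult_distrib)
    also have "\<dots> = (A z + cnj (A z)) ^ (2 * m)"
      by (simp add: resolvent_pair_def A_def)
    also have "\<dots> = (\<Sum>j\<le>2 * m. of_nat ((2 * m) choose j) * (A z ^ j * cnj (A z ^ (2 * m - j))))"
      by (simp add: binomial_ring mult.assoc)
    finally have "Re (of_real (cmod (resolvent_pair r z) ^ (2 * m)))
        = Re (\<Sum>j\<le>2 * m. of_real (real ((2 * m) choose j)) * (A z ^ j * cnj (A z ^ (2 * m - j))))" by simp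
    moreover have "Re (of_real c * x) = c * Re x" for c x by simp
    ultimately show ?thesis by (simp only: Re_complex_of_real Re_sum)
  qed
  show "integrable ?M (\<lambda>z. cmod (resolvent_pair r z) ^ (2 * m))"
    unfolding eq using P(1)
    by (intro Bochner_Integration.integrable_sum integrable_mult_right integrable_Re)
  have I: "(\<integral>z. cmod (resolvent_pair r z) ^ (2 * m) \<partial>?M) = (\<Sum>j\<le>2 * m. real ((2 * m) choose j) * J j)"
    unfolding eq J_def using P(1)
    by (simp add: Bochner_Integration.integral_sum del: times_complex.sel complex_cnj_power)
  have w_nonneg: "0 \<le> moment_weight m i" for i by (simp add: moment_weight_def)
  have J_nonneg: "0 \<le> J j" for j
  proof -
    have nonneg: "0 \<le> (real ((i + j - 1) choose i) * r ^ i) * (real ((i + (2 * m - j) - 1) choose i) * r ^ i) * moment_weight m i" for i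
      using r w_nonneg by (intro mult_nonneg_nonneg) auto
    show ?thesis unfolding J_def by (rule sums_le[OF nonneg sums_zero P(2)])
  qed
  have r2: "0 < r\<^sup>2" "r\<^sup>2 < 1" using r by (auto simp: abs_square_less_1)
  let ?q = "\<lambda>j. (fact (m - 1))\<^sup>2 / (fact (j - 1) * fact (2 * m - j - 1)) :: real"
  have J_ge: "?q j * (1 / (1 - r\<^sup>2)) ^ m \<le> J j" if j: "1 \<le> j" "j < 2 * m" for j
  proof (rule sums_le)
    show "(\<lambda>i. ?q j * (real ((i + m - 1) choose i) * (r\<^sup>2) ^ i)) sums (?q j * (1 / (1 - r\<^sup>2)) ^ m)"
      by (intro sums_mult real_binomial_series r2)
    show "(\<lambda>i. (real ((i + j - 1) choose i) * r ^ i) * (real ((i + (2 * m - j) - 1) choose i) * r ^ i) * moment_weight m i) sums J j"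
      unfolding J_def by (rule P(2))
    show "?q j * (real ((i + m - 1) choose i) * (r\<^sup>2) ^ i)
        \<le> (real ((i + j - 1) choose i) * r ^ i) * (real ((i + (2 * m - j) - 1) choose i) * r ^ i) * moment_weight m i" for i
    proof -
      have "?q j * real ((i + m - 1) choose i) * (r\<^sup>2) ^ i
          \<le> real ((i + j - 1) choose i) * real ((i + (2 * m - j) - 1) choose i) * moment_weight m i * (r\<^sup>2) ^ i"
        by (intro mult_right_mono binomial_product_ge j) simp
      moreover have "(r\<^sup>2) ^ i = r ^ i * r ^ i" by (simp add: power2_eq_square power_mult_distrib)
      ultimately show ?thesis by (simp only: mult_ac)
    qed
  qed
  have "2 ^ m * L_const m ^ (2 * m) * (1 / (1 - r\<^sup>2)) ^ m
      = (\<Sum>j = 1..<2 * m. real ((2 * m) choose j) * (?q j * (1 / (1 - r\<^sup>2)) ^ m))"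
    unfolding L_const_power[OF m] sum_distrib_right by (simp only: mult.assoc)
  also have "\<dots> \<le> (\<Sum>j = 1..<2 * m. real ((2 * m) choose j) * J j)"
    using J_ge by (intro sum_mono mult_left_mono) auto
  \<comment> \<open>Dropping the outer terms \<open>j = 0\<close> and \<open>j = 2 * m\<close> costs
    little: their series reduce to the term \<open>i = 0\<close> and do not grow as \<open>r\<close>
    tends to 1.\<close>
  also have "\<dots> \<le> (\<Sum>j\<le>2 * m. real ((2 * m) choose j) * J j)"
    using J_nonneg by (intro sum_mono2) auto
  finally show "2 ^ m * L_const m ^ (2 * m) * (1 / (1 - r\<^sup>2)) ^ m
      \<le> (\<integral>z. cmod (resolvent_pair r z) ^ (2 * m) \<partial>?M)" unfolding I .
qed

text \<open>Taking \<open>m\<close>-th roots in the estimate for the test function and multiplying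
  by \<open>(1 - r^2) / 2\<close> gives \<open>L_m^2 <= C^2 (2 - r^2)\<close>. The summand 2 in the
  squared Hardy norm is negligible against \<open>2 / (1 - r^2)\<close>, so \<open>r\<close> tending
  to 1 yields the claim.\<close>

lemma admissible_const_ge:
  assumes m: "2 \<le> m" and n: "0 < n" and C: "0 \<le> C"
    and adm: "\<And>f. f \<in> hardy_space n 2 \<Longrightarrow> bergman_norm n m (real m * 2) f \<le> ennreal C * hardy_norm n 2 f"
  shows "L_const m \<le> C"
proof -
  have *: "(L_const m)\<^sup>2 \<le> C\<^sup>2 * (2 - r\<^sup>2)" if r: "0 < r" "r < 1" for r
  proof -
    define Y where "Y = 2 / (1 - r\<^sup>2) + 2"
    have r2: "0 < 1 - r\<^sup>2" using r by (simp add: abs_square_less_1)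
    have Y: "0 \<le> Y" using r2 by (simp add: Y_def)
    note h = resolvent_pair_hardy_norm[OF r n, folded Y_def]
    note b = resolvent_pair_bergman[OF m r n]
    let ?I = "\<integral>z. cmod (resolvent_pair r z) ^ (2 * m) \<partial>bergman_measure n m"
    have "hardy_norm n 2 (resolvent_pair r) < \<infinity>"
      using h by (rule le_less_trans) simp
    then have f: "resolvent_pair r \<in> hardy_space n 2"
      using resolvent_pair_pluriharmonic[OF r n] by (simp add: hardy_space_def)
    have "ennreal (?I powr (1 / real (2 * m))) = bergman_norm n m (real m * 2) (resolvent_pair r)"
      using m Lp_norm_integrable[OF _ b(1)] by (simp add: bergman_norm_def mult.commute)
    also have "\<dots> \<le> ennreal C * hardy_norm n 2 (resolvent_pair r)" by (rule adm[OF f])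
    also have "\<dots> \<le> ennreal C * ennreal (sqrt Y)" by (intro mult_left_mono h) simp
    also have "\<dots> = ennreal (C * sqrt Y)" using C Y by (simp add: ennreal_mult)
    finally have "?I powr (1 / real (2 * m)) \<le> C * sqrt Y"
      using C Y by (subst (asm) ennreal_le_iff) auto
    then have "(?I powr (1 / real (2 * m))) ^ (2 * m) \<le> (C * sqrt Y) ^ (2 * m)"
      by (intro power_mono) auto
    also have "(?I powr (1 / real (2 * m))) ^ (2 * m) = ?I"
    proof (cases "?I = 0")
      case False
      then have I: "0 < ?I" by (simp add: less_le)
      then have "(?I powr (1 / real (2 * m))) ^ (2 * m) = (?I powr (1 / real (2 * m))) powr real (2 * m)"
        by (subst powr_realpow) auto
      also have "\<dots> = ?I" unfolding powr_powr using m I by simp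
      finally show ?thesis .
    qed (use m in \<open>simp add: power_0_left\<close>)
    finally have "?I \<le> (C * sqrt Y) ^ (2 * m)" .
    also have "\<dots> = (C\<^sup>2 * Y) ^ m" using Y by (simp add: power_mult power_mult_distrib)
    finally have "2 ^ m * L_const m ^ (2 * m) * (1 / (1 - r\<^sup>2)) ^ m \<le> (C\<^sup>2 * Y) ^ m"
      using b(2) by linarith
    also have "2 ^ m * L_const m ^ (2 * m) * (1 / (1 - r\<^sup>2)) ^ m = (2 * (L_const m)\<^sup>2 / (1 - r\<^sup>2)) ^ m"
      by (simp add: power_mult power_mult_distrib power_divide)
    finally have "2 * (L_const m)\<^sup>2 / (1 - r\<^sup>2) \<le> C\<^sup>2 * Y"
      using m Y r2 by (subst (asm) power_mono_iff) auto
    then have "2 * (L_const m)\<^sup>2 \<le> C\<^sup>2 * Y * (1 - r\<^sup>2)" using r2 by (simp add: field_simps)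
    also have "\<dots> = 2 * (C\<^sup>2 * (2 - r\<^sup>2))" using r2 by (simp add: Y_def field_simps)
    finally show ?thesis by simp
  qed
  have "(L_const m)\<^sup>2 \<le> C\<^sup>2 * (2 - 1\<^sup>2)"
  proof (rule tendsto_lowerbound)
    show "((\<lambda>r. C\<^sup>2 * (2 - r\<^sup>2)) \<longlongrightarrow> C\<^sup>2 * (2 - 1\<^sup>2)) (at_left 1)" by (intro tendsto_intros)
    have "\<forall>\<^sub>F r in at_left (1::real). r \<in> {0<..<1}" by (rule eventually_at_leftI[of 0]) auto
    then show "\<forall>\<^sub>F r in at_left 1. (L_const m)\<^sup>2 \<le> C\<^sup>2 * (2 - r\<^sup>2)"
      by eventually_elim (use * in auto)
  qed simp
  then show ?thesis using C by (simp add: power2_le_iff_abs_le)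
qed

lemma best_const_ge:
  assumes "2 \<le> m" "1 \<le> n"
  shows "ereal (L_const m) \<le> best_const 2 m n"
  unfolding best_const_def using admissible_const_ge[of m n] assms
  by (intro Inf_greatest) auto

section \<open>Asymptotics\<close>

text \<open>The Wallis ratio. In these terms \<open>L_m ^ (2 m)\<close> is \<open>2 ^ m\<close>
  times the quotient of the ratios at \<open>2 m - 1\<close> and \<open>m - 1\<close>.\<close>

definition central_ratio :: "nat \<Rightarrow> real" where
  "central_ratio k = real ((2 * k) choose k) / 4 ^ k"

lemma central_ratio_pos: "0 < central_ratio k"
  by (simp add: central_ratio_def)

lemma central_ratio_nonzero [simp]: "central_ratio k \<noteq> 0"
  using central_ratio_pos[of k] by simp

lemma central_ratio_Suc: "central_ratio (Suc k) = central_ratio k * ((2 * real k + 1) / (2 * real k + 2))"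
proof -
  have c: "real ((2 * j) choose j) = fact (2 * j) / (fact j)\<^sup>2" for j
  proof -
    have "2 * j - j = j" by simp
    then show ?thesis using binomial_fact[of j "2 * j", where ?'a = real] by (simp add: power2_eq_square)
  qed
  define K where "K = real k + 1"
  have K: "0 < K" "2 * real k + 2 = 2 * K" by (auto simp: K_def)
  have f: "fact (2 * Suc k) = 2 * K * ((2 * real k + 1) * fact (2 * k))" "fact (Suc k) = K * fact k"
    by (simp_all add: K_def algebra_simps)
  show ?thesis
    unfolding central_ratio_def c K(2) f using K(1) by (simp add: divide_simps power2_eq_square)
qed

text \<open>Wallis without the value of the limit: \<open>k c_k^2\<close> increases, and
  \<open>(2 k + 1) c_k^2\<close> decreases from 1 and dominates it. Positivity follows from the term
  \<open>k = 1\<close>; the constant itself cancels in the quotient below.\<close>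

lemma central_ratio_limit:
  obtains u where "0 < u" "(\<lambda>k. real k * (central_ratio k)\<^sup>2) \<longlonglongrightarrow> u"
proof -
  let ?u = "\<lambda>k. real k * (central_ratio k)\<^sup>2"
  let ?v = "\<lambda>k. (2 * real k + 1) * (central_ratio k)\<^sup>2"
  have u_mono: "?u k \<le> ?u (Suc k)" for k
  proof -
    have "real k * (2 * real k + 2)\<^sup>2 \<le> (real k + 1) * (2 * real k + 1)\<^sup>2"
      by (simp add: power2_eq_square algebra_simps)
    then have "real k \<le> (real k + 1) * ((2 * real k + 1) / (2 * real k + 2))\<^sup>2"
      by (simp add: power_divide field_simps)
    from mult_right_mono[OF this zero_le_power2[of "central_ratio k"]]
    show ?thesis unfolding central_ratio_Suc power_mult_distrib of_nat_Suc by (simp only: ac_simps)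
  qed
  have v_mono: "?v (Suc k) \<le> ?v k" for k
  proof -
    have "(2 * real k + 3) * (2 * real k + 1)\<^sup>2 \<le> (2 * real k + 1) * (2 * real k + 2)\<^sup>2"
      by (simp add: power2_eq_square algebra_simps)
    then have "(2 * real (Suc k) + 1) * ((2 * real k + 1) / (2 * real k + 2))\<^sup>2 \<le> 2 * real k + 1"
      by (simp add: power_divide field_simps)
    from mult_right_mono[OF this zero_le_power2[of "central_ratio k"]]
    show ?thesis unfolding central_ratio_Suc power_mult_distrib of_nat_Suc by (simp only: ac_simps)
  qed
  have v_le: "?v k \<le> 1" for k
  proof (induction k)
    case (Suc k)
    then show ?case using v_mono[of k] by linarith
  qed (simp add: central_ratio_def)
  have "?u k \<le> ?v k" for k by (intro mult_right_mono) auto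
  then have u_le: "?u k \<le> 1" for k using v_le[of k] by (rule order_trans)
  have "incseq ?u" by (intro incseq_SucI u_mono)
  moreover have "\<forall>k. ?u k \<le> 1" using u_le by blast
  ultimately obtain u where u: "?u \<longlonglongrightarrow> u" "\<forall>k. ?u k \<le> u" by (rule incseq_convergent)
  have "0 < ?u 1" using central_ratio_pos[of 1] by simp
  then have "0 < u" using spec[OF u(2), of 1] by linarith
  then show ?thesis using u(1) that by blast
qed

text \<open>The quantities \<open>k c_k^2\<close> at \<open>2 m - 1\<close> and \<open>m - 1\<close>
  have the same positive limit and cancel, leaving the index quotient
  \<open>(m - 1) / (2 m - 1)\<close>, which tends to 1/2.\<close>

lemma central_ratio_quotient_limit:
  "(\<lambda>m. central_ratio (2 * m - 1) / central_ratio (m - 1)) \<longlonglongrightarrow> sqrt (1 / 2)"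
proof -
  obtain u where u: "0 < u" "(\<lambda>k. real k * (central_ratio k)\<^sup>2) \<longlonglongrightarrow> u"
    using central_ratio_limit by blast
  let ?U = "\<lambda>k. real k * (central_ratio k)\<^sup>2"
  have sub: "filterlim (\<lambda>m::nat. 2 * m - 1) sequentially sequentially" "filterlim (\<lambda>m::nat. m - 1) sequentially sequentially"
    by real_asymp+
  have frac: "(\<lambda>m. (real m - 1) / (2 * real m - 1)) \<longlonglongrightarrow> 1 / 2" by real_asymp
  have "(\<lambda>m. ?U (2 * m - 1) / ?U (m - 1) * ((real m - 1) / (2 * real m - 1))) \<longlonglongrightarrow> u / u * (1 / 2)"
    by (rule tendsto_mult[OF tendsto_divide[OF filterlim_compose[OF u(2) sub(1)]
            filterlim_compose[OF u(2) sub(2)]] frac])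
      (use u in simp)
  then have "(\<lambda>m. ?U (2 * m - 1) / ?U (m - 1) * ((real m - 1) / (2 * real m - 1))) \<longlonglongrightarrow> 1 / 2"
    using u by simp
  from tendsto_real_sqrt[OF this] show ?thesis
  proof (rule Lim_transform_eventually)
    show "\<forall>\<^sub>F m in sequentially. sqrt (?U (2 * m - 1) / ?U (m - 1) * ((real m - 1) / (2 * real m - 1)))
        = central_ratio (2 * m - 1) / central_ratio (m - 1)"
      using eventually_ge_at_top[of 2]
    proof eventually_elim
      case (elim m)
      have "?U (2 * m - 1) / ?U (m - 1) * ((real m - 1) / (2 * real m - 1))
          = (central_ratio (2 * m - 1) / central_ratio (m - 1))\<^sup>2"
      proof -
        have "q * a\<^sup>2 / (p * b\<^sup>2) * (p / q) = (a / b)\<^sup>2" if "p \<noteq> 0" "q \<noteq> 0" for p q a b :: real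
          using that by (simp add: power_divide)
        moreover have "real (2 * m - 1) = 2 * real m - 1" "real (m - 1) = real m - 1"
          "real m - 1 \<noteq> 0" "2 * real m - 1 \<noteq> 0"
          using elim by (auto simp: of_nat_diff)
        ultimately show ?thesis by (simp add: power_divide)
      qed
      then show ?case using central_ratio_pos[of "m - 1"] central_ratio_pos[of "2 * m - 1"] by simp
    qed
  qed
qed

text \<open>The powers of 4 from the two central binomials and the \<open>2 ^ m\<close> of the
  definition combine to \<open>2 ^ m\<close>, whose \<open>2 m\<close>-th root is the factor
  \<open>sqrt 2\<close>.\<close>

lemma L_const_eq:
  assumes m: "1 \<le> m"
  shows "L_const m / sqrt 2 = exp (ln (central_ratio (2 * m - 1) / central_ratio (m - 1)) / (2 * real m))"
proof -
  let ?R = "central_ratio (2 * m - 1) / central_ratio (m - 1)"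
  have R: "0 < ?R" using central_ratio_pos by simp
  have c: "fact (2 * j) / (fact j)\<^sup>2 = 4 ^ j * central_ratio j" for j
  proof -
    have "2 * j - j = j" by simp
    then show ?thesis
      using binomial_fact[of j "2 * j", where ?'a = real] by (simp add: power2_eq_square central_ratio_def)
  qed
  have e: "2 * (2 * m - 1) = 4 * m - 2" "2 * (m - 1) = 2 * m - 2" by simp_all
  have "fact (4 * m - 2) * (fact (m - 1))\<^sup>2 / (2 ^ m * (fact (2 * m - 1))\<^sup>2 * fact (2 * m - 2))
      = (fact (4 * m - 2) / (fact (2 * m - 1))\<^sup>2) / (fact (2 * m - 2) / (fact (m - 1))\<^sup>2) / (2 ^ m :: real)"
    by simp
  also have "\<dots> = (4 ^ (2 * m - 1) * central_ratio (2 * m - 1)) / (4 ^ (m - 1) * central_ratio (m - 1)) / 2 ^ m"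
    unfolding c[of "2 * m - 1", unfolded e] c[of "m - 1", unfolded e] ..
  also have "\<dots> = (4 ^ (2 * m - 1) / 4 ^ (m - 1) / 2 ^ m) * ?R" by simp
  also have "(4 ^ (2 * m - 1) / 4 ^ (m - 1) / 2 ^ m :: real) = 2 ^ m"
  proof -
    have "2 * m - 1 = (m - 1) + m" using m by simp
    then have "(4 :: real) ^ (2 * m - 1) = 4 ^ (m - 1) * 4 ^ m" by (simp only: power_add)
    moreover have "(4 :: real) ^ m = 2 ^ m * 2 ^ m" by (simp flip: power_mult_distrib)
    ultimately show ?thesis by simp
  qed
  finally have "L_const m = (2 ^ m * ?R) powr (1 / (2 * real m))" by (simp add: L_const_def)
  also have "\<dots> = (2 powr real m) powr (1 / (2 * real m)) * ?R powr (1 / (2 * real m))"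
    using R by (subst powr_mult) (simp_all add: powr_realpow)
  also have "(2 powr real m) powr (1 / (2 * real m)) = sqrt 2"
    using m by (simp add: powr_powr powr_half_sqrt)
  also have "?R powr (1 / (2 * real m)) = exp (ln ?R / (2 * real m))"
    using R by (simp add: powr_def)
  finally show ?thesis by simp
qed

text \<open>The exponent \<open>x m\<close> in \<open>L_const_eq\<close> satisfies
  \<open>m x m -> ln (sqrt (1 / 2)) / 2\<close>, which is the coefficient of the expansion.\<close>

lemma L_const_first_order: "(\<lambda>m. real m * (L_const m / sqrt 2 - 1)) \<longlonglongrightarrow> - ln 2 / 4"
proof -
  define x where "x m = ln (central_ratio (2 * m - 1) / central_ratio (m - 1)) / (2 * real m)" for m
  have mx: "(\<lambda>m. real m * x m) \<longlonglongrightarrow> - ln 2 / 4"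
  proof -
    have "(\<lambda>m. ln (central_ratio (2 * m - 1) / central_ratio (m - 1)) / 2) \<longlonglongrightarrow> ln (sqrt (1 / 2)) / 2"
      by (intro tendsto_intros central_ratio_quotient_limit) auto
    moreover have "ln (sqrt (1 / 2)) / 2 = - ln 2 / (4 :: real)"
      by (simp add: ln_sqrt ln_div)
    moreover have "\<forall>\<^sub>F m in sequentially. ln (central_ratio (2 * m - 1) / central_ratio (m - 1)) / 2 = real m * x m"
      using eventually_gt_at_top[of 0] by eventually_elim (simp add: x_def)
    ultimately show ?thesis by (simp add: Lim_transform_eventually)
  qed
  have "(\<lambda>m. (real m * x m) * (1 / real m)) \<longlonglongrightarrow> - ln 2 / 4 * 0"
    by (intro tendsto_mult mx lim_1_over_n)
  then have "(\<lambda>m. (real m * x m) * (1 / real m)) \<longlonglongrightarrow> 0" by simp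
  then have x0: "x \<longlonglongrightarrow> 0"
  proof (rule Lim_transform_eventually)
    show "\<forall>\<^sub>F m in sequentially. (real m * x m) * (1 / real m) = x m"
      using eventually_gt_at_top[of 0] by eventually_elim simp
  qed
  have "(\<lambda>m. real m * (exp (x m) - 1)) \<longlonglongrightarrow> - ln 2 / 4"
  \<comment> \<open>Uses \<open>x <= exp x - 1 <= x / (1 - x)\<close> for \<open>x < 1\<close>; the
    upper half is the lower half at \<open>- x\<close>.\<close>
  proof (rule tendsto_sandwich[OF _ _ mx])
    have "(\<lambda>m. real m * x m / (1 - x m)) \<longlonglongrightarrow> (- ln 2 / 4) / (1 - 0)"
      by (intro tendsto_intros mx x0) simp
    then show "(\<lambda>m. real m * x m / (1 - x m)) \<longlonglongrightarrow> - ln 2 / 4" by simp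
    show "\<forall>\<^sub>F m in sequentially. real m * x m \<le> real m * (exp (x m) - 1)"
      using exp_ge_add_one_self by (intro always_eventually allI mult_left_mono) (auto simp: algebra_simps)
    have "\<forall>\<^sub>F m in sequentially. x m < 1" using order_tendstoD(2)[OF x0, of 1] by simp
    then show "\<forall>\<^sub>F m in sequentially. real m * (exp (x m) - 1) \<le> real m * x m / (1 - x m)"
    proof eventually_elim
      case (elim m)
      have "1 - x m \<le> exp (- x m)" using exp_ge_add_one_self[of "- x m"] by simp
      then have "exp (x m) * (1 - x m) \<le> exp (x m) * exp (- x m)" by (intro mult_left_mono) auto
      then have "exp (x m) * (1 - x m) \<le> 1" by (simp flip: exp_add)
      then have "(exp (x m) - 1) * (1 - x m) \<le> x m" by (simp add: algebra_simps)
      then have "exp (x m) - 1 \<le> x m / (1 - x m)" using elim by (simp add: pos_le_divide_eq)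
      from mult_left_mono[OF this, of "real m"] show ?case by simp
    qed
  qed
  moreover have "\<forall>\<^sub>F m in sequentially. real m * (exp (x m) - 1) = real m * (L_const m / sqrt 2 - 1)"
    using eventually_ge_at_top[of 1] by eventually_elim (simp only: L_const_eq x_def)
  ultimately show ?thesis by (rule Lim_transform_eventually)
qed

lemma L_const_expansion:
  "(\<lambda>m. L_const m / sqrt 2 - (1 - ln 2 / (4 * real m))) \<in> o[sequentially](\<lambda>m. 1 / real m)"
proof (rule smalloI_tendsto)
  have "(\<lambda>m. real m * (L_const m / sqrt 2 - 1) + ln 2 / 4) \<longlonglongrightarrow> - ln 2 / 4 + ln 2 / 4"
    by (intro tendsto_intros L_const_first_order)
  then have "(\<lambda>m. real m * (L_const m / sqrt 2 - 1) + ln 2 / 4) \<longlonglongrightarrow> 0" by simp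
  moreover have "\<forall>\<^sub>F m in sequentially. real m * (L_const m / sqrt 2 - 1) + ln 2 / 4
      = (L_const m / sqrt 2 - (1 - ln 2 / (4 * real m))) / (1 / real m)"
    using eventually_gt_at_top[of 0] by eventually_elim (simp add: field_simps)
  ultimately show "(\<lambda>m. (L_const m / sqrt 2 - (1 - ln 2 / (4 * real m))) / (1 / real m)) \<longlonglongrightarrow> 0"
    by (rule Lim_transform_eventually)
  show "\<forall>\<^sub>F m in sequentially. 1 / real m \<noteq> 0"
    using eventually_gt_at_top[of 0] by eventually_elim simp
qed

lemma L_const_limit: "L_const \<longlonglongrightarrow> sqrt 2"
proof -
  have "(\<lambda>m. sqrt 2 * (1 + real m * (L_const m / sqrt 2 - 1) * (1 / real m))) \<longlonglongrightarrow> sqrt 2 * (1 + - ln 2 / 4 * 0)"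
    by (intro tendsto_intros L_const_first_order lim_1_over_n)
  then have "(\<lambda>m. sqrt 2 * (1 + real m * (L_const m / sqrt 2 - 1) * (1 / real m))) \<longlonglongrightarrow> sqrt 2" by simp
  moreover have "\<forall>\<^sub>F m in sequentially. sqrt 2 * (1 + real m * (L_const m / sqrt 2 - 1) * (1 / real m)) = L_const m"
    using eventually_gt_at_top[of 0] by eventually_elim simp
  ultimately show ?thesis by (rule Lim_transform_eventually)
qed

text \<open>Since \<open>D_m <= sqrt 2\<close>, the constant lies between \<open>L_m\<close> and
  \<open>sqrt 2\<close>, and the resulting bound does not involve \<open>n\<close>.\<close>

lemma best_const_deviation:
  assumes "2 \<le> m" "1 \<le> n"
  shows "\<bar>best_const 2 m n - ereal (sqrt 2)\<bar> \<le> ereal (sqrt 2 - L_const m)"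
proof -
  have D: "D_const m \<le> sqrt 2" by (simp add: D_const_def)
  note b = best_const_ge[OF assms] best_const_le[OF assms(1), of n]
  \<comment> \<open>Lying between two real numbers, the extended real is finite, which reduces the
    claim to real arithmetic.\<close>
  then obtain c where c: "best_const 2 m n = ereal c" by (cases "best_const 2 m n") auto
  show ?thesis using b D unfolding c by simp
qed

theorem theorem1p4:
  shows "(\<forall>m n::nat. m \<ge> 2 \<longrightarrow> n \<ge> 1 \<longrightarrow>
            ereal (L_const m) \<le> best_const 2 m n \<and> best_const 2 m n \<le> ereal (D_const m)) \<and>
         (\<lambda>m. L_const m / sqrt 2 - (1 - ln 2 / (4 * real m))) \<in> o[sequentially](\<lambda>m. 1 / real m) \<and>
         (\<lambda>m. SUP n\<in>{1::nat..}. \<bar>best_const 2 m n - ereal (sqrt 2)\<bar>) \<longlonglongrightarrow> 0"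
proof (intro conjI)
  show "\<forall>m n::nat. m \<ge> 2 \<longrightarrow> n \<ge> 1 \<longrightarrow>
            ereal (L_const m) \<le> best_const 2 m n \<and> best_const 2 m n \<le> ereal (D_const m)"
    using best_const_ge best_const_le by blast
  show "(\<lambda>m. L_const m / sqrt 2 - (1 - ln 2 / (4 * real m))) \<in> o[sequentially](\<lambda>m. 1 / real m)"
    by (rule L_const_expansion)
  show "(\<lambda>m. SUP n\<in>{1::nat..}. \<bar>best_const 2 m n - ereal (sqrt 2)\<bar>) \<longlonglongrightarrow> 0"
  proof (rule tendsto_sandwich[OF _ _ tendsto_const])
    have "(\<lambda>m. sqrt 2 - L_const m) \<longlonglongrightarrow> sqrt 2 - sqrt 2"
      by (intro tendsto_intros L_const_limit)
    then have "(\<lambda>m. sqrt 2 - L_const m) \<longlonglongrightarrow> 0" by simp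
    then show "(\<lambda>m. ereal (sqrt 2 - L_const m)) \<longlonglongrightarrow> 0"
      unfolding zero_ereal_def by (rule tendsto_ereal)
    show "\<forall>\<^sub>F m in sequentially. (SUP n\<in>{1::nat..}. \<bar>best_const 2 m n - ereal (sqrt 2)\<bar>) \<le> ereal (sqrt 2 - L_const m)"
      using eventually_ge_at_top[of 2]
      by eventually_elim (auto intro!: SUP_least best_const_deviation)
    show "\<forall>\<^sub>F m in sequentially. 0 \<le> (SUP n\<in>{1::nat..}. \<bar>best_const 2 m n - ereal (sqrt 2)\<bar>)"
      by (intro always_eventually allI SUP_upper2[of 1]) auto
  qed
qed

end
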